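(* There is a randomized algorithm in the $\mathsf{LOCAL}$ model which, for any covering integer linear programming problem and any $0<\varepsilon<1$, computes a $(1+\varepsilon)$-approximate solution in $O\left(\frac{(\log\log n+\log(1/\varepsilon))^3\cdot\log n}{\varepsilon}\right)$ rounds with probability $1-1/\operatorname{poly}(n)$, where $n$ is the number of variables.
   Context: A covering problem: given $A\in\mathbb{R}_{\ge0}^{m\times n}$, $b\in\mathbb{R}_{\ge0}^m$, $w\in\mathbb{Z}_{\ge0}^n$, find $x\in\{0,1\}^n$ minimizing $w^\intercal x$ subject to $Ax\ge b$. It is assumed that $\|w\|_1=\sum_i w_i$ is polynomial in $n$. A $(1+\varepsilon)$-approximate solution is a feasible $x$ with $w^\intercal x\le(1+\varepsilon)\cdot\mathrm{OPT}$. Distributed model: the problem is modeled by the hypergraph $H$ whose vertices are the variables $x_1,\dots,x_n$ and whose hyperedges are, for each constraint $j$, the set $\{x_i: A_{j,i}\neq 0\}$. The $\mathsf{LOCAL}$ model on $H$: synchronous rounds, in each round each vertex may exchange messages of arbitrary size with every vertex sharing a hyperedge with it and perform arbitrary local computation; vertices have independent local random bits; each vertex outputs the value of its variable. A polynomial upper bound $\tilde n$ with $\max(n,\mathrm{OPT})\le\tilde n\le\max(n,\mathrm{OPT})^c$ ($c\ge1$ a universal constant) is known to all vertices. "With probability $1-1/\operatorname{poly}(n)$" means with probability at least $1-n^{-c'}$ for a suitably large constant $c'$. *)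

theory Defs
  imports "HOL-Probability.Probability"
begin

section \<open>Covering problems\<close>

text \<open>
  Variables are indexed by \<open>{..<num_vars P}\<close> and constraints by \<open>{..<num_cons P}\<close>;
  \<open>coef P j i\<close> is the entry in row \<open>j\<close> and column \<open>i\<close> of the constraint matrix.
  Values outside these ranges are never used.
\<close>

record covering_problem =
  num_vars :: nat
  num_cons :: nat
  coef :: "nat \<Rightarrow> nat \<Rightarrow> real"
  rhs :: "nat \<Rightarrow> real"
  weight :: "nat \<Rightarrow> nat"

definition valid_problem :: "covering_problem \<Rightarrow> bool" where
  "valid_problem P \<longleftrightarrow>
     1 \<le> num_vars P \<and>
     (\<forall>j<num_cons P. 0 \<le> rhs P j \<and> (\<forall>i<num_vars P. 0 \<le> coef P j i))"

definition feasible :: "covering_problem \<Rightarrow> (nat \<Rightarrow> nat) \<Rightarrow> bool" where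
  "feasible P x \<longleftrightarrow>
     (\<forall>i<num_vars P. x i \<in> {0, 1}) \<and>
     (\<forall>j<num_cons P. (\<Sum>i<num_vars P. coef P j i * real (x i)) \<ge> rhs P j)"

definition cost :: "covering_problem \<Rightarrow> (nat \<Rightarrow> nat) \<Rightarrow> nat" where
  "cost P x = (\<Sum>i<num_vars P. weight P i * x i)"

text \<open>The infimum is over a set of naturals, hence a minimum whenever some \<open>x\<close> is feasible.\<close>

definition opt :: "covering_problem \<Rightarrow> nat" where
  "opt P = (INF x\<in>{x. feasible P x}. cost P x)"

definition approx_solution :: "covering_problem \<Rightarrow> real \<Rightarrow> (nat \<Rightarrow> nat) \<Rightarrow> bool" where
  "approx_solution P \<epsilon> x \<longleftrightarrow> feasible P x \<and> real (cost P x) \<le> (1 + \<epsilon>) * real (opt P)"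


section \<open>The communication hypergraph\<close>

definition hyperedge :: "covering_problem \<Rightarrow> nat \<Rightarrow> nat set" where
  "hyperedge P j = {i. i < num_vars P \<and> coef P j i \<noteq> 0}"

definition neighbours :: "covering_problem \<Rightarrow> nat \<Rightarrow> nat set" where
  "neighbours P v = {u. u \<noteq> v \<and> (\<exists>j<num_cons P. u \<in> hyperedge P j \<and> v \<in> hyperedge P j)}"

text \<open>
  Vertices have no identifiers.  Each vertex \<open>v\<close> addresses its neighbours through local ports
  \<open>0, 1, \<dots>\<close>: its port \<open>p\<close> leads to \<open>nb v ! p\<close>.  The numbering is arbitrary, and the
  numberings at different vertices are unrelated.
\<close>

definition port_numbering :: "covering_problem \<Rightarrow> (nat \<Rightarrow> nat list) \<Rightarrow> bool" where
  "port_numbering P nb \<longleftrightarrow>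
     (\<forall>v<num_vars P. distinct (nb v) \<and> set (nb v) = neighbours P v)"

definition port_to :: "(nat \<Rightarrow> nat list) \<Rightarrow> nat \<Rightarrow> nat \<Rightarrow> nat" where
  "port_to nb u v = (THE q. q < length (nb u) \<and> nb u ! q = v)"


section \<open>Randomized algorithms in the LOCAL model\<close>

text \<open>
  What a vertex knows at the start: the approximation parameter, the common upper bound
  \<open>in_bound\<close>, its own weight, its number of ports, and the constraints it occurs in.
  A constraint is given to the vertex as a triple of the right-hand side, the vertex's own
  coefficient, and the list of its neighbours' coefficients in the order of the ports (zero for
  a neighbour outside the hyperedge).  Neither the vertex's index, nor the indices of the
  constraints, nor \<open>num_vars\<close> and \<open>num_cons\<close> are revealed.
\<close>

record local_input =
  in_eps :: real
  in_bound :: nat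
  in_weight :: nat
  in_degree :: nat
  in_constraints :: "(real \<times> real \<times> real list) set"

definition input_of ::
  "covering_problem \<Rightarrow> real \<Rightarrow> nat \<Rightarrow> (nat \<Rightarrow> nat list) \<Rightarrow> nat \<Rightarrow> local_input" where
  "input_of P \<epsilon> N nb v =
     \<lparr> in_eps = \<epsilon>,
       in_bound = N,
       in_weight = weight P v,
       in_degree = length (nb v),
       in_constraints =
         {(rhs P j, coef P j v, map (coef P j) (nb v)) |j. j < num_cons P \<and> v \<in> hyperedge P j} \<rparr>"

text \<open>
  All components are arbitrary functions, since local computation is not restricted.
  The number of rounds may depend only on quantities that every vertex knows.
  \<open>start\<close> receives the vertex's private random bits, \<open>send s p\<close> is the message sent through
  port \<open>p\<close> in state \<open>s\<close>, and \<open>receive s ms\<close> is the next state when the message \<open>ms ! p\<close>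
  arrives through port \<open>p\<close>.
\<close>

record ('s, 'm) local_algorithm =
  rounds :: "real \<Rightarrow> nat \<Rightarrow> nat"
  start :: "local_input \<Rightarrow> (nat \<Rightarrow> bool) \<Rightarrow> 's"
  send :: "'s \<Rightarrow> nat \<Rightarrow> 'm"
  receive :: "'s \<Rightarrow> 'm list \<Rightarrow> 's"
  result :: "'s \<Rightarrow> nat"

text \<open>
  One cannot quantify existentially over the types of states and messages, so they are
  instantiated with a type that is closed under forming finite sequences and contains the
  coefficients and the random bits.  Messages thus have no size bound.
\<close>

datatype data = Num real | Bits "nat \<Rightarrow> bool" | Seq "data list"

primrec state_after ::
  "('s, 'm) local_algorithm \<Rightarrow> covering_problem \<Rightarrow> real \<Rightarrow> nat \<Rightarrow> (nat \<Rightarrow> nat list) \<Rightarrow>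
   (nat \<Rightarrow> nat \<Rightarrow> bool) \<Rightarrow> nat \<Rightarrow> nat \<Rightarrow> 's" where
  "state_after Alg P \<epsilon> N nb \<omega> 0 = (\<lambda>v. start Alg (input_of P \<epsilon> N nb v) (\<omega> v))"
| "state_after Alg P \<epsilon> N nb \<omega> (Suc t) =
     (\<lambda>v. receive Alg (state_after Alg P \<epsilon> N nb \<omega> t v)
            (map (\<lambda>u. send Alg (state_after Alg P \<epsilon> N nb \<omega> t u) (port_to nb u v)) (nb v)))"

definition output_of ::
  "('s, 'm) local_algorithm \<Rightarrow> covering_problem \<Rightarrow> real \<Rightarrow> nat \<Rightarrow> (nat \<Rightarrow> nat list) \<Rightarrow>
   (nat \<Rightarrow> nat \<Rightarrow> bool) \<Rightarrow> nat \<Rightarrow> nat" where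
  "output_of Alg P \<epsilon> N nb \<omega> v =
     result Alg (state_after Alg P \<epsilon> N nb \<omega> (rounds Alg \<epsilon> N) v)"

text \<open>Every vertex owns an infinite sequence of fair bits; all bits are independent.\<close>

definition random_bits :: "covering_problem \<Rightarrow> (nat \<Rightarrow> nat \<Rightarrow> bool) measure" where
  "random_bits P =
     (\<Pi>\<^sub>M v\<in>{..<num_vars P}. \<Pi>\<^sub>M k\<in>(UNIV :: nat set). measure_pmf (bernoulli_pmf (1/2)))"

definition success_event ::
  "('s, 'm) local_algorithm \<Rightarrow> covering_problem \<Rightarrow> real \<Rightarrow> nat \<Rightarrow> (nat \<Rightarrow> nat list) \<Rightarrow>
   (nat \<Rightarrow> nat \<Rightarrow> bool) set" where
  "success_event Alg P \<epsilon> N nb =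
     {\<omega> \<in> space (random_bits P). approx_solution P \<epsilon> (output_of Alg P \<epsilon> N nb \<omega>)}"

end

theory Submission
  imports Defs
begin

text \<open>
  Give every vertex a geometric shift with a small parameter and let it join every centre whose
  shifted distance is within two of the best one.  Then each hyperedge lies inside one of the
  resulting clusters and, by memorylessness, few vertices lie in several clusters, so solving all
  clusters optimally gives a feasible solution of small expected excess.  The excess concentrates
  once every ball of the size of a cluster carries only a tiny part of the optimum.

  To reach that situation, average polynomially many such covers.  This yields a locally
  computable measure of total mass \<open>O(OPT)\<close> that dominates the local optimum of every vertex set;
  dividing it by the mass of a large ball turns it into a density.  At level \<open>i = 0, 1, \<dots>\<close> centres
  are sampled with probability proportional to \<open>2 ^ i\<close> times their density, and around each centre
  the cheapest of several concentric rings is cut out.  Only vertices all of whose neighbourhoods so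
  far had density at most \<open>2 ^ -i\<close> count for a ring at level \<open>i\<close>, and double counting bounds the
  total cost of the chosen rings by a small fraction of \<open>OPT\<close>.  With high probability every
  vertex whose neighbourhood exceeds density \<open>2 ^ -(i + 1)\<close> is enclosed by a ring at level \<open>i\<close>, so
  after logarithmically many levels only light vertices remain, and one more cover handles them.
  The rings, the classes of vertices enclosed by the same rings, and the parts of the final cover
  are solved optimally.

  Everything depends on a neighbourhood of radius \<open>O(L\<^sup>2 * log n / \<epsilon>)\<close> for
  \<open>L = log log n + log (1 / \<epsilon>)\<close>, which the vertices collect before they decide; sequences of random
  numbers serve as names.
\<close>

subsection \<open>Concentration under limited dependence\<close>

text \<open>The obstacle is the failure probability. A single cover has small excess in expectation,
  but in a heavy region that excess rides on a few shifts and need not concentrate, and repetition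
  does not help because no vertex can compare global costs. The optimum itself cannot be seen
  locally either. Averages of covers replace it: one run costs \<open>O(OPT)\<close> only in
  expectation, yet never more than \<open>n * OPT\<close>, so \<open>k * n\<close> independent runs
  suffice for the average to concentrate. The levels keep sampling cheap. Sampling at once at the
  rate that hits every ball of density \<open>2 ^ -t\<close> would put about
  \<open>2 ^ t * k\<close> rings around a vertex in a dense region. At level \<open>i\<close> only
  regions of density at most \<open>2 ^ -i\<close> are charged, so each vertex pays for
  \<open>O(k)\<close> rings in expectation, each costing a \<open>1 / g\<close> fraction of its
  ball. Here \<open>k\<close> is of order \<open>log n\<close>, \<open>2 ^ b\<close> at most of
  order \<open>1 / \<epsilon>\<close>, \<open>t\<close> of order \<open>L\<close> and
  \<open>g\<close> at most of order \<open>t * k / \<epsilon>\<close>. The shifts need radius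
  \<open>k * 2 ^ b\<close> and the rings \<open>3 * g * t\<close>, which dominates.\<close>

lemma sum_UN_le:
  fixes f :: "'a \<Rightarrow> 'b :: ordered_comm_monoid_add"
  assumes "finite I" "\<And>i. i \<in> I \<Longrightarrow> finite (A i)" "\<And>x. 0 \<le> f x"
  shows "sum f (\<Union>i\<in>I. A i) \<le> (\<Sum>i\<in>I. sum f (A i))"
  using assms(1,2)
proof (induction I rule: finite_induct)
  case (insert i I)
  have "sum f (\<Union>i\<in>insert i I. A i) \<le> sum f (A i \<union> (\<Union>i\<in>I. A i)) + sum f (A i \<inter> (\<Union>i\<in>I. A i))"
    using assms(3) by (simp add: add_increasing2 sum_nonneg)
  also have "\<dots> = sum f (A i) + sum f (\<Union>i\<in>I. A i)"
    using insert by (intro sum.union_inter) auto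
  finally show ?case using insert by (auto intro: order_trans add_left_mono)
qed simp

text \<open>Fubini: a bound that holds for every fixed assignment \<open>f\<close> to the
  coordinates in \<open>A\<close> survives averaging over \<open>f\<close>. Comparing with a second
  event \<open>Q\<close> instead of a constant is what conditioning needs: \<open>Q\<close> plays
  the role of the event conditioned on.\<close>

lemma Pi_pmf_union_prob_mono:
  assumes "finite A" "finite B" "A \<inter> B = {}" "0 \<le> c"
    and le: "\<And>f. measure_pmf.prob (Pi_pmf B d p) {g. P (\<lambda>x. if x \<in> A then f x else g x)}
      \<le> c * measure_pmf.prob (Pi_pmf B d p) {g. Q (\<lambda>x. if x \<in> A then f x else g x)}"
  shows "measure_pmf.prob (Pi_pmf (A \<union> B) d p) {h. P h}
    \<le> c * measure_pmf.prob (Pi_pmf (A \<union> B) d p) {h. Q h}"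
proof -
  let ?A = "Pi_pmf A d p" and ?B = "Pi_pmf B d p"
  let ?mg = "\<lambda>f g x. if x \<in> A then f x else g x"
  have *: "emeasure (measure_pmf (Pi_pmf (A \<union> B) d p)) {h. R h}
      = (\<integral>\<^sup>+f. emeasure ?B {g. R (?mg f g)} \<partial>?A)" for R
  proof -
    have "emeasure (measure_pmf (Pi_pmf (A \<union> B) d p)) {h. R h}
        = (\<integral>\<^sup>+x. indicator {h. R h} x \<partial>Pi_pmf (A \<union> B) d p)" by simp
    also have "\<dots> = (\<integral>\<^sup>+f. \<integral>\<^sup>+g. indicator {h. R h} (?mg f g) \<partial>?B \<partial>?A)"
      by (simp add: Pi_pmf_union assms nn_integral_pair_pmf' case_prod_unfold
          del: nn_integral_indicator cong: if_cong)
    also have "\<dots> = (\<integral>\<^sup>+f. emeasure ?B {g. R (?mg f g)} \<partial>?A)"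
    proof (rule nn_integral_cong)
      fix f
      have "(\<integral>\<^sup>+g. indicator {h. R h} (?mg f g) \<partial>?B) = (\<integral>\<^sup>+g. indicator {g. R (?mg f g)} g \<partial>?B)"
        by (intro nn_integral_cong) (auto simp: indicator_def)
      then show "(\<integral>\<^sup>+g. indicator {h. R h} (?mg f g) \<partial>?B) = emeasure ?B {g. R (?mg f g)}" by simp
    qed
    finally show ?thesis .
  qed
  have "emeasure (measure_pmf (Pi_pmf (A \<union> B) d p)) {h. P h}
      \<le> (\<integral>\<^sup>+f. ennreal c * emeasure ?B {g. Q (?mg f g)} \<partial>?A)"
    unfolding * using le \<open>0 \<le> c\<close>
    by (intro nn_integral_mono) (simp add: measure_pmf.emeasure_eq_measure flip: ennreal_mult)
  also have "\<dots> = ennreal c * emeasure (measure_pmf (Pi_pmf (A \<union> B) d p)) {h. Q h}"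
    unfolding * by (simp add: nn_integral_cmult)
  finally show ?thesis using \<open>0 \<le> c\<close>
    by (simp add: measure_pmf.emeasure_eq_measure flip: ennreal_mult)
qed

lemma Pi_pmf_union_prob_le:
  assumes "finite A" "finite B" "A \<inter> B = {}" "0 \<le> c"
    and "\<And>f. measure_pmf.prob (Pi_pmf B d p) {g. P (\<lambda>x. if x \<in> A then f x else g x)} \<le> c"
  shows "measure_pmf.prob (Pi_pmf (A \<union> B) d p) {h. P h} \<le> c"
  using Pi_pmf_union_prob_mono[of A B c d p P "\<lambda>_. True"] assms by simp

text \<open>Factors that read disjoint blocks of independent coordinates are independent. The
  induction peels off one block: after splitting the coordinates into \<open>J u\<close> and the
  rest, the factor of \<open>u\<close> ignores the second part and all others ignore the
  first.\<close>

lemma nn_integral_Pi_pmf_disjoint: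
  fixes F :: "'u \<Rightarrow> ('i \<Rightarrow> 'b) \<Rightarrow> ennreal"
  assumes "finite U" and A: "finite A" and "disjoint_family_on J U"
    and dep: "\<And>u f g. u \<in> U \<Longrightarrow> (\<And>x. x \<in> J u \<Longrightarrow> f x = g x) \<Longrightarrow> F u f = F u g"
    and sub: "\<And>u. u \<in> U \<Longrightarrow> J u \<subseteq> A"
  shows "(\<integral>\<^sup>+\<omega>. (\<Prod>u\<in>U. F u \<omega>) \<partial>Pi_pmf A d p) = (\<Prod>u\<in>U. \<integral>\<^sup>+\<omega>. F u \<omega> \<partial>Pi_pmf A d p)"
  using assms(1,3-)
proof (induction U rule: finite_induct)
  case empty
  then show ?case by simp
next
  case (insert u U)
  let ?A1 = "J u" and ?A2 = "A - J u"
  let ?P = "Pi_pmf A d p" and ?P1 = "Pi_pmf ?A1 d p" and ?P2 = "Pi_pmf ?A2 d p"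
  let ?mg = "\<lambda>f g x. if x \<in> ?A1 then f x else g x"
  have fin: "finite ?A1" "finite ?A2" using A insert.prems(3)[of u] finite_subset by auto
  have AA: "A = ?A1 \<union> ?A2" using insert.prems(3)[of u] by auto
  have split: "(\<integral>\<^sup>+\<omega>. H \<omega> \<partial>?P) = (\<integral>\<^sup>+f. \<integral>\<^sup>+g. H (?mg f g) \<partial>?P2 \<partial>?P1)" for H :: "_ \<Rightarrow> ennreal"
    by (subst AA, subst Pi_pmf_union[OF fin])
       (auto simp: nn_integral_pair_pmf' case_prod_unfold cong: if_cong)
  have Fu: "F u (?mg f g) = F u f" for f g
    by (rule insert.prems(2)) auto
  have Fv: "F v (?mg f g) = F v g" if "v \<in> U" for v f g
  proof (rule insert.prems(2))
    show "v \<in> insert u U" using that by simp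
    fix x assume "x \<in> J v"
    then have "x \<notin> J u"
      using insert.prems(1) insert.hyps that by (auto simp: disjoint_family_on_def)
    then show "?mg f g x = g x" by simp
  qed
  have "(\<integral>\<^sup>+\<omega>. (\<Prod>u\<in>insert u U. F u \<omega>) \<partial>?P) = (\<integral>\<^sup>+f. \<integral>\<^sup>+g. F u f * (\<Prod>v\<in>U. F v g) \<partial>?P2 \<partial>?P1)"
    unfolding split using insert.hyps by (simp add: Fu Fv)
  also have "\<dots> = (\<integral>\<^sup>+f. F u f \<partial>?P1) * (\<integral>\<^sup>+g. (\<Prod>v\<in>U. F v g) \<partial>?P2)"
    by (simp add: nn_integral_cmult nn_integral_multc)
  also have "(\<integral>\<^sup>+f. F u f \<partial>?P1) = (\<integral>\<^sup>+\<omega>. F u \<omega> \<partial>?P)"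
    unfolding split by (simp add: Fu)
  also have "(\<integral>\<^sup>+g. (\<Prod>v\<in>U. F v g) \<partial>?P2) = (\<integral>\<^sup>+\<omega>. (\<Prod>v\<in>U. F v \<omega>) \<partial>?P)"
    unfolding split by (simp add: Fv)
  also have "\<dots> = (\<Prod>v\<in>U. \<integral>\<^sup>+\<omega>. F v \<omega> \<partial>?P)"
  proof (rule insert.IH)
    show "disjoint_family_on J U" using insert.prems(1) by (auto simp: disjoint_family_on_def)
    show "\<And>v f g. v \<in> U \<Longrightarrow> (\<And>x. x \<in> J v \<Longrightarrow> f x = g x) \<Longrightarrow> F v f = F v g"
      using insert.prems(2) by blast
    show "\<And>v. v \<in> U \<Longrightarrow> J v \<subseteq> A" using insert.prems(3) by blast
  qed
  finally show ?case using insert.hyps by simp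
qed

section \<open>Sums over tuples of pairwise far indices\<close>

definition far_lists :: "('u \<Rightarrow> 'u \<Rightarrow> bool) \<Rightarrow> 'u set \<Rightarrow> nat \<Rightarrow> 'u list set" where
  "far_lists far U k = {xs. length xs = k \<and> set xs \<subseteq> U \<and> sorted_wrt far xs}"

lemma finite_far_lists: "finite U \<Longrightarrow> finite (far_lists far U k)"
  unfolding far_lists_def
  by (rule finite_subset[OF _ finite_lists_length_eq[of U k]]) auto

lemma far_lists_0: "far_lists far U 0 = {[]}"
  by (auto simp: far_lists_def)

lemma far_lists_Suc:
  "far_lists far U (Suc k) =
    (\<lambda>(xs, x). x # xs) ` (SIGMA xs:far_lists far U k. {x\<in>U. \<forall>y\<in>set xs. far x y})"
proof -
  have "ys \<in> far_lists far U (Suc k) \<longleftrightarrow> (\<exists>x xs. ys = x # xs \<and> xs \<in> far_lists far U k \<and> x \<in> U \<and> (\<forall>y\<in>set xs. far x y))" for ys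
    by (cases ys) (auto simp: far_lists_def)
  then show ?thesis by (auto simp: image_iff)
qed

lemma sum_far_lists_Suc:
  fixes z :: "'u \<Rightarrow> real"
  assumes "finite U"
  shows "(\<Sum>xs\<in>far_lists far U (Suc k). prod_list (map z xs)) =
    (\<Sum>xs\<in>far_lists far U k. prod_list (map z xs) * (\<Sum>x\<in>{x\<in>U. \<forall>y\<in>set xs. far x y}. z x))"
proof -
  have inj: "inj_on (\<lambda>(xs, x). x # xs) (SIGMA xs:far_lists far U k. {x\<in>U. \<forall>y\<in>set xs. far x y})"
    by (auto simp: inj_on_def)
  have "(\<Sum>xs\<in>far_lists far U (Suc k). prod_list (map z xs)) =
    (\<Sum>(xs, x)\<in>(SIGMA xs:far_lists far U k. {x\<in>U. \<forall>y\<in>set xs. far x y}). prod_list (map z xs) * z x)"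
    unfolding far_lists_Suc sum.reindex[OF inj] by (intro sum.cong) (auto simp: mult.commute)
  also have "\<dots> = (\<Sum>xs\<in>far_lists far U k. \<Sum>x\<in>{x\<in>U. \<forall>y\<in>set xs. far x y}. prod_list (map z xs) * z x)"
    using assms by (subst sum.Sigma) (auto simp: finite_far_lists)
  finally show ?thesis by (simp add: sum_distrib_left)
qed

text \<open>Every index chosen so far blocks mass at most \<open>B\<close>, hence all of them at
  most \<open>n * B\<close>, so at least \<open>c\<close> is left for the next choice. The bound
  uses a fixed \<open>n \<ge> k\<close> so that the hypothesis on the total does not change during
  the induction on \<open>k\<close>.\<close>

lemma sum_far_lists_ge:
  fixes z :: "'u \<Rightarrow> real"
  assumes "finite U" and z: "\<And>u. u \<in> U \<Longrightarrow> 0 \<le> z u"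
    and near: "\<And>u. u \<in> U \<Longrightarrow> (\<Sum>v\<in>{v\<in>U. \<not> far v u}. z v) \<le> B"
    and "0 \<le> B" "0 \<le> c" "k \<le> n" and s: "c + real n * B \<le> (\<Sum>u\<in>U. z u)"
  shows "c ^ k \<le> (\<Sum>xs\<in>far_lists far U k. prod_list (map z xs))"
  using \<open>k \<le> n\<close>
proof (induction k)
  case 0
  then show ?case by (simp add: far_lists_0)
next
  case (Suc k)
  have pl: "0 \<le> prod_list (map z xs)" if "xs \<in> far_lists far U k" for xs
    using that z by (intro prod_list_nonneg) (auto simp: far_lists_def)
  have "c ^ Suc k = c ^ k * c" by simp
  also have "\<dots> \<le> (\<Sum>xs\<in>far_lists far U k. prod_list (map z xs)) * c"
    using Suc \<open>0 \<le> c\<close> by (intro mult_right_mono) auto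
  also have "\<dots> = (\<Sum>xs\<in>far_lists far U k. prod_list (map z xs) * c)"
    by (simp add: sum_distrib_right)
  also have "\<dots> \<le> (\<Sum>xs\<in>far_lists far U k. prod_list (map z xs) * (\<Sum>x\<in>{x\<in>U. \<forall>y\<in>set xs. far x y}. z x))"
  proof (intro sum_mono mult_left_mono pl)
    fix xs assume xs: "xs \<in> far_lists far U k"
    let ?N = "\<Union>y\<in>set xs. {x\<in>U. \<not> far x y}"
    have fN: "finite ?N" using \<open>finite U\<close> by (rule rev_finite_subset) auto
    have "(\<Sum>x\<in>?N. z x) = (\<Sum>x\<in>?N. if x \<in> U then z x else 0)"
      by (intro sum.cong) auto
    also have "\<dots> \<le> (\<Sum>y\<in>set xs. \<Sum>x\<in>{x\<in>U. \<not> far x y}. if x \<in> U then z x else 0)"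
      using \<open>finite U\<close> z by (intro sum_UN_le) auto
    also have "\<dots> = (\<Sum>y\<in>set xs. \<Sum>x\<in>{x\<in>U. \<not> far x y}. z x)"
      by (intro sum.cong) auto
    also have "\<dots> \<le> (\<Sum>y\<in>set xs. B)"
      using xs by (intro sum_mono near) (auto simp: far_lists_def)
    also have "\<dots> = real (card (set xs)) * B" by simp
    also have "\<dots> \<le> real n * B"
    proof (rule mult_right_mono[OF _ \<open>0 \<le> B\<close>])
      have "card (set xs) \<le> k" using xs card_length[of xs] by (auto simp: far_lists_def)
      then show "real (card (set xs)) \<le> real n" using Suc.prems by linarith
    qed
    finally have "(\<Sum>x\<in>?N. z x) \<le> real n * B" .
    moreover have "(\<Sum>u\<in>U. z u) = (\<Sum>x\<in>?N. z x) + (\<Sum>x\<in>{x\<in>U. \<forall>y\<in>set xs. far x y}. z x)"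
      by (subst sum.union_disjoint[symmetric]) (use \<open>finite U\<close> in \<open>auto intro!: sum.cong\<close>)
    ultimately show "c \<le> (\<Sum>x\<in>{x\<in>U. \<forall>y\<in>set xs. far x y}. z x)" using s by linarith
  qed
  also have "\<dots> = (\<Sum>xs\<in>far_lists far U (Suc k). prod_list (map z xs))"
    using \<open>finite U\<close> by (simp add: sum_far_lists_Suc)
  finally show ?case .
qed

text \<open>Dropping the farness condition only adds nonnegative terms, and the sum over all
  \<open>k\<close>-tuples is the \<open>k\<close>-th power.\<close>

lemma sum_far_lists_le:
  fixes e :: "'u \<Rightarrow> real"
  assumes "finite U" and e: "\<And>u. u \<in> U \<Longrightarrow> 0 \<le> e u"
  shows "(\<Sum>xs\<in>far_lists far U k. prod_list (map e xs)) \<le> (\<Sum>u\<in>U. e u) ^ k"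
proof (induction k)
  case 0
  then show ?case by (simp add: far_lists_0)
next
  case (Suc k)
  have pl: "0 \<le> prod_list (map e xs)" if "xs \<in> far_lists far U k" for xs
    using that e by (intro prod_list_nonneg) (auto simp: far_lists_def)
  have "(\<Sum>xs\<in>far_lists far U (Suc k). prod_list (map e xs))
      \<le> (\<Sum>xs\<in>far_lists far U k. prod_list (map e xs) * (\<Sum>u\<in>U. e u))"
    unfolding sum_far_lists_Suc[OF \<open>finite U\<close>] using assms
    by (intro sum_mono mult_left_mono pl sum_mono2) auto
  also have "\<dots> \<le> (\<Sum>u\<in>U. e u) ^ k * (\<Sum>u\<in>U. e u)"
    using Suc e by (simp add: sum_nonneg mult_right_mono flip: sum_distrib_right)
  finally show ?case by (simp add: mult.commute)
qed

text \<open>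
  If the sum exceeds \<open>2 * \<mu> + k * B\<close>, then choosing \<open>k\<close> pairwise far indices one after the other
  always leaves mass at least \<open>2 * \<mu>\<close>, so the sum of the products over all pairwise far
  \<open>k\<close>-tuples is at least \<open>(2 * \<mu>) ^ k\<close>, whereas its expectation is at most \<open>\<mu> ^ k\<close>.
\<close>
lemma far_tuple_concentration:
  fixes M :: "'a pmf" and Z :: "'u \<Rightarrow> 'a \<Rightarrow> real" and e :: "'u \<Rightarrow> real"
  assumes fin: "finite U" and Z: "\<And>u \<omega>. u \<in> U \<Longrightarrow> 0 \<le> Z u \<omega>" and e: "\<And>u. u \<in> U \<Longrightarrow> 0 \<le> e u"
    and prods: "\<And>xs. set xs \<subseteq> U \<Longrightarrow> sorted_wrt far xs \<Longrightarrow>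
      (\<integral>\<^sup>+\<omega>. ennreal (prod_list (map (\<lambda>u. Z u \<omega>) xs)) \<partial>M) \<le> ennreal (prod_list (map e xs))"
    and near: "\<And>u \<omega>. u \<in> U \<Longrightarrow> (\<Sum>v\<in>{v\<in>U. \<not> far v u}. Z v \<omega>) \<le> B"
    and "0 \<le> B" and mu: "(\<Sum>u\<in>U. e u) \<le> \<mu>"
  shows "measure_pmf.prob M {\<omega>. (\<Sum>u\<in>U. Z u \<omega>) > 2 * \<mu> + real k * B} \<le> (1 / 2) ^ k"
proof (cases "\<mu> > 0")
  \<comment> \<open>The Markov argument below divides by \<open>(2 * \<mu>) ^ k\<close>. Without
    positive mass the claim holds for another reason: every \<open>Z u\<close> has expectation zero,
    so the sum vanishes almost surely.\<close>
  case False
  have "(\<Sum>u\<in>U. e u) \<ge> 0" using e by (intro sum_nonneg)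
  then have mu0: "\<mu> = 0" and "(\<Sum>u\<in>U. e u) = 0" using False mu by linarith+
  then have e0: "e u = 0" if "u \<in> U" for u using that e fin by (simp add: sum_nonneg_eq_0_iff)
  have "AE \<omega> in M. Z u \<omega> = 0" if "u \<in> U" for u
  proof -
    have "(\<integral>\<^sup>+\<omega>. ennreal (Z u \<omega>) \<partial>M) \<le> 0" using prods[of "[u]"] that e0 by simp
    then have "AE \<omega> in M. ennreal (Z u \<omega>) = 0" by (subst (asm) le_zero_eq, subst (asm) nn_integral_0_iff_AE) auto
    then show ?thesis
    proof (rule AE_mp, intro AE_I2 impI)
      fix \<omega> assume "ennreal (Z u \<omega>) = 0"
      then show "Z u \<omega> = 0" using Z[OF that, of \<omega>] by (simp add: ennreal_eq_0_iff)
    qed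
  qed
  then have "AE \<omega> in M. \<forall>u\<in>U. Z u \<omega> = 0" by (intro AE_finite_allI fin)
  then have "AE \<omega> in M. \<not> (\<Sum>u\<in>U. Z u \<omega>) > 2 * \<mu> + real k * B"
  proof (rule AE_mp, intro AE_I2 impI)
    fix \<omega> assume "\<forall>u\<in>U. Z u \<omega> = 0"
    then have "(\<Sum>u\<in>U. Z u \<omega>) = 0" by simp
    then show "\<not> (\<Sum>u\<in>U. Z u \<omega>) > 2 * \<mu> + real k * B" using mu0 \<open>0 \<le> B\<close>
      by (simp add: not_less)
  qed
  then have "measure_pmf.prob M {\<omega>. (\<Sum>u\<in>U. Z u \<omega>) > 2 * \<mu> + real k * B} = 0"
    by (subst measure_pmf.prob_eq_0) auto
  then show ?thesis by simp
next
  case True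
  let ?F = "\<lambda>\<omega>. \<Sum>xs\<in>far_lists far U k. prod_list (map (\<lambda>u. Z u \<omega>) xs)"
  have Fnn: "0 \<le> prod_list (map (\<lambda>u. Z u \<omega>) xs)" if "xs \<in> far_lists far U k" for xs \<omega>
    using that Z by (intro prod_list_nonneg) (auto simp: far_lists_def)
  have "(\<integral>\<^sup>+\<omega>. ennreal (?F \<omega>) \<partial>M) = (\<Sum>xs\<in>far_lists far U k. \<integral>\<^sup>+\<omega>. ennreal (prod_list (map (\<lambda>u. Z u \<omega>) xs)) \<partial>M)"
    using Fnn by (subst nn_integral_sum[symmetric]) (auto simp: sum_ennreal)
  also have "\<dots> \<le> (\<Sum>xs\<in>far_lists far U k. ennreal (prod_list (map e xs)))"
    by (intro sum_mono prods) (auto simp: far_lists_def)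
  also have "\<dots> = ennreal (\<Sum>xs\<in>far_lists far U k. prod_list (map e xs))"
    by (intro sum_ennreal prod_list_nonneg) (auto simp: far_lists_def intro: e)
  also have "\<dots> \<le> ennreal (\<mu> ^ k)"
    using sum_far_lists_le[OF fin e, where far = far and k = k] mu
    by (intro ennreal_leI) (meson order_trans power_mono sum_nonneg e)
  finally have EF: "(\<integral>\<^sup>+\<omega>. ennreal (?F \<omega>) \<partial>M) \<le> ennreal (\<mu> ^ k)" .
  have "ennreal (measure_pmf.prob M {\<omega>. (\<Sum>u\<in>U. Z u \<omega>) > 2 * \<mu> + real k * B})
      \<le> emeasure M {\<omega>\<in>space M. 1 \<le> ennreal (1 / (2 * \<mu>) ^ k) * ennreal (?F \<omega>)}"
    unfolding measure_pmf.emeasure_eq_measure[symmetric]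
  proof (rule emeasure_mono)
    show "{\<omega>. (\<Sum>u\<in>U. Z u \<omega>) > 2 * \<mu> + real k * B}
      \<subseteq> {\<omega>\<in>space M. 1 \<le> ennreal (1 / (2 * \<mu>) ^ k) * ennreal (?F \<omega>)}"
    proof safe
      fix \<omega> assume "(\<Sum>u\<in>U. Z u \<omega>) > 2 * \<mu> + real k * B"
      then have "(2 * \<mu>) ^ k \<le> ?F \<omega>"
        using True \<open>0 \<le> B\<close> by (intro sum_far_lists_ge[OF fin Z near, where n = k]) auto
      then have "1 \<le> 1 / (2 * \<mu>) ^ k * ?F \<omega>" using True by (simp add: field_simps)
      then show "1 \<le> ennreal (1 / (2 * \<mu>) ^ k) * ennreal (?F \<omega>)"
        using True Fnn by (subst ennreal_mult[symmetric]) (auto simp: ennreal_le_1 intro!: sum_nonneg)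
    qed simp
  qed simp
  also have "\<dots> \<le> ennreal (1 / (2 * \<mu>) ^ k) * (\<integral>\<^sup>+\<omega>. ennreal (?F \<omega>) \<partial>M)"
    using nn_integral_Markov_inequality[of "\<lambda>\<omega>. ennreal (?F \<omega>)" UNIV "measure_pmf M" "ennreal (1 / (2 * \<mu>) ^ k)"] by simp
  also have "\<dots> \<le> ennreal (1 / (2 * \<mu>) ^ k) * ennreal (\<mu> ^ k)"
    by (intro mult_left_mono EF) simp
  also have "\<dots> = ennreal ((1 / 2) ^ k)"
    using True by (subst ennreal_mult[symmetric]) (auto simp: power_mult_distrib power_one_over divide_simps)
  finally show ?thesis by simp
qed

text \<open>Indices count as far when they differ and read disjoint coordinates \<open>J u\<close>,
  so products over far tuples have product expectations. The alternative \<open>v = u\<close> in the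
  hypothesis on \<open>B\<close> matters when \<open>J u\<close> is empty: it keeps far tuples free
  of repetitions.\<close>

lemma Pi_pmf_concentration:
  fixes Z :: "'u \<Rightarrow> ('i \<Rightarrow> 'b) \<Rightarrow> real" and e :: "'u \<Rightarrow> real"
  assumes fin: "finite U" and A: "finite A" and Z: "\<And>u \<omega>. u \<in> U \<Longrightarrow> 0 \<le> Z u \<omega>"
    and e: "\<And>u. u \<in> U \<Longrightarrow> (\<integral>\<^sup>+\<omega>. ennreal (Z u \<omega>) \<partial>Pi_pmf A (d :: 'b) p) \<le> ennreal (e u)"
    and e0: "\<And>u. u \<in> U \<Longrightarrow> 0 \<le> e u"
    and dep: "\<And>u (f :: 'i \<Rightarrow> 'b) g. u \<in> U \<Longrightarrow> (\<And>x. x \<in> J u \<Longrightarrow> f x = g x) \<Longrightarrow> Z u f = Z u g"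
    and sub: "\<And>u. u \<in> U \<Longrightarrow> J u \<subseteq> A"
    and near: "\<And>u \<omega>. u \<in> U \<Longrightarrow> (\<Sum>v\<in>{v\<in>U. v = u \<or> J v \<inter> J u \<noteq> {}}. Z v \<omega>) \<le> B"
    and "0 \<le> B" and mu: "(\<Sum>u\<in>U. e u) \<le> \<mu>"
  shows "measure_pmf.prob (Pi_pmf A d p) {\<omega>. (\<Sum>u\<in>U. Z u \<omega>) > 2 * \<mu> + real k * B} \<le> (1 / 2) ^ k"
proof (rule far_tuple_concentration[where far = "\<lambda>u v. \<not> (u = v \<or> J u \<inter> J v \<noteq> {})" and e = e])
  let ?far = "\<lambda>u v. \<not> (u = v \<or> J u \<inter> J v \<noteq> {})"
  fix xs assume xs: "set xs \<subseteq> U" and far: "sorted_wrt ?far xs"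
  have dist: "distinct xs" using far by (induction xs) auto
  have disj: "disjoint_family_on J (set xs)" using far
    by (induction xs) (auto simp: disjoint_family_on_def)
  have "(\<integral>\<^sup>+\<omega>. ennreal (prod_list (map (\<lambda>u. Z u \<omega>) xs)) \<partial>Pi_pmf A d p)
     = (\<integral>\<^sup>+\<omega>. (\<Prod>u\<in>set xs. ennreal (Z u \<omega>)) \<partial>Pi_pmf A d p)"
    using dist xs Z by (intro nn_integral_cong) (auto simp: prod.distinct_set_conv_list[symmetric] prod_ennreal subset_iff)
  also have "\<dots> = (\<Prod>u\<in>set xs. \<integral>\<^sup>+\<omega>. ennreal (Z u \<omega>) \<partial>Pi_pmf A d p)"
  proof (rule nn_integral_Pi_pmf_disjoint[OF _ A disj])
    fix u and f g :: "'i \<Rightarrow> 'b" assume "u \<in> set xs" "\<And>x. x \<in> J u \<Longrightarrow> f x = g x"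
    then show "ennreal (Z u f) = ennreal (Z u g)"
      using xs by (intro arg_cong[of _ _ ennreal] dep) auto
  qed (use xs sub in auto)
  also have "\<dots> \<le> (\<Prod>u\<in>set xs. ennreal (e u))"
    using xs e by (intro prod_mono_ennreal) auto
  also have "\<dots> = ennreal (prod_list (map e xs))"
    using dist xs e0 by (simp add: prod.distinct_set_conv_list[symmetric] prod_ennreal subset_iff)
  finally show "(\<integral>\<^sup>+\<omega>. ennreal (prod_list (map (\<lambda>u. Z u \<omega>) xs)) \<partial>Pi_pmf A d p)
      \<le> ennreal (prod_list (map e xs))" .
next
  fix u \<omega> assume "u \<in> U"
  have "{v\<in>U. \<not> \<not> (v = u \<or> J v \<inter> J u \<noteq> {})} = {v\<in>U. v = u \<or> J v \<inter> J u \<noteq> {}}" by simp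
  then show "(\<Sum>v\<in>{v\<in>U. \<not> \<not> (v = u \<or> J v \<inter> J u \<noteq> {})}. Z v \<omega>) \<le> B"
    using near[OF \<open>u \<in> U\<close>, of \<omega>] by simp
qed (fact fin Z e0 \<open>0 \<le> B\<close> mu)+

subsection \<open>Geometric shifts\<close>

lemma prob_geometric_atLeast:
  assumes "0 < q" "q \<le> 1"
  shows "measure_pmf.prob (geometric_pmf q) {x..} = (1 - q) ^ x"
proof -
  have "measure_pmf.prob (geometric_pmf q) {..<x} = (\<Sum>n<x. (1 - q) ^ n * q)"
    using assms by (simp add: measure_measure_pmf_finite)
  also have "\<dots> = 1 - (1 - q) ^ x"
    using assms sum_gp_strict[of "1 - q" x] by (simp flip: sum_distrib_right)
  finally have "measure_pmf.prob (geometric_pmf q) {..<x} = 1 - (1 - q) ^ x" .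
  moreover have "measure_pmf.prob (geometric_pmf q) (UNIV - {..<x})
      = 1 - measure_pmf.prob (geometric_pmf q) {..<x}"
    using measure_pmf.prob_compl[of "{..<x}" "geometric_pmf q"] by simp
  moreover have "UNIV - {..<x} = {x..}" by auto
  ultimately show ?thesis by simp
qed

text \<open>Memorylessness: the up-set \<open>S\<close> is a tail \<open>{x..}\<close> or empty, and
  a geometric value known to be at least \<open>x\<close> is below \<open>x + d\<close> with
  probability \<open>1 - (1 - q) ^ d\<close>.\<close>

lemma prob_geometric_window:
  assumes q: "0 < q" "q \<le> 1"
    and up: "\<And>x y. x \<in> S \<Longrightarrow> x \<le> y \<Longrightarrow> y \<in> S"
    and win: "\<And>x y. x \<in> S \<Longrightarrow> y \<in> F \<Longrightarrow> y < x + d"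
  shows "measure_pmf.prob (geometric_pmf q) (S \<inter> F)
    \<le> (1 - (1 - q) ^ d) * measure_pmf.prob (geometric_pmf q) S"
proof (cases "S = {}")
  case False
  define x where "x = (LEAST x. x \<in> S)"
  have xS: "x \<in> S" unfolding x_def using False LeastI_ex[of "\<lambda>x. x \<in> S"] by auto
  have S: "S = {x..}"
  proof (intro set_eqI iffI)
    fix y assume "y \<in> S"
    then show "y \<in> {x..}" unfolding x_def by (simp add: Least_le)
  qed (use up[OF xS] in simp)
  have "S \<inter> F \<subseteq> {x..} - {x + d..}"
  proof
    fix y assume y: "y \<in> S \<inter> F"
    then show "y \<in> {x..} - {x + d..}" using win[OF xS, of y] S by simp
  qed
  then have "measure_pmf.prob (geometric_pmf q) (S \<inter> F) \<le> measure_pmf.prob (geometric_pmf q) ({x..} - {x + d..})"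
    by (intro measure_pmf.finite_measure_mono) auto
  also have "\<dots> = (1 - q) ^ x - (1 - q) ^ (x + d)"
    using q by (subst measure_pmf.finite_measure_Diff) (auto simp: prob_geometric_atLeast)
  also have "\<dots> = (1 - (1 - q) ^ d) * measure_pmf.prob (geometric_pmf q) S"
    unfolding S using q by (simp add: prob_geometric_atLeast power_add algebra_simps)
  finally show ?thesis .
qed simp

lemma top_set_exists:
  fixes key :: "'v \<Rightarrow> nat"
  assumes "finite W" "inj_on key W" "j \<le> card W"
  shows "\<exists>A\<subseteq>W. card A = j \<and> (\<forall>a\<in>A. \<forall>c\<in>W - A. key c < key a)"
  using assms(3)
proof (induction j)
  case (Suc j)
  then obtain A where A: "A \<subseteq> W" "card A = j" "\<forall>a\<in>A. \<forall>c\<in>W - A. key c < key a" by auto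
  have ne: "W - A \<noteq> {}" using A Suc.prems by auto
  have fin: "finite (W - A)" using assms by auto
  obtain x where x: "x \<in> W - A" "key x = Max (key ` (W - A))"
    using Max_in[of "key ` (W - A)"] fin ne by (metis finite_imageI image_iff image_is_empty)
  have xm: "key c < key x" if "c \<in> W - insert x A" for c
  proof -
    have "key c \<le> key x" using that x fin by auto
    moreover have "key c \<noteq> key x" using that x inj_onD[OF assms(2)] by auto
    ultimately show ?thesis by simp
  qed
  have "card (insert x A) = Suc j" using A x finite_subset[OF _ assms(1)] by auto
  then show ?case using A x xm by (intro exI[of _ "insert x A"]) auto
qed (auto intro: exI[of _ "{}"])

text \<open>
  The \<open>j\<close> largest values of \<open>T c - D c\<close> (with ties broken by a key) form a set \<open>A\<close>.  Given \<open>A\<close>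
  and the values outside \<open>A\<close>, the coordinates in \<open>A\<close> are independent geometric variables
  conditioned to exceed a threshold, and by memorylessness each of them stays within a window of
  length three above its threshold with probability at most \<open>1 - (1 - q)^3\<close>.
\<close>
lemma prob_many_near_max:
  fixes D :: "'v \<Rightarrow> nat" and p :: real
  assumes q: "0 < q" "q \<le> 1" and W: "finite W" and I: "finite I" "J ` W \<subseteq> I" "inj_on J W"
  defines "p \<equiv> 1 - (1 - q) ^ 3"
  shows "measure_pmf.prob (Pi_pmf I d (\<lambda>_. geometric_pmf q))
    {T. j + 1 \<le> card {c\<in>W. \<forall>c'\<in>W. T (J c') + D c \<le> T (J c) + D c' + 2}} \<le> p ^ j"
proof -
  let ?P = "Pi_pmf I d (\<lambda>_. geometric_pmf q)"
  obtain rk :: "'v \<Rightarrow> nat" where rk: "inj_on rk W"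
    using finite_imp_inj_to_nat_seg[OF W] by blast
  define n where "n = Suc (Max (insert 0 (rk ` W)))"
  have rkn: "rk c < n" if "c \<in> W" for c
    using that W by (simp add: n_def less_Suc_eq_le)
  \<comment> \<open>Adding the constant \<open>H\<close> turns \<open>T c - D c\<close> into a
    natural number without changing any comparison.\<close>
  define H where "H = Max (insert 0 (D ` W))"
  have DH: "D c \<le> H" if "c \<in> W" for c using that W by (simp add: H_def)
  define val where "val T c = T (J c) + (H - D c)" for T :: "_ \<Rightarrow> nat" and c
  define key where "key T c = val T c * n + rk c" for T c
  have key_less: "key T c < key T c' \<Longrightarrow> val T c \<le> val T c'" if "c \<in> W" "c' \<in> W" for T c c'
  proof (rule ccontr)
    assume "key T c < key T c'" "\<not> val T c \<le> val T c'"
    then have "Suc (val T c') * n \<le> val T c * n" by (intro mult_right_mono) auto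
    then show False using \<open>key T c < key T c'\<close> rkn[OF that(2)] by (simp add: key_def)
  qed
  have inj: "inj_on (key T) W" for T
  proof (rule inj_onI)
    fix c c' assume c: "c \<in> W" "c' \<in> W" and eq: "key T c = key T c'"
    have "rk c = key T c mod n" "rk c' = key T c' mod n" using c rkn by (simp_all add: key_def)
    then have "rk c = rk c'" using eq by simp
    then show "c = c'" using rk c by (auto dest: inj_onD)
  qed
  define E where "E A T \<longleftrightarrow> (\<forall>a\<in>A. \<forall>c\<in>W - A. key T c < key T a)" for A T
  define G where "G A T \<longleftrightarrow> (\<forall>a\<in>A. \<exists>c\<in>W - A. val T a \<le> val T c + 2)" for A T
  let ?As = "{A. A \<subseteq> W \<and> card A = j}"
  have finAs: "finite ?As" using W by (auto intro: finite_subset[of _ "Pow W"])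
  \<comment> \<open>Among \<open>j + 1\<close> centres within two of the best, one lies outside the
    top \<open>j\<close>. The members of the top set then exceed it by at most two, which is
    \<open>G\<close>.\<close>
  have cover: "\<exists>A\<in>?As. E A T \<and> G A T"
    if "j + 1 \<le> card {c\<in>W. \<forall>c'\<in>W. T (J c') + D c \<le> T (J c) + D c' + 2}" for T
  proof -
    let ?X = "{c\<in>W. \<forall>c'\<in>W. T (J c') + D c \<le> T (J c) + D c' + 2}"
    have "card ?X \<le> card W" using W by (intro card_mono) auto
    then obtain A where A: "A \<subseteq> W" "card A = j" "\<forall>a\<in>A. \<forall>c\<in>W - A. key T c < key T a"
      using top_set_exists[OF W inj, of j T] \<open>j + 1 \<le> card ?X\<close> by auto
    have finA: "finite A" using A W finite_subset by auto
    have "\<not> ?X \<subseteq> A" using card_mono[OF finA, of ?X] \<open>j + 1 \<le> card ?X\<close> A by auto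
    then obtain c where c: "c \<in> W - A" "\<forall>c'\<in>W. T (J c') + D c \<le> T (J c) + D c' + 2" by auto
    have "val T a \<le> val T c + 2" if "a \<in> A" for a
    proof -
      have "a \<in> W" using that A by auto
      then have "T (J a) + D c \<le> T (J c) + D a + 2" "D a \<le> H" "D c \<le> H"
        using c DH by auto
      then show ?thesis by (simp add: val_def)
    qed
    then show ?thesis using A c by (auto simp: E_def G_def)
  qed
  \<comment> \<open>Distinct sets of equal size cannot both be the top set. Hence the probabilities
    of the candidates \<open>A\<close> sum to at most one, and no union bound over them is
    paid.\<close>
  have disj: "disjoint_family_on (\<lambda>A. {T. E A T}) ?As"
    unfolding disjoint_family_on_def
  proof (intro ballI impI)
    fix A B assume AB: "A \<in> ?As" "B \<in> ?As" "A \<noteq> B"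
    have fin: "finite A" "finite B" using AB W finite_subset by auto
    have "\<not> A \<subseteq> B" "\<not> B \<subseteq> A" using AB fin card_subset_eq[of B A] card_subset_eq[of A B] by auto
    then obtain a b where "a \<in> A - B" "b \<in> B - A" by auto
    then have "key T b < key T a \<and> key T a < key T b" if "E A T" "E B T" for T
      using AB that unfolding E_def by blast
    then show "{T. E A T} \<inter> {T. E B T} = {}" by force
  qed
  have one: "measure_pmf.prob ?P {T. E A T \<and> G A T} \<le> p ^ j * measure_pmf.prob ?P {T. E A T}"
    if A: "A \<in> ?As" for A
  proof -
    let ?B = "J ` A" and ?A = "I - J ` A"
    have fin: "finite ?B" "finite ?A" "finite A" using A W I finite_subset[of A W] by auto
    have I_eq: "I = ?A \<union> ?B" using A I by auto
    have JA: "J c \<notin> ?B" if "c \<in> W - A" for c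
      using that A I(3) by (auto dest: inj_onD)
    have J_A: "J a \<in> ?B" if "a \<in> A" for a using that by auto
    have injA: "inj_on J A" using A I(3) inj_on_subset by auto
    have "measure_pmf.prob (Pi_pmf (?A \<union> ?B) d (\<lambda>_. geometric_pmf q)) {h. E A h \<and> G A h}
      \<le> p ^ j * measure_pmf.prob (Pi_pmf (?A \<union> ?B) d (\<lambda>_. geometric_pmf q)) {h. E A h}"
    proof (rule Pi_pmf_union_prob_mono)
      fix f :: "_ \<Rightarrow> nat"
      let ?mg = "\<lambda>g x. if x \<in> ?A then f x else g x"
      define v where "v a t = t + (H - D a)" for a t
      define S where "S a = {t. \<forall>c\<in>W - A. v c (f (J c)) * n + rk c < v a t * n + rk a}" for a
      define F where "F a = {t. \<exists>c\<in>W - A. v a t \<le> v c (f (J c)) + 2}" for a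
      have val_out: "val (?mg g) c = v c (f (J c))" if "c \<in> W - A" for g c
        using JA[OF that] that I by (auto simp: val_def v_def)
      have val_in: "val (?mg g) a = v a (g (J a))" if "a \<in> A" for g a
        using J_A[OF that] by (auto simp: val_def v_def)
      have E_iff: "E A (?mg g) \<longleftrightarrow> (\<forall>a\<in>A. g (J a) \<in> S a)" for g
        unfolding E_def key_def S_def mem_Collect_eq
        by (intro ball_cong refl) (simp only: val_out val_in)
      have G_iff: "G A (?mg g) \<longleftrightarrow> (\<forall>a\<in>A. g (J a) \<in> F a)" for g
        unfolding G_def F_def mem_Collect_eq
        by (intro ball_cong bex_cong refl) (simp only: val_out val_in)
      have EE: "{g. E A (?mg g)} = Pi ?B (\<lambda>i. S (the_inv_into A J i))"
        unfolding E_iff by (auto simp: Pi_def the_inv_into_f_f[OF injA])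
      have EG: "{g. E A (?mg g) \<and> G A (?mg g)} = Pi ?B (\<lambda>i. S (the_inv_into A J i) \<inter> F (the_inv_into A J i))"
        unfolding E_iff G_iff by (auto simp: Pi_def the_inv_into_f_f[OF injA])
      have window: "measure_pmf.prob (geometric_pmf q) (S a \<inter> F a) \<le> p * measure_pmf.prob (geometric_pmf q) (S a)"
        if a: "a \<in> A" for a
        unfolding p_def
      proof (rule prob_geometric_window[OF q])
        fix x y assume "x \<in> S a" "x \<le> y"
        then have "v a x * n \<le> v a y * n" by (intro mult_right_mono) (auto simp: v_def)
        then show "y \<in> S a" using \<open>x \<in> S a\<close> by (auto simp: S_def intro: less_le_trans)
      next
        \<comment> \<open>Since the rank may decide a tie, \<open>x \<in> S a\<close> only says that
          the value of \<open>a\<close> is at least that of \<open>c\<close>. With the slack of two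
          this gives \<open>y \<le> x + 2\<close>, hence a window of length three.\<close>
        fix x y assume x: "x \<in> S a" and "y \<in> F a"
        then obtain c where c: "c \<in> W - A" "v a y \<le> v c (f (J c)) + 2" by (auto simp: F_def)
        have "v c (f (J c)) * n + rk c < v a x * n + rk a" using x c by (auto simp: S_def)
        moreover have "rk a < n" using a A rkn by auto
        ultimately have "v c (f (J c)) * n < (v a x + 1) * n" by (simp add: algebra_simps)
        then have "v c (f (J c)) < v a x + 1" using mult_less_cancel2 by blast
        then show "y < x + 3" using c by (auto simp: v_def)
      qed
      have "measure_pmf.prob (Pi_pmf ?B d (\<lambda>_. geometric_pmf q)) {g. E A (?mg g) \<and> G A (?mg g)}
        = (\<Prod>i\<in>?B. measure_pmf.prob (geometric_pmf q) (S (the_inv_into A J i) \<inter> F (the_inv_into A J i)))"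
        unfolding EG by (rule measure_Pi_pmf_Pi) fact
      also have "\<dots> = (\<Prod>a\<in>A. measure_pmf.prob (geometric_pmf q) (S a \<inter> F a))"
        by (subst prod.reindex[OF injA]) (simp add: the_inv_into_f_f[OF injA])
      also have "\<dots> \<le> (\<Prod>a\<in>A. p * measure_pmf.prob (geometric_pmf q) (S a))"
        by (intro prod_mono conjI window) auto
      also have "\<dots> = p ^ j * (\<Prod>a\<in>A. measure_pmf.prob (geometric_pmf q) (S a))"
        using A by (simp add: prod.distrib)
      also have "(\<Prod>a\<in>A. measure_pmf.prob (geometric_pmf q) (S a))
         = (\<Prod>i\<in>?B. measure_pmf.prob (geometric_pmf q) (S (the_inv_into A J i)))"
        by (subst prod.reindex[OF injA]) (simp add: the_inv_into_f_f[OF injA])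
      also have "\<dots> = measure_pmf.prob (Pi_pmf ?B d (\<lambda>_. geometric_pmf q)) {g. E A (?mg g)}"
        unfolding EE by (rule measure_Pi_pmf_Pi[symmetric]) fact
      finally show "measure_pmf.prob (Pi_pmf ?B d (\<lambda>_. geometric_pmf q)) {g. E A (?mg g) \<and> G A (?mg g)}
        \<le> p ^ j * measure_pmf.prob (Pi_pmf ?B d (\<lambda>_. geometric_pmf q)) {g. E A (?mg g)}" .
    qed (use fin q in \<open>auto simp: p_def power_le_one\<close>)
    then show ?thesis using I_eq by simp
  qed
  have "measure_pmf.prob ?P {T. j + 1 \<le> card {c\<in>W. \<forall>c'\<in>W. T (J c') + D c \<le> T (J c) + D c' + 2}}
    \<le> measure_pmf.prob ?P (\<Union>A\<in>?As. {T. E A T \<and> G A T})"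
    using cover by (intro measure_pmf.finite_measure_mono) auto
  also have "\<dots> \<le> (\<Sum>A\<in>?As. measure_pmf.prob ?P {T. E A T \<and> G A T})"
    using finAs by (intro measure_pmf.finite_measure_subadditive_finite) auto
  also have "\<dots> \<le> (\<Sum>A\<in>?As. p ^ j * measure_pmf.prob ?P {T. E A T})"
    by (intro sum_mono one)
  also have "\<dots> = p ^ j * measure_pmf.prob ?P (\<Union>A\<in>?As. {T. E A T})"
    using finAs disj by (subst measure_pmf.finite_measure_finite_Union) (auto simp: sum_distrib_left)
  also have "\<dots> \<le> p ^ j * 1"
    using q by (intro mult_left_mono) (auto simp: p_def power_le_one)
  finally show ?thesis by simp
qed

text \<open>The expected excess over one is the sum of the tail probabilities from
  \<open>prob_many_near_max\<close>, a geometric series with ratio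
  \<open>p \<le> 1 / 2\<close>.\<close>

lemma nn_integral_near_max_excess:
  fixes D :: "'v \<Rightarrow> nat" and p :: real
  assumes q: "0 < q" "q \<le> 1" and W: "finite W" and I: "finite I" "J ` W \<subseteq> I" "inj_on J W"
  defines "p \<equiv> 1 - (1 - q) ^ 3"
  assumes "p \<le> 1 / 2"
  shows "(\<integral>\<^sup>+T. ennreal (real (card {c\<in>W. \<forall>c'\<in>W. T (J c') + D c \<le> T (J c) + D c' + 2} - 1))
    \<partial>Pi_pmf I d (\<lambda>_. geometric_pmf q)) \<le> ennreal (2 * p)"
proof -
  let ?P = "Pi_pmf I d (\<lambda>_. geometric_pmf q)"
  let ?X = "\<lambda>T. card {c\<in>W. \<forall>c'\<in>W. T (J c') + D c \<le> T (J c) + D c' + 2}"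
  have p0: "0 \<le> p" using q by (simp add: p_def power_le_one)
  have X: "ennreal (real (?X T - 1)) = (\<Sum>j\<in>{1..card W}. indicator {T. j + 1 \<le> ?X T} T)" for T
  proof -
    have "?X T \<le> card W" using W by (intro card_mono) auto
    then have "{1..card W} \<inter> {j. T \<in> {T. j + 1 \<le> ?X T}} = {1..?X T - 1}" by auto
    then show ?thesis
      by (simp add: indicator_def sum.If_cases flip: ennreal_of_nat_eq_real_of_nat)
  qed
  have "(\<integral>\<^sup>+T. ennreal (real (?X T - 1)) \<partial>?P)
      = (\<Sum>j\<in>{1..card W}. emeasure ?P {T. j + 1 \<le> ?X T})"
    unfolding X by (simp add: nn_integral_sum)
  also have "\<dots> \<le> (\<Sum>j\<in>{1..card W}. ennreal (p ^ j))"
    using prob_many_near_max[OF q W I] unfolding p_def measure_pmf.emeasure_eq_measure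
    by (intro sum_mono ennreal_leI)
  also have "\<dots> = ennreal (\<Sum>j\<in>{1..card W}. p ^ j)"
    using p0 by (intro sum_ennreal) auto
  also have "\<dots> \<le> ennreal (2 * p)"
  proof (rule ennreal_leI)
    have "(\<Sum>j\<in>{1..card W}. p ^ j) = p * (\<Sum>j<card W. p ^ j)"
      by (simp add: sum_distrib_left sum.atLeast1_atMost_eq)
    also have "\<dots> \<le> p * 2"
    proof (rule mult_left_mono[OF _ p0])
      have "(\<Sum>j<card W. p ^ j) = (1 - p ^ card W) / (1 - p)"
        using \<open>p \<le> 1 / 2\<close> by (subst sum_gp_strict) auto
      also have "\<dots> \<le> 2"
        proof (subst pos_divide_le_eq)
          show "1 - p ^ card W \<le> 2 * (1 - p)"
          proof -
            have "2 * p \<le> 1" using \<open>p \<le> 1 / 2\<close> by simp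
            moreover define x where "x = p ^ card W"
            moreover have "0 \<le> x" unfolding x_def by (rule zero_le_power[OF p0])
            ultimately show ?thesis unfolding x_def[symmetric] by (simp add: algebra_simps)
          qed
        qed (use \<open>p \<le> 1 / 2\<close> in simp)
      finally show "(\<Sum>j<card W. p ^ j) \<le> 2" .
    qed
    finally show "(\<Sum>j\<in>{1..card W}. p ^ j) \<le> 2 * p" by simp
  qed
  finally show ?thesis .
qed

subsection \<open>Carvings\<close>

text \<open>A constraint is represented by its content, a right-hand side and a coefficient
  function. Vertices know no constraint numbers, so this is what two of them can compare.\<close>

type_synonym 'v constraint = "real \<times> ('v \<Rightarrow> real)"

definition supp :: "'v constraint \<Rightarrow> 'v set" where
  "supp e = {v. snd e v \<noteq> 0}"

definition satisfied :: "'v set \<Rightarrow> 'v constraint \<Rightarrow> bool" where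
  "satisfied X e \<longleftrightarrow> fst e \<le> (\<Sum>v\<in>supp e \<inter> X. snd e v)"

lemma satisfied_Int: "supp e \<subseteq> C \<Longrightarrow> satisfied (X \<inter> C) e \<longleftrightarrow> satisfied X e"
proof -
  assume "supp e \<subseteq> C"
  then have "supp e \<inter> (X \<inter> C) = supp e \<inter> X" by auto
  then show ?thesis by (simp add: satisfied_def)
qed

locale network =
  fixes wt :: "'v \<Rightarrow> nat" and adj :: "'v \<Rightarrow> 'v set" and con :: "'v \<Rightarrow> 'v constraint set"
begin

primrec ball :: "nat \<Rightarrow> 'v \<Rightarrow> 'v set" where
  "ball 0 v = {v}"
| "ball (Suc r) v = ball r v \<union> (\<Union>u\<in>ball r v. adj u)"

text \<open>For an unreachable \<open>v\<close> the \<open>LEAST\<close> is unspecified, so bounds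
  on \<open>hop u v\<close> come with the membership of \<open>v\<close> in some ball around
  \<open>u\<close>.\<close>

definition hop :: "'v \<Rightarrow> 'v \<Rightarrow> nat" where
  "hop u v = (LEAST r. v \<in> ball r u)"

definition cons_in :: "'v set \<Rightarrow> 'v constraint set" where
  "cons_in C = {e\<in>\<Union>(con ` C). supp e \<subseteq> C}"

definition covers :: "'v set \<Rightarrow> 'v set \<Rightarrow> bool" where
  "covers X C \<longleftrightarrow> (\<forall>e\<in>cons_in C. satisfied X e)"

text \<open>The choice operator is the common tie-breaking rule: all vertices that know
  \<open>C\<close> and the data on \<open>C\<close> select the same optimal solution without
  communication.\<close>

definition sol :: "'v set \<Rightarrow> 'v set" where
  "sol C = (SOME X. X \<subseteq> C \<and> covers X C \<and> (\<forall>X'\<subseteq>C. covers X' C \<longrightarrow> sum wt X \<le> sum wt X'))"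

lemma ball_mono: "r \<le> s \<Longrightarrow> ball r v \<subseteq> ball s v"
  by (rule lift_Suc_mono_le) auto

lemma center_in_ball [simp]: "v \<in> ball r v"
  using ball_mono[of 0 r v] by auto

lemma ball_trans: "u \<in> ball r v \<Longrightarrow> x \<in> ball s u \<Longrightarrow> x \<in> ball (r + s) v"
  by (induction s arbitrary: x) auto

lemma hop_le: "v \<in> ball r u \<Longrightarrow> hop u v \<le> r"
  unfolding hop_def by (rule Least_le)

lemma in_ball_hop: "v \<in> ball r u \<Longrightarrow> v \<in> ball (hop u v) u"
  unfolding hop_def by (rule LeastI)

end

locale carving = network wt adj con
  for wt :: "'v \<Rightarrow> nat" and adj con +
  fixes k b t g m :: nat and T :: "'v \<Rightarrow> nat \<Rightarrow> nat"
begin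

text \<open>
  \<open>T v j\<close> is the value of vertex \<open>v\<close> in slot \<open>j\<close>: slots below \<open>k\<close> form the name of \<open>v\<close>, slots \<open>k\<close>
  to \<open>k + m - 1\<close> are the shifts of the covers that are averaged, the first of which is also the
  final cover, and slot \<open>k + m + i\<close> decides whether \<open>v\<close> is sampled at level \<open>i\<close>.
\<close>

definition cap :: nat where "cap = k * 2 ^ b"

text \<open>Level \<open>i\<close> has \<open>g\<close> rings of three layers between
  \<open>rad (Suc i)\<close> and \<open>rad i\<close>. The innermost radius leaves room for
  \<open>ball (2 * cap + 1)\<close>, in which \<open>thin_light\<close> compares the optimum with
  \<open>rough\<close>.\<close>

definition rad :: "nat \<Rightarrow> nat" where "rad i = 2 * cap + 2 + 3 * g * (t - i)"

text \<open>The slack of two ensures that some cluster contains a given vertex and all its neighbours.\<close>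

definition joins :: "nat \<Rightarrow> 'v \<Rightarrow> 'v \<Rightarrow> bool" where
  "joins j c u \<longleftrightarrow> c \<in> ball cap u \<and>
    (\<forall>c'\<in>ball cap u. T c' j + hop u c \<le> T c j + hop u c' + 2)"

definition cluster :: "nat \<Rightarrow> 'v \<Rightarrow> 'v set" where
  "cluster j c = {u\<in>ball cap c. joins j c u}"

definition chosen :: "nat \<Rightarrow> 'v \<Rightarrow> bool" where
  "chosen j u \<longleftrightarrow> (\<exists>c\<in>ball cap u. u \<in> cluster j c \<and> u \<in> sol (cluster j c))"

text \<open>The sum, not the average, over the \<open>m\<close> runs, which keeps it a natural
  number; comparisons with the optimum therefore carry the factor \<open>m\<close>.\<close>

definition rough :: "'v \<Rightarrow> nat" where
  "rough u = wt u * card {j\<in>{k..<k + m}. chosen j u}"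

text \<open>The radius \<open>2 * rad 0\<close> is so large that for every \<open>v\<close> in a
  ball of radius \<open>rad 0\<close> the denominator contains the mass of that whole ball, so
  densities there sum to at most one. On the other hand the denominator is at most the total, so low
  density still means a small share of the total. A zero denominator gives density zero.\<close>

definition dens :: "'v \<Rightarrow> real" where
  "dens u = real (rough u) / real (\<Sum>v\<in>ball (2 * rad 0) u. rough v)"

definition thin :: "nat \<Rightarrow> 'v \<Rightarrow> bool" where
  "thin i u \<longleftrightarrow> (\<forall>i'\<le>i. (\<Sum>v\<in>ball (rad i') u. dens v) \<le> 1 / 2 ^ i')"

text \<open>A geometric \<open>T\<close> satisfies \<open>(1 - 1 / 2 ^ b) ^ T \<le> x\<close> with probability between
  \<open>min 1 (x / 2)\<close> and \<open>x\<close>.\<close>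

definition sampled :: "nat \<Rightarrow> 'v \<Rightarrow> bool" where
  "sampled i s \<longleftrightarrow> (1 - 1 / 2 ^ b) ^ T s (k + m + i) \<le> 2 ^ i * (4 * real k) * dens s"

text \<open>The rings start outside distance \<open>rad (Suc i)\<close>, so whichever is picked, its
  cut encloses all vertices closer to the centre, in particular those for whose sake the centre had
  to be sampled.\<close>

definition ring :: "nat \<Rightarrow> 'v \<Rightarrow> nat \<Rightarrow> 'v set" where
  "ring i s j = {v\<in>ball (rad i) s. thin i v \<and>
    rad (Suc i) + 3 * j \<le> hop s v \<and> hop s v \<le> rad (Suc i) + 3 * j + 2}"

definition pick :: "nat \<Rightarrow> 'v \<Rightarrow> nat" where
  "pick i s = (ARG_MIN (\<lambda>j. \<Sum>v\<in>ring i s j. rough v) j. j < g)"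

text \<open>The middle layer of the picked ring: a hyperedge of thin vertices that meets it lies inside
  the ring.\<close>

definition cut :: "nat \<Rightarrow> 'v \<Rightarrow> nat" where
  "cut i s = rad (Suc i) + 3 * pick i s + 1"

definition sig :: "nat \<Rightarrow> 'v \<Rightarrow> 'v set" where
  "sig i u = {s\<in>ball (rad 0) u. sampled i s \<and> hop s u < cut i s}"

text \<open>Both \<open>sig\<close> and \<open>free\<close> use strict inequalities. A vertex at
  distance exactly \<open>cut\<close> is neither enclosed nor free; its hyperedges are left to the
  rings.\<close>

definition free :: "nat \<Rightarrow> 'v \<Rightarrow> bool" where
  "free i u \<longleftrightarrow> (\<forall>i'<i. \<forall>s\<in>ball (rad 0) u. sampled i' s \<longrightarrow> cut i' s < hop s u)"

definition group :: "nat \<Rightarrow> 'v \<Rightarrow> 'v set" where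
  "group i u = {v\<in>ball (2 * rad 0) u. free i v \<and> sig i v = sig i u}"

definition core :: "'v \<Rightarrow> 'v set" where
  "core c = {v\<in>cluster k c. free t v}"

definition answer :: "'v \<Rightarrow> bool" where
  "answer u \<longleftrightarrow>
    (\<exists>i<t. \<exists>s\<in>ball (rad 0) u. sampled i s \<and> u \<in> ring i s (pick i s) \<and> u \<in> sol (ring i s (pick i s))) \<or>
    (\<exists>i<t. free i u \<and> sig i u \<noteq> {} \<and> u \<in> sol (group i u)) \<or>
    (\<exists>c\<in>ball cap u. u \<in> core c \<and> u \<in> sol (core c))"

end

subsection \<open>Locality\<close>

text \<open>The first network is the true one, the second is what a single vertex reconstructs from
  the part it has seen, with arbitrary values elsewhere. Equality of the answers is
  locality.\<close>

locale two_networks =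
  A: carving wt adj con k b t g m T + B: carving wt' adj' con' k b t g m T'
  for wt wt' :: "'v \<Rightarrow> nat" and adj adj' con con' k b t g m T T' +
  assumes sym: "\<And>u v. u \<in> adj v \<Longrightarrow> v \<in> adj u"
begin

abbreviation "cap \<equiv> A.cap"
abbreviation "rad \<equiv> A.rad"

definition agree :: "nat \<Rightarrow> 'v \<Rightarrow> bool" where
  "agree \<rho> v \<longleftrightarrow> (\<forall>u\<in>A.ball \<rho> v. wt u = wt' u \<and> adj u = adj' u \<and> con u = con' u \<and> T u = T' u)"

lemma agree_near: "agree \<rho> v \<Longrightarrow> u \<in> A.ball \<sigma> v \<Longrightarrow> \<sigma> + \<tau> \<le> \<rho> \<Longrightarrow> agree \<tau> u"
  using A.ball_trans[of u \<sigma> v _ \<tau>] A.ball_mono[of "\<sigma> + \<tau>" \<rho> v] unfolding agree_def by blast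

lemma agree_mono: "agree \<rho> v \<Longrightarrow> \<tau> \<le> \<rho> \<Longrightarrow> agree \<tau> v"
  using agree_near[of \<rho> v v 0 \<tau>] by simp

lemma ball_eq: "agree \<rho> v \<Longrightarrow> r \<le> \<rho> \<Longrightarrow> B.ball r v = A.ball r v"
proof (induction r)
  case (Suc r)
  then have IH: "B.ball r v = A.ball r v" by simp
  have "adj u = adj' u" if "u \<in> A.ball r v" for u
    using that Suc.prems A.ball_mono[of r \<rho>] unfolding agree_def by auto
  then show ?case using IH by simp
qed simp

lemma hop_eq:
  assumes "agree \<rho> v" "u \<in> A.ball \<rho> v"
  shows "B.hop v u = A.hop v u"
proof -
  have le: "u \<in> B.ball r v \<longleftrightarrow> u \<in> A.ball r v" if "r \<le> \<rho>" for r
    using ball_eq[OF assms(1), of r] that by simp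
  show ?thesis unfolding A.hop_def
  proof (subst B.hop_def, rule Least_equality)
    have *: "(LEAST r. u \<in> A.ball r v) \<le> \<rho>" using assms(2) by (rule Least_le)
    moreover have "u \<in> A.ball (LEAST r. u \<in> A.ball r v) v" using assms(2) by (rule LeastI)
    ultimately show "u \<in> B.ball (LEAST r. u \<in> A.ball r v) v" using le by simp
    fix r assume "u \<in> B.ball r v"
    then show "(LEAST r. u \<in> A.ball r v) \<le> r"
      using le[of r] * by (cases "r \<le> \<rho>") (auto intro: Least_le)
  qed
qed

text \<open>The predicate under the choice operator mentions only weights and constraints of
  vertices in \<open>C\<close>, so both networks apply the choice to the same predicate.\<close>

lemma sol_eq:
  assumes "\<And>u. u \<in> C \<Longrightarrow> agree 0 u"
  shows "B.sol C = A.sol C"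
proof -
  have con: "con u = con' u" and wt: "wt u = wt' u" if "u \<in> C" for u
    using assms[OF that] by (auto simp: agree_def)
  have "A.cons_in C = B.cons_in C" unfolding A.cons_in_def B.cons_in_def using con by auto
  then have cov: "A.covers X C = B.covers X C" for X unfolding A.covers_def B.covers_def by simp
  have sm: "sum wt X = sum wt' X" if "X \<subseteq> C" for X using wt that by (intro sum.cong) auto
  have "(X \<subseteq> C \<and> A.covers X C \<and> (\<forall>X'\<subseteq>C. A.covers X' C \<longrightarrow> sum wt X \<le> sum wt X'))
    = (X \<subseteq> C \<and> B.covers X C \<and> (\<forall>X'\<subseteq>C. B.covers X' C \<longrightarrow> sum wt' X \<le> sum wt' X'))" for X
    by (metis cov sm)
  then show ?thesis unfolding A.sol_def B.sol_def by simp
qed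

lemma ball_sym: "u \<in> A.ball r v \<Longrightarrow> v \<in> A.ball r u"
proof (induction r arbitrary: u)
  case (Suc r)
  then obtain x where x: "x \<in> A.ball r v" "u = x \<or> u \<in> adj x" by auto
  then have "v \<in> A.ball r x" "x \<in> A.ball 1 u" using Suc.IH[of x] sym[of u x] by auto
  then show ?case using A.ball_trans[of x 1 u v r] by simp
qed simp

lemma rad_le: "rad i \<le> rad 0" "2 * cap \<le> rad i"
  by (auto simp: A.rad_def)

lemma joins_eq:
  assumes ag: "agree cap u"
  shows "B.joins j c u = A.joins j c u"
proof -
  have "T c' j = T' c' j" "B.hop u c' = A.hop u c'" if "c' \<in> A.ball cap u" for c'
    using ag that hop_eq[OF ag that] by (auto simp: agree_def)
  then show ?thesis
    unfolding A.joins_def B.joins_def using ball_eq[OF ag, of cap] by auto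
qed

lemma cluster_eq:
  assumes ag: "agree (2 * cap) c"
  shows "B.cluster j c = A.cluster j c"
proof -
  have "B.joins j c u = A.joins j c u" if "u \<in> A.ball cap c" for u
    using joins_eq agree_near[OF ag that] by simp
  then show ?thesis
    unfolding A.cluster_def B.cluster_def using ball_eq[OF ag, of cap] by auto
qed

lemma sol_cluster_eq:
  assumes ag: "agree (2 * cap) c"
  shows "B.sol (B.cluster j c) = A.sol (A.cluster j c)"
  unfolding cluster_eq[OF ag]
  by (intro sol_eq agree_near[OF ag]) (auto simp: A.cluster_def)

lemma rough_eq:
  assumes ag: "agree (3 * cap) u"
  shows "B.rough u = A.rough u"
proof -
  have "B.chosen j u = A.chosen j u" for j
  proof -
    have "agree (2 * cap) c" if "c \<in> A.ball cap u" for c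
      using agree_near[OF ag that] by simp
    then show ?thesis
      unfolding A.chosen_def B.chosen_def
      using ball_eq[OF ag, of cap] cluster_eq sol_cluster_eq by auto
  qed
  moreover have "wt' u = wt u" using ag by (auto simp: agree_def)
  ultimately show ?thesis by (simp add: A.rough_def B.rough_def)
qed

lemma dens_eq:
  assumes ag: "agree (2 * rad 0 + 3 * cap) u"
  shows "B.dens u = A.dens u"
proof -
  have "B.rough v = A.rough v" if "v \<in> A.ball (2 * rad 0) u" for v
    using agree_near[OF ag that] by (intro rough_eq) simp
  then show ?thesis
    unfolding A.dens_def B.dens_def
    using ball_eq[OF ag, of "2 * rad 0"] by simp
qed

lemma thin_eq:
  assumes ag: "agree (3 * rad 0 + 3 * cap) u"
  shows "B.thin i u = A.thin i u"
proof -
  have "(\<Sum>v\<in>B.ball (rad i') u. B.dens v) = (\<Sum>v\<in>A.ball (rad i') u. A.dens v)" for i'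
  proof (rule sum.cong)
    have le: "rad i' \<le> rad 0" by (rule rad_le)
    show "B.ball (rad i') u = A.ball (rad i') u" using le by (intro ball_eq[OF ag]) simp
    fix v assume "v \<in> A.ball (rad i') u"
    then have "agree (2 * rad 0 + 3 * cap) v" using le by (intro agree_near[OF ag]) auto
    then show "B.dens v = A.dens v" by (rule dens_eq)
  qed
  then show ?thesis unfolding A.thin_def B.thin_def by simp
qed

lemma sampled_eq:
  assumes ag: "agree (2 * rad 0 + 3 * cap) s"
  shows "B.sampled i s = A.sampled i s"
proof -
  have "T' s = T s" using ag by (auto simp: agree_def)
  then show ?thesis unfolding A.sampled_def B.sampled_def using dens_eq[OF ag] by simp
qed

lemma ring_eq:
  assumes ag: "agree (4 * rad 0 + 3 * cap) s"
  shows "B.ring i s j = A.ring i s j"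
proof -
  have le: "rad i \<le> rad 0" by (rule rad_le)
  have "B.thin i v = A.thin i v \<and> B.hop s v = A.hop s v" if "v \<in> A.ball (rad i) s" for v
  proof
    have v: "v \<in> A.ball (rad 0) s" using that A.ball_mono[OF le] by auto
    show "B.thin i v = A.thin i v" using agree_near[OF ag v] by (intro thin_eq) simp
    show "B.hop s v = A.hop s v" using v agree_mono[OF ag] by (intro hop_eq[of "rad 0"]) auto
  qed
  then show ?thesis
    unfolding A.ring_def B.ring_def using ball_eq[OF ag, of "rad i"] le by auto
qed

lemma cut_eq:
  assumes ag: "agree (4 * rad 0 + 3 * cap) s"
  shows "B.cut i s = A.cut i s" "B.pick i s = A.pick i s"
proof -
  have "(\<Sum>v\<in>B.ring i s j. B.rough v) = (\<Sum>v\<in>A.ring i s j. A.rough v)" for j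
  proof (rule sum.cong[OF ring_eq[OF ag]])
    fix v assume "v \<in> A.ring i s j"
    then have "v \<in> A.ball (rad 0) s"
      using A.ball_mono[OF rad_le(1)[of i]] by (auto simp: A.ring_def)
    then show "B.rough v = A.rough v" using agree_near[OF ag] by (intro rough_eq) simp
  qed
  then show "B.pick i s = A.pick i s" unfolding A.pick_def B.pick_def by simp
  then show "B.cut i s = A.cut i s" unfolding A.cut_def B.cut_def by simp
qed

context
  fixes u assumes ag: "agree (5 * rad 0 + 3 * cap) u"
begin

lemma near_center:
  assumes "s \<in> A.ball (rad 0) u"
  shows "agree (4 * rad 0 + 3 * cap) s" "B.sampled i s = A.sampled i s" "B.cut i s = A.cut i s"
    "B.hop s u = A.hop s u"
proof -
  show ag': "agree (4 * rad 0 + 3 * cap) s" using assms by (intro agree_near[OF ag]) auto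
  show "B.sampled i s = A.sampled i s" using agree_mono[OF ag'] by (intro sampled_eq) simp
  show "B.cut i s = A.cut i s" by (rule cut_eq[OF ag'])
  show "B.hop s u = A.hop s u"
    using agree_mono[OF ag'] ball_sym[OF assms] by (intro hop_eq[of "rad 0"]) auto
qed

lemma ball_rad0_eq: "B.ball (rad 0) u = A.ball (rad 0) u"
  using ball_eq[OF ag] by simp

lemma sig_eq: "B.sig i u = A.sig i u"
  unfolding A.sig_def B.sig_def ball_rad0_eq using near_center by auto

lemma free_eq: "B.free i u = A.free i u"
  unfolding A.free_def B.free_def ball_rad0_eq using near_center by auto

end

lemma group_eq:
  assumes ag: "agree (7 * rad 0 + 3 * cap) u"
  shows "B.group i u = A.group i u" "B.sol (B.group i u) = A.sol (A.group i u)"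
proof -
  have ag': "agree (5 * rad 0 + 3 * cap) v" if "v \<in> A.ball (2 * rad 0) u" for v
    using that by (intro agree_near[OF ag]) auto
  show *: "B.group i u = A.group i u"
    unfolding A.group_def B.group_def
    using ball_eq[OF ag, of "2 * rad 0"] free_eq[OF ag'] sig_eq[OF ag'] by auto
  show "B.sol (B.group i u) = A.sol (A.group i u)"
    unfolding * using agree_mono[OF ag'] by (intro sol_eq) (auto simp: A.group_def)
qed

lemma core_eq:
  assumes ag: "agree (6 * rad 0 + 3 * cap) c"
  shows "B.core c = A.core c" "B.sol (B.core c) = A.sol (A.core c)"
proof -
  have le: "2 * cap \<le> rad 0" by (rule rad_le)
  have ag': "agree (5 * rad 0 + 3 * cap) v" if "v \<in> A.cluster k c" for v
    using that le by (intro agree_near[OF ag, of v cap]) (auto simp: A.cluster_def)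
  have "B.cluster k c = A.cluster k c" using agree_mono[OF ag] le by (intro cluster_eq) simp
  then show *: "B.core c = A.core c"
    unfolding A.core_def B.core_def using free_eq[OF ag'] by auto
  show "B.sol (B.core c) = A.sol (A.core c)"
    unfolding * using agree_mono[OF ag'] by (intro sol_eq) (auto simp: A.core_def)
qed

text \<open>Radii add up along the definitions: \<open>rough\<close> needs \<open>3 * cap\<close>,
  \<open>dens\<close> adds \<open>2 * rad 0\<close>, then \<open>thin\<close>, \<open>ring\<close>
  and \<open>free\<close> add \<open>rad 0\<close> each, and \<open>group\<close> adds
  \<open>2 * rad 0\<close>. Since \<open>2 * cap \<le> rad 0\<close>, the sum stays below
  \<open>10 * rad 0\<close>.\<close>

theorem answer_eq:
  assumes ag: "agree (10 * rad 0) u"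
  shows "B.answer u = A.answer u"
proof -
  have le: "2 * cap \<le> rad 0" by (rule rad_le)
  have ag5: "agree (5 * rad 0 + 3 * cap) u" using le by (intro agree_mono[OF ag]) simp
  have ag7: "agree (7 * rad 0 + 3 * cap) u" using le by (intro agree_mono[OF ag]) simp
  have 1: "B.ring i s (B.pick i s) = A.ring i s (A.pick i s) \<and> B.sampled i s = A.sampled i s \<and>
      B.sol (B.ring i s (B.pick i s)) = A.sol (A.ring i s (A.pick i s))"
    if s: "s \<in> A.ball (rad 0) u" for i s
  proof -
    have ags: "agree (4 * rad 0 + 3 * cap) s" using near_center[OF ag5 s] by simp
    have eq: "B.ring i s (B.pick i s) = A.ring i s (A.pick i s)"
      using ring_eq[OF ags] cut_eq[OF ags] by simp
    have "agree 0 v" if "v \<in> A.ring i s (A.pick i s)" for v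
      using that rad_le(1)[of i] by (intro agree_near[OF ags, of v "rad i"]) (auto simp: A.ring_def)
    then show ?thesis using eq sol_eq near_center[OF ag5 s] by auto
  qed
  have 3: "B.core c = A.core c \<and> B.sol (B.core c) = A.sol (A.core c)" if "c \<in> A.ball cap u" for c
    using core_eq[OF agree_near[OF ag that]] le by simp
  have ring: "B.sampled i s = A.sampled i s" "B.ring i s (B.pick i s) = A.ring i s (A.pick i s)"
      "B.sol (A.ring i s (A.pick i s)) = A.sol (A.ring i s (A.pick i s))"
    if "s \<in> A.ball (rad 0) u" for i s
    using 1[OF that, of i] by metis+
  have core: "B.core c = A.core c" "B.sol (A.core c) = A.sol (A.core c)" if "c \<in> A.ball cap u" for c
    using 3[OF that] by metis+
  have group: "B.group i u = A.group i u" "B.sol (A.group i u) = A.sol (A.group i u)" for i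
    using group_eq[OF ag7, of i] by metis+
  have balls: "B.ball (rad 0) u = A.ball (rad 0) u" "B.ball cap u = A.ball cap u"
    using ball_eq[OF ag] le by auto
  show ?thesis
    unfolding A.answer_def B.answer_def balls group free_eq[OF ag5] sig_eq[OF ag5]
    by (simp add: ring core cong: bex_cong)
qed

end

subsection \<open>Feasibility and cost of a carving\<close>

locale covering_network = network wt adj con
  for wt :: "'v \<Rightarrow> nat" and adj con +
  fixes V :: "'v set"
  assumes finV: "finite V"
    and adjV: "v \<in> V \<Longrightarrow> adj v \<subseteq> V"
    and adj_sym: "u \<in> adj v \<Longrightarrow> v \<in> adj u"
    and con_mem: "v \<in> V \<Longrightarrow> e \<in> con v \<Longrightarrow> v \<in> supp e \<and> supp e \<subseteq> V"
    and con_share: "v \<in> V \<Longrightarrow> e \<in> con v \<Longrightarrow> u \<in> supp e \<Longrightarrow> e \<in> con u"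
    and con_adj: "v \<in> V \<Longrightarrow> e \<in> con v \<Longrightarrow> u \<in> supp e \<Longrightarrow> u \<noteq> v \<Longrightarrow> u \<in> adj v"
    and con_nonneg: "v \<in> V \<Longrightarrow> e \<in> con v \<Longrightarrow> 0 \<le> snd e u"
    and con_satisfiable: "v \<in> V \<Longrightarrow> e \<in> con v \<Longrightarrow> satisfied V e"
begin

lemma ball_subset: "v \<in> V \<Longrightarrow> ball r v \<subseteq> V"
  using adjV by (induction r) auto

lemma finite_ball [simp]: "v \<in> V \<Longrightarrow> finite (ball r v)"
  using ball_subset[of v r] finV by (rule finite_subset)

lemma ball_sym: "u \<in> ball r v \<Longrightarrow> v \<in> ball r u"
proof (induction r arbitrary: u)
  case (Suc r)
  then obtain x where x: "x \<in> ball r v" "u = x \<or> u \<in> adj x" by auto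
  then have "v \<in> ball r x" "x \<in> ball 1 u" using Suc.IH[of x] adj_sym[of u x] by auto
  then show ?case using ball_trans[of x 1 u v r] by simp
qed simp

lemma hop_sym: "hop u v = hop v u"
proof -
  have "(\<lambda>r. v \<in> ball r u) = (\<lambda>r. u \<in> ball r v)" by (intro ext iffI) (erule ball_sym)+
  then show ?thesis unfolding hop_def by simp
qed

lemma ball_hop: "v \<in> ball r u \<Longrightarrow> hop u v \<le> s \<Longrightarrow> v \<in> ball s u"
  using in_ball_hop ball_mono by blast

lemma hop_step:
  assumes "v \<in> ball r u" "x \<in> ball 1 v"
  shows "hop u x \<le> hop u v + 1" "x \<in> ball (r + 1) u"
proof -
  show "x \<in> ball (r + 1) u" using ball_trans assms .
  show "hop u x \<le> hop u v + 1" using ball_trans[OF in_ball_hop[OF assms(1)] assms(2)] hop_le by simp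
qed

lemma cons_inD:
  assumes "C \<subseteq> V" "e \<in> cons_in C"
  shows "supp e \<noteq> {}" "supp e \<subseteq> C" "e \<in> cons_in V" "\<And>u. u \<in> supp e \<Longrightarrow> e \<in> con u"
    "\<And>u x. u \<in> supp e \<Longrightarrow> x \<in> supp e \<Longrightarrow> x \<in> ball 1 u" "\<And>u. 0 \<le> snd e u" "satisfied V e"
proof -
  obtain v where v: "v \<in> C" "e \<in> con v" and sC: "supp e \<subseteq> C" using assms by (auto simp: cons_in_def)
  have vV: "v \<in> V" using v assms by auto
  show "supp e \<noteq> {}" "supp e \<subseteq> C" "e \<in> cons_in V" using con_mem[OF vV v(2)] vV v sC
    by (auto simp: cons_in_def)
  show *: "e \<in> con u" if "u \<in> supp e" for u using con_share[OF vV v(2) that] .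
  show "x \<in> ball 1 u" if "u \<in> supp e" "x \<in> supp e" for u x
  proof (cases "x = u")
    case False
    have "u \<in> V" using that sC assms by auto
    then show ?thesis using con_adj[OF _ *[OF that(1)] that(2)] False by auto
  qed simp
  show "0 \<le> snd e u" for u using con_nonneg[OF vV v(2)] .
  show "satisfied V e" using con_satisfiable[OF vV v(2)] .
qed

lemma cons_inI: "C \<subseteq> V \<Longrightarrow> e \<in> cons_in V \<Longrightarrow> supp e \<subseteq> C \<Longrightarrow> e \<in> cons_in C"
  using cons_inD[of V e] unfolding cons_in_def by blast

lemma satisfied_mono:
  assumes "e \<in> cons_in V" "satisfied X e" "X \<inter> supp e \<subseteq> Y"
  shows "satisfied Y e"
proof -
  note D = cons_inD[OF subset_refl assms(1)]
  have "finite (supp e)" using D finV finite_subset by blast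
  then have "(\<Sum>v\<in>supp e \<inter> X. snd e v) \<le> (\<Sum>v\<in>supp e \<inter> Y. snd e v)"
    using D assms(3) by (intro sum_mono2) auto
  then show ?thesis using assms(2) by (simp add: satisfied_def)
qed

lemma covers_restrict:
  assumes "C \<subseteq> V" "covers X V"
  shows "covers (X \<inter> C) C"
  unfolding covers_def
proof
  fix e assume e: "e \<in> cons_in C"
  note D = cons_inD[OF assms(1) e]
  show "satisfied (X \<inter> C) e" using assms(2) D satisfied_Int[of e C X] by (auto simp: covers_def)
qed

text \<open>By monotonicity and \<open>con_satisfiable\<close>, \<open>C\<close> itself satisfies
  all constraints supported inside \<open>C\<close>, so the choice in \<open>sol\<close> is made
  from a nonempty set.\<close>

lemma sol_props:
  assumes C: "C \<subseteq> V"
  shows "sol C \<subseteq> C" "covers (sol C) C" "\<And>X. X \<subseteq> C \<Longrightarrow> covers X C \<Longrightarrow> sum wt (sol C) \<le> sum wt X"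
proof -
  let ?P = "\<lambda>X. X \<subseteq> C \<and> covers X C"
  have "?P C"
  proof
    show "covers C C" unfolding covers_def
    proof
      fix e assume e: "e \<in> cons_in C"
      note D = cons_inD[OF C e]
      show "satisfied C e" using D(3) D(7) by (rule satisfied_mono) (use D(2) in auto)
    qed
  qed simp
  then have "\<exists>X. ?P X \<and> (\<forall>Y. ?P Y \<longrightarrow> sum wt X \<le> sum wt Y)"
    using ex_has_least_nat[of ?P C "sum wt"] by blast
  then have "\<exists>X. X \<subseteq> C \<and> covers X C \<and> (\<forall>X'\<subseteq>C. covers X' C \<longrightarrow> sum wt X \<le> sum wt X')" by blast
  from someI_ex[OF this] show "sol C \<subseteq> C" "covers (sol C) C"
    "\<And>X. X \<subseteq> C \<Longrightarrow> covers X C \<Longrightarrow> sum wt (sol C) \<le> sum wt X"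
    unfolding sol_def by blast+
qed

text \<open>Restricting a global cover to \<open>C\<close> loses nothing for the constraints inside
  \<open>C\<close>. This charges the local solution of any part to the global optimum on that
  part.\<close>

lemma sol_le: "C \<subseteq> V \<Longrightarrow> covers X V \<Longrightarrow> sum wt (sol C) \<le> sum wt (X \<inter> C)"
  using sol_props(3)[of C "X \<inter> C"] covers_restrict by simp

lemma finite_sol: "C \<subseteq> V \<Longrightarrow> finite (sol C)"
  using sol_props(1)[of C] finV by (meson finite_subset)

text \<open>
  Exchange: replacing the part of the optimum inside a ball by an optimal solution of the
  constraints inside the next larger ball does not destroy feasibility.
\<close>
lemma opt_ball_le:
  assumes u: "u \<in> V"
  shows "sum wt (sol V \<inter> ball r u) \<le> sum wt (sol (ball (r + 1) u))"
proof -
  let ?O = "sol V" and ?B = "ball r u" and ?B' = "ball (r + 1) u"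
  have B': "?B' \<subseteq> V" using ball_subset u by blast
  note S = sol_props[OF subset_refl] sol_props[OF B']
  let ?X = "(?O - ?B) \<union> sol ?B'"
  have "covers ?X V"
    unfolding covers_def
  proof
    fix e assume e: "e \<in> cons_in V"
    note D = cons_inD[OF subset_refl e]
    show "satisfied ?X e"
    proof (cases "supp e \<inter> ?B = {}")
      case True
      have "satisfied ?O e" using S(2) e by (auto simp: covers_def)
      then show ?thesis by (rule satisfied_mono[OF e]) (use True in blast)
    next
      case False
      then obtain x where x: "x \<in> supp e" "x \<in> ?B" by auto
      have "supp e \<subseteq> ?B'" using ball_trans[OF x(2) D(5)[OF x(1)]] by (intro subsetI)
      then have "e \<in> cons_in ?B'" using cons_inI[OF B' e] by simp
      then have "satisfied (sol ?B') e" using S(5) by (auto simp: covers_def)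
      then show ?thesis by (rule satisfied_mono[OF e]) blast
    qed
  qed
  moreover have "?X \<subseteq> V" using S(1,4) B' by blast
  ultimately have "sum wt ?O \<le> sum wt ?X" using S(3) by blast
  also have "\<dots> \<le> sum wt (?O - ?B) + sum wt (sol ?B')"
    using finite_sol[OF subset_refl] finite_sol[OF B'] by (subst sum.union_inter[symmetric]) auto
  finally have "sum wt ?O \<le> sum wt (?O - ?B) + sum wt (sol ?B')" .
  moreover have "sum wt ?O = sum wt (?O - ?B) + sum wt (?O \<inter> ?B)"
    using finite_sol[OF subset_refl] by (subst sum.union_disjoint[symmetric]) (auto intro: arg_cong[of _ _ "sum wt"])
  ultimately show ?thesis by simp
qed

end

section \<open>Deterministic properties of one carving\<close>

locale covering_carving = covering_network wt adj con V + carving wt adj con k b t g m T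
  for wt :: "'v \<Rightarrow> nat" and adj con V k b t g m T
begin

text \<open>The number of clusters of run \<open>j\<close> that contain \<open>u\<close>, see
  \<open>mult_eq\<close>, written out in the form to which
  \<open>nn_integral_near_max_excess\<close> applies.\<close>

definition mult :: "nat \<Rightarrow> 'v \<Rightarrow> nat" where
  "mult j u = card {c\<in>ball cap u. \<forall>c'\<in>ball cap u. T c' j + hop u c \<le> T c j + hop u c' + 2}"

definition runs_bounded :: bool where
  "runs_bounded \<longleftrightarrow> (\<forall>u\<in>V. \<forall>j\<in>{k..<k + m}. T u j < cap)"

definition hitting :: bool where
  "hitting \<longleftrightarrow> (\<forall>i<t. \<forall>u\<in>V. 1 / 2 ^ Suc i < (\<Sum>v\<in>ball (rad (Suc i)) u. dens v) \<longrightarrow>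
     (\<exists>s\<in>ball (rad (Suc i)) u. sampled i s))"

text \<open>Two vertices whose multiplicities depend on a common shift are within
  \<open>2 * cap\<close> of each other, hence this radius. The factor three comes from the bound on
  the total of \<open>rough\<close> in \<open>thin_light\<close>.\<close>

definition light :: "'v set" where
  "light = {u\<in>V. 2 ^ t * sum wt (sol V \<inter> ball (2 * cap) u) \<le> 3 * sum wt (sol V)}"

lemma rad_Suc: "i < t \<Longrightarrow> rad i = rad (Suc i) + 3 * g"
proof -
  assume "i < t"
  then have "t - i = Suc (t - Suc i)" by simp
  then show ?thesis unfolding rad_def by (simp only: mult_Suc_right)
qed

lemma rad_le: "rad i \<le> rad 0"
  by (simp add: rad_def)

lemma cluster_subset: "c \<in> V \<Longrightarrow> cluster j c \<subseteq> V"
  using ball_subset by (auto simp: cluster_def)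

lemma mem_cluster: "u \<in> cluster j c \<longleftrightarrow> c \<in> ball cap u \<and>
    (\<forall>c'\<in>ball cap u. T c' j + hop u c \<le> T c j + hop u c' + 2)"
  using ball_sym unfolding cluster_def joins_def by auto

lemma mult_eq: "u \<in> V \<Longrightarrow> mult j u = card {c\<in>V. u \<in> cluster j c}"
  unfolding mult_def mem_cluster using ball_subset by (intro arg_cong[of _ _ card]) auto

text \<open>Take \<open>c\<close> with the best shifted distance at one vertex \<open>u\<close> of
  the hyperedge. Passing to a neighbour \<open>x\<close> changes every distance by at most one, so
  \<open>c\<close> is still within two of the best at \<open>x\<close>.\<close>

lemma cluster_cover:
  assumes bound: "\<forall>u\<in>V. T u j < cap" and e: "e \<in> cons_in V"
  shows "\<exists>c\<in>V. supp e \<subseteq> cluster j c"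
proof -
  note D = cons_inD[OF subset_refl e]
  obtain u where u: "u \<in> supp e" using D(1) by auto
  then have uV: "u \<in> V" using D(2) by auto
  let ?f = "\<lambda>c. T c j + (cap - hop u c)"
  have "finite (?f ` ball cap u)" "?f ` ball cap u \<noteq> {}"
    using uV center_in_ball[of u cap] by (auto simp del: center_in_ball)
  then have "Max (?f ` ball cap u) \<in> ?f ` ball cap u" by (rule Max_in)
  then obtain c where c: "c \<in> ball cap u" "?f c = Max (?f ` ball cap u)" by auto
  have cmax: "T c' j + hop u c \<le> T c j + hop u c'" if "c' \<in> ball cap u" for c'
  proof -
    have "?f c' \<le> ?f c" using c uV that by simp
    then show ?thesis using hop_le[OF that] hop_le[OF c(1)] by simp
  qed
  \<comment> \<open>Comparing \<open>c\<close> with \<open>u\<close> itself shows that the distance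
    to \<open>c\<close> is at most the shift of \<open>c\<close>. As shifts are below
    \<open>cap\<close>, the centre is still in \<open>ball cap x\<close> one step further
    on.\<close>
  have "hop u u = 0" using hop_le[of u 0 u] by simp
  then have huc: "hop u c \<le> T c j" using cmax[of u] by simp
  have cV: "c \<in> V" using c uV ball_subset by blast
  have Tc: "T c j < cap" using bound cV by auto
  have "x \<in> cluster j c" if x: "x \<in> supp e" for x
  proof -
    have xV: "x \<in> V" using x D(2) by auto
    have ux: "u \<in> ball 1 x" and xu: "x \<in> ball 1 u" using D(5) x u by blast+
    have "x \<in> ball (hop c u + 1) c" "hop c x \<le> hop c u + 1"
      using hop_step[OF in_ball_hop[OF ball_sym[OF c(1)]] xu] by auto
    then have hxc: "hop x c \<le> hop u c + 1" and "c \<in> ball (hop u c + 1) x"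
      using hop_sym[of c x] hop_sym[of c u] ball_sym[of x "hop c u + 1" c] by simp_all
    then have cx: "c \<in> ball cap x" using huc Tc ball_mono[of "hop u c + 1" cap x] by auto
    have "T c' j + hop x c \<le> T c j + hop x c' + 2" if c': "c' \<in> ball cap x" for c'
    proof (cases "hop x c' < cap")
      case True
      have c'x: "c' \<in> ball (hop x c') x" using in_ball_hop c' .
      have "c' \<in> ball (1 + hop x c') u" using ball_trans[OF xu c'x] .
      then have "c' \<in> ball cap u" "hop u c' \<le> hop x c' + 1"
        using True ball_mono[of "1 + hop x c'" cap u] hop_le[of c' "1 + hop x c'" u] by auto
      then show ?thesis using cmax[of c'] hxc by simp
    next
      \<comment> \<open>Such a \<open>c'\<close> may lie outside \<open>ball cap u\<close>, but its
        shift is smaller than its distance to \<open>x\<close>, so it cannot beat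
        \<open>c\<close>.\<close>
      case False
      have "c' \<in> V" using c' xV ball_subset by blast
      then have "T c' j < cap" using bound by auto
      then show ?thesis using False hxc huc by simp
    qed
    then show ?thesis using cx by (simp add: mem_cluster)
  qed
  then show ?thesis using cV by auto
qed

definition run :: "nat \<Rightarrow> 'v set" where "run j = {u\<in>V. chosen j u}"

lemma run_covers:
  assumes "\<forall>u\<in>V. T u j < cap"
  shows "covers (run j) V"
  unfolding covers_def
proof
  fix e assume e: "e \<in> cons_in V"
  obtain c where c: "c \<in> V" "supp e \<subseteq> cluster j c" using cluster_cover[OF assms e] by auto
  note cV = cluster_subset[OF c(1), of j]
  note S = sol_props[OF cV]
  have "e \<in> cons_in (cluster j c)" using cons_inI[OF cV e c(2)] .
  then have "satisfied (sol (cluster j c)) e" using S(2) by (auto simp: covers_def)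
  then show "satisfied (run j) e"
  proof (rule satisfied_mono[OF e])
    show "sol (cluster j c) \<inter> supp e \<subseteq> run j"
    proof
      fix x assume "x \<in> sol (cluster j c) \<inter> supp e"
      then have x: "x \<in> sol (cluster j c)" "x \<in> cluster j c" using S(1) by auto
      then have "c \<in> ball cap x" by (simp add: mem_cluster)
      then show "x \<in> run j" using x cV by (auto simp: run_def chosen_def)
    qed
  qed
qed

lemma sum_rough:
  assumes "A \<subseteq> V"
  shows "sum rough A = (\<Sum>j\<in>{k..<k + m}. sum wt (run j \<inter> A))"
proof -
  have fA: "finite A" using assms finV finite_subset by auto
  have "rough u = (\<Sum>j\<in>{k..<k + m}. if chosen j u then wt u else 0)" for u
    by (simp add: rough_def sum.If_cases Int_def)
  then have "sum rough A = (\<Sum>u\<in>A. \<Sum>j\<in>{k..<k + m}. if chosen j u then wt u else 0)" by simp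
  also have "\<dots> = (\<Sum>j\<in>{k..<k + m}. \<Sum>u\<in>A. if chosen j u then wt u else 0)" by (rule sum.swap)
  also have "\<dots> = (\<Sum>j\<in>{k..<k + m}. sum wt (run j \<inter> A))"
  proof (rule sum.cong)
    fix j
    have "run j \<inter> A = A \<inter> {u. chosen j u}" using assms by (auto simp: run_def)
    then show "(\<Sum>u\<in>A. if chosen j u then wt u else 0) = sum wt (run j \<inter> A)"
      using fA by (simp add: sum.If_cases)
  qed simp
  finally show ?thesis .
qed

lemma sol_le_rough:
  assumes "runs_bounded" "C \<subseteq> V"
  shows "m * sum wt (sol C) \<le> sum rough C"
proof -
  have "m * sum wt (sol C) = (\<Sum>j\<in>{k..<k + m}. sum wt (sol C))" by simp
  also have "\<dots> \<le> (\<Sum>j\<in>{k..<k + m}. sum wt (run j \<inter> C))"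
    using assms run_covers by (intro sum_mono sol_le) (auto simp: runs_bounded_def)
  finally show ?thesis using sum_rough[OF assms(2)] by simp
qed

text \<open>Each cluster pays at most what the optimum spends inside it, so an optimum vertex is
  counted once per cluster containing it.\<close>

lemma run_le:
  "sum wt (run j) \<le> (\<Sum>u\<in>sol V. wt u * mult j u)"
proof -
  have "run j \<subseteq> (\<Union>c\<in>V. sol (cluster j c))"
    using ball_subset by (auto simp: run_def chosen_def)
  then have "sum wt (run j) \<le> sum wt (\<Union>c\<in>V. sol (cluster j c))"
    using finV finite_sol cluster_subset by (intro sum_mono2) auto
  also have "\<dots> \<le> (\<Sum>c\<in>V. sum wt (sol (cluster j c)))"
    using finV finite_sol cluster_subset by (intro sum_UN_le) auto
  also have "\<dots> \<le> (\<Sum>c\<in>V. sum wt (sol V \<inter> cluster j c))"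
    using sol_props(2)[OF subset_refl] cluster_subset by (intro sum_mono sol_le) auto
  also have "\<dots> = (\<Sum>c\<in>V. \<Sum>u\<in>sol V. if u \<in> cluster j c then wt u else 0)"
    using finite_sol[OF subset_refl] by (simp add: sum.If_cases Int_def)
  also have "\<dots> = (\<Sum>u\<in>sol V. \<Sum>c\<in>V. if u \<in> cluster j c then wt u else 0)" by (rule sum.swap)
  also have "\<dots> = (\<Sum>u\<in>sol V. wt u * mult j u)"
  proof (rule sum.cong)
    fix u assume "u \<in> sol V"
    then have "u \<in> V" using sol_props(1)[OF subset_refl] by auto
    then show "(\<Sum>c\<in>V. if u \<in> cluster j c then wt u else 0) = wt u * mult j u"
      using finV by (simp add: mult_eq sum.If_cases Int_def mult.commute)
  qed simp
  finally show ?thesis .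
qed

lemma rough_total_le: "sum rough V \<le> (\<Sum>j\<in>{k..<k + m}. \<Sum>u\<in>sol V. wt u * mult j u)"
proof -
  have "run j \<inter> V = run j" for j by (auto simp: run_def)
  then show ?thesis using run_le by (subst sum_rough) (auto intro: sum_mono)
qed

lemma dens_nonneg: "0 \<le> dens u"
  by (simp add: dens_def sum_nonneg del: of_nat_sum)

lemma sum_dens_ball_le_1:
  assumes u: "u \<in> V"
  shows "(\<Sum>v\<in>ball (rad 0) u. dens v) \<le> 1"
proof -
  let ?Q = "sum rough (ball (rad 0) u)"
  have "dens v \<le> real (rough v) / real ?Q" if "v \<in> ball (rad 0) u" for v
  proof (cases "rough v = 0")
    case False
    have vV: "v \<in> V" using that u ball_subset by blast
    have "rough v \<le> ?Q" using that u by (intro member_le_sum) auto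
    then have pos: "0 < ?Q" using False by simp
    have "ball (rad 0) u \<subseteq> ball (2 * rad 0) v"
      using ball_trans[OF ball_sym[OF that]] by (auto simp: mult_2)
    then have "?Q \<le> sum rough (ball (2 * rad 0) v)" using vV by (intro sum_mono2) auto
    then have "real ?Q \<le> real (sum rough (ball (2 * rad 0) v))" by (rule of_nat_mono)
    then show ?thesis using pos unfolding dens_def by (intro divide_left_mono mult_pos_pos)
        (simp_all del: of_nat_sum)
  qed (simp add: dens_def)
  then have "(\<Sum>v\<in>ball (rad 0) u. dens v) \<le> (\<Sum>v\<in>ball (rad 0) u. real (rough v) / real ?Q)"
    by (intro sum_mono)
  also have "\<dots> = real ?Q / real ?Q" by (simp flip: sum_divide_distrib)
  also have "\<dots> \<le> 1" by simp
  finally show ?thesis .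
qed

text \<open>If the ball of radius \<open>rad (Suc i)\<close> around \<open>u\<close> were too dense,
  \<open>hitting\<close> would give a sampled centre in it. Every cut of level \<open>i\<close> lies
  beyond \<open>rad (Suc i)\<close>, so that centre would enclose \<open>u\<close>. Level zero holds
  because densities sum to at most one.\<close>

lemma free_thin:
  assumes hit: "hitting" and "i \<le> t" and u: "u \<in> V" and "free i u"
  shows "thin i u"
  using assms(2,4)
proof (induction i)
  case 0
  then show ?case using sum_dens_ball_le_1[OF u] by (simp add: thin_def)
next
  case (Suc i)
  have fr: "free i u" using Suc.prems by (auto simp: free_def)
  then have th: "thin i u" using Suc by simp
  show ?case
  proof (rule ccontr)
    assume "\<not> thin (Suc i) u"
    then have "1 / 2 ^ Suc i < (\<Sum>v\<in>ball (rad (Suc i)) u. dens v)"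
      using th unfolding thin_def by (metis le_Suc_eq not_le)
    then obtain s where s: "s \<in> ball (rad (Suc i)) u" "sampled i s"
      using hit Suc.prems(1) u unfolding hitting_def by (meson Suc_le_lessD)
    have "s \<in> ball (rad 0) u" using s ball_mono[OF rad_le] by auto
    then have "cut i s < hop s u" using Suc.prems s by (auto simp: free_def)
    moreover have "hop s u \<le> rad (Suc i)" using s hop_le hop_sym by metis
    ultimately show False by (simp add: cut_def)
  qed
qed

text \<open>The share of \<open>ball (2 * cap + 1) u\<close> in the total of \<open>rough\<close> is
  at most its density, hence at most \<open>1 / 2 ^ t\<close>. By exchange, the optimum in
  \<open>ball (2 * cap) u\<close> is at most the local optimum one step further out, and that is
  dominated by \<open>rough\<close>.\<close>

lemma thin_light:
  assumes "runs_bounded" "m > 0" and total: "sum rough V \<le> 3 * m * sum wt (sol V)"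
    and u: "u \<in> V" and "thin t u"
  shows "u \<in> light"
proof -
  let ?B = "ball (2 * cap + 1) u" and ?Q = "sum rough V"
  have BV: "?B \<subseteq> V" using u ball_subset by blast
  have "2 ^ t * sum rough ?B \<le> ?Q"
  proof (cases "?Q = 0")
    case True
    then have "\<forall>v\<in>V. rough v = 0" using finV by simp
    then have "rough v = 0" if "v \<in> ?B" for v using BV that by blast
    then have "sum rough ?B = 0" by (rule sum.neutral[OF ballI])
    then show ?thesis by simp
  next
    case False
    have "real (sum rough ?B) / real ?Q = (\<Sum>v\<in>?B. real (rough v) / real ?Q)"
      by (simp add: sum_divide_distrib)
    also have "\<dots> \<le> (\<Sum>v\<in>?B. dens v)"
    proof (rule sum_mono)
      fix v assume "v \<in> ?B"
      then have vV: "v \<in> V" using BV by auto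
      show "real (rough v) / real ?Q \<le> dens v"
      proof (cases "rough v = 0")
        case False
        let ?Q' = "sum rough (ball (2 * rad 0) v)"
        have "rough v \<le> ?Q'" using vV by (intro member_le_sum) auto
        then have "0 < ?Q'" using False by simp
        moreover have "?Q' \<le> ?Q" using vV finV ball_subset by (intro sum_mono2) auto
        then have "real ?Q' \<le> real ?Q" by (rule of_nat_mono)
        ultimately show ?thesis unfolding dens_def by (intro divide_left_mono mult_pos_pos)
            (simp_all del: of_nat_sum)
      qed (simp add: dens_def)
    qed
    also have "\<dots> \<le> (\<Sum>v\<in>ball (rad t) u. dens v)"
      using u dens_nonneg by (intro sum_mono2 ball_mono finite_ball) (auto simp: rad_def)
    also have "\<dots> \<le> 1 / 2 ^ t" using \<open>thin t u\<close> by (simp add: thin_def)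
    finally have "2 ^ t * real (sum rough ?B) \<le> real ?Q" using False by (simp add: field_simps del: of_nat_sum)
    then show ?thesis by (metis of_nat_le_iff of_nat_mult of_nat_numeral of_nat_power)
  qed
  moreover have "m * sum wt (sol V \<inter> ball (2 * cap) u) \<le> sum rough ?B"
    using order_trans[OF mult_le_mono2[OF opt_ball_le[OF u, of "2 * cap"], of m] sol_le_rough[OF assms(1) BV]] .
  ultimately have "2 ^ t * (m * sum wt (sol V \<inter> ball (2 * cap) u)) \<le> 3 * m * sum wt (sol V)"
    using total by (meson le_trans mult_le_mono2)
  then have "m * (2 ^ t * sum wt (sol V \<inter> ball (2 * cap) u)) \<le> m * (3 * sum wt (sol V))"
    by (simp add: ac_simps)
  then show ?thesis using u \<open>m > 0\<close> by (simp add: light_def)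
qed

lemma pick_less: "g > 0 \<Longrightarrow> pick i s < g"
  and pick_min: "j < g \<Longrightarrow> sum rough (ring i s (pick i s)) \<le> sum rough (ring i s j)"
  unfolding pick_def
  using arg_min_natI[of "\<lambda>j. j < g" 0 "\<lambda>j. sum rough (ring i s j)"]
    arg_min_nat_le[of "\<lambda>j. j < g" j "\<lambda>j. sum rough (ring i s j)"] by blast+

lemma ring_subset: "s \<in> V \<Longrightarrow> ring i s j \<subseteq> V"
  using ball_subset by (auto simp: ring_def)

lemma ring_cheap:
  assumes s: "s \<in> V"
  shows "g * sum rough (ring i s (pick i s)) \<le> sum rough {v\<in>ball (rad i) s. thin i v}"
proof -
  have "g * sum rough (ring i s (pick i s)) = (\<Sum>j<g. sum rough (ring i s (pick i s)))" by simp
  also have "\<dots> \<le> (\<Sum>j<g. sum rough (ring i s j))"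
    by (intro sum_mono pick_min) simp
  also have "\<dots> = sum rough (\<Union>j<g. ring i s j)"
  proof (rule sum.UNION_disjoint[symmetric])
    show "\<forall>j\<in>{..<g}. finite (ring i s j)"
      using ring_subset[OF s] finV finite_subset by blast
    show "\<forall>j\<in>{..<g}. \<forall>j'\<in>{..<g}. j \<noteq> j' \<longrightarrow> ring i s j \<inter> ring i s j' = {}"
      by (auto simp: ring_def)
  qed simp
  also have "\<dots> \<le> sum rough {v\<in>ball (rad i) s. thin i v}"
    using s by (intro sum_mono2) (auto simp: ring_def)
  finally show ?thesis .
qed

lemma group_eq:
  assumes u: "u \<in> V" and "sig i u \<noteq> {}"
  shows "group i u = {v\<in>V. free i v \<and> sig i v = sig i u}"
proof -
  have "v \<in> ball (2 * rad 0) u" if "sig i v = sig i u" for v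
  proof -
    obtain s where "s \<in> sig i u" using assms by auto
    then have "s \<in> ball (rad 0) u" "s \<in> ball (rad 0) v" using that by (auto simp: sig_def)
    then show ?thesis using ball_trans[of s "rad 0" u v "rad 0"] ball_sym by (simp add: mult_2)
  qed
  then show ?thesis using u ball_subset by (auto simp: group_def)
qed

lemma sig_not_free:
  assumes "sig i u \<noteq> {}" "i < i'"
  shows "\<not> free i' u"
proof
  assume "free i' u"
  obtain s where "s \<in> sig i u" using assms by auto
  then have "s \<in> ball (rad 0) u" "sampled i s" "hop s u < cut i s" by (auto simp: sig_def)
  then show False using \<open>free i' u\<close> \<open>i < i'\<close> by (force simp: free_def)
qed

abbreviation answers :: "'v set" where "answers \<equiv> {u\<in>V. answer u}"

lemma cut_bounds: "i < t \<Longrightarrow> g > 0 \<Longrightarrow> cut i s + 1 < rad i"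
  using pick_less[of i s] rad_Suc[of i] by (simp add: cut_def)

text \<open>Consider the first level at which some vertex of the hyperedge is on or inside a cut.
  All its vertices are still free there, hence thin. If one lies on a cut, the hyperedge fits into
  that ring; otherwise it cannot cross a cut, so all its vertices have the same signature. If there
  is no such level, a cluster of the final cover contains the hyperedge and none of its vertices is
  missing from the core.\<close>

lemma answers_cover:
  assumes hit: "hitting" and bd: "runs_bounded" and "m > 0" "g > 0"
  shows "covers answers V"
  unfolding covers_def
proof
  fix e assume e: "e \<in> cons_in V"
  note D = cons_inD[OF subset_refl e]
  have by_cluster: "satisfied answers e"
    if C: "supp e \<subseteq> C" "C \<subseteq> V" and ans: "sol C \<subseteq> answers" for C
  proof -
    have "e \<in> cons_in C" using cons_inI[OF C(2) e C(1)] .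
    then have "satisfied (sol C) e" using sol_props(2)[OF C(2)] by (auto simp: covers_def)
    then show ?thesis by (rule satisfied_mono[OF e]) (use ans in blast)
  qed
  define touched where "touched i u \<longleftrightarrow> (\<exists>s\<in>ball (rad 0) u. sampled i s \<and> hop s u \<le> cut i s)" for i u
  have free_iff: "free i u \<longleftrightarrow> (\<forall>i'<i. \<not> touched i' u)" for i u
    by (force simp: free_def touched_def)
  show "satisfied answers e"
  proof (cases "\<exists>i<t. \<exists>u\<in>supp e. touched i u")
    case False
    then have fr: "free t u" if "u \<in> supp e" for u using that by (auto simp: free_iff)
    have "\<forall>u\<in>V. T u k < cap" using bd \<open>m > 0\<close> by (auto simp: runs_bounded_def)
    then obtain c where c: "c \<in> V" "supp e \<subseteq> cluster k c" using cluster_cover[OF _ e] by blast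
    show ?thesis
    proof (rule by_cluster)
      show "supp e \<subseteq> core c" using c fr by (auto simp: core_def)
      show CV: "core c \<subseteq> V" using cluster_subset[OF c(1)] by (auto simp: core_def)
      show "sol (core c) \<subseteq> answers"
      proof
        fix v assume v: "v \<in> sol (core c)"
        then have vc: "v \<in> core c" using sol_props(1)[OF CV] by auto
        then have "c \<in> ball cap v" by (auto simp: core_def mem_cluster)
        then show "v \<in> answers" using v vc CV by (auto simp: answer_def)
      qed
    qed
  next
    case True
    define i where "i = (LEAST i. i < t \<and> (\<exists>u\<in>supp e. touched i u))"
    have i: "i < t" "\<exists>u\<in>supp e. touched i u"
      using LeastI_ex[OF True] by (auto simp: i_def)
    have min: "\<not> touched i' u" if "i' < i" "u \<in> supp e" for i' u
      using not_less_Least[of i' "\<lambda>i. i < t \<and> (\<exists>u\<in>supp e. touched i u)"] that i(1)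
      by (auto simp: i_def)
    have fr: "free i u" if "u \<in> supp e" for u using that min by (auto simp: free_iff)
    have th: "thin i u" if "u \<in> supp e" for u
      using free_thin[OF hit _ _ fr[OF that]] that D(2) i by auto
    have step: "hop s x \<le> hop s u + 1" "x \<in> ball (r + 1) s"
      if "u \<in> supp e" "x \<in> supp e" "s \<in> ball r u" for u x s r
      using hop_step[OF ball_sym[OF that(3)] D(5)[OF that(1,2)]] by auto
    note cb = cut_bounds[OF i(1) \<open>g > 0\<close>]
    show ?thesis
    proof (cases "\<exists>u\<in>supp e. \<exists>s\<in>ball (rad 0) u. sampled i s \<and> hop s u = cut i s")
      case True
      then obtain u s where us: "u \<in> supp e" "s \<in> ball (rad 0) u" "sampled i s" "hop s u = cut i s"
        by auto
      have sV: "s \<in> V" using us D(2) ball_subset by blast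
      show ?thesis
      proof (rule by_cluster)
        show "supp e \<subseteq> ring i s (pick i s)"
        proof
          fix x assume x: "x \<in> supp e"
          have 1: "hop s x \<le> cut i s + 1" "x \<in> ball (rad 0 + 1) s" using step[OF us(1) x us(2)] us by auto
          have 2: "cut i s \<le> hop s x + 1" using step(1)[OF x us(1) ball_sym[OF 1(2)]] us by simp
          have "x \<in> ball (rad i) s" using ball_hop[OF 1(2)] 1(1) cb[of s] by simp
          then show "x \<in> ring i s (pick i s)" using 1(1) 2 th[OF x] by (auto simp: ring_def cut_def)
        qed
        show CV: "ring i s (pick i s) \<subseteq> V" using ring_subset[OF sV] .
        show "sol (ring i s (pick i s)) \<subseteq> answers"
        proof
          fix v assume v: "v \<in> sol (ring i s (pick i s))"
          then have vr: "v \<in> ring i s (pick i s)" using sol_props(1)[OF CV] by auto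
          then have "v \<in> ball (rad 0) s" using ball_mono[OF rad_le[of i]] by (auto simp: ring_def)
          then show "v \<in> answers" using v vr CV us i ball_sym by (auto simp: answer_def)
        qed
      qed
    next
      case False
      obtain u where u: "u \<in> supp e" "touched i u" using i by auto
      have uV: "u \<in> V" using u D(2) by auto
      have sub: "sig i x \<subseteq> sig i y" if x: "x \<in> supp e" and y: "y \<in> supp e" for x y
      proof
        fix s assume "s \<in> sig i x"
        then have s: "s \<in> ball (rad 0) x" "sampled i s" "hop s x < cut i s" by (auto simp: sig_def)
        have 1: "hop s y \<le> cut i s" "y \<in> ball (rad 0 + 1) s" using step[OF x y s(1)] s(3) by auto
        have "y \<in> ball (rad 0) s" using ball_hop[OF 1(2)] 1(1) cb[of s] rad_le[of i] by simp
        then have "s \<in> ball (rad 0) y" by (rule ball_sym)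
        then show "s \<in> sig i y" using False y s 1(1) by (force simp: sig_def)
      qed
      obtain s where "s \<in> ball (rad 0) u" "sampled i s" "hop s u \<le> cut i s" using u by (auto simp: touched_def)
      then have ne: "sig i u \<noteq> {}" using False u by (force simp: sig_def)
      note G = group_eq[OF uV ne]
      show ?thesis
      proof (rule by_cluster)
        show "supp e \<subseteq> group i u" unfolding G using sub u fr D(2) by blast
        show CV: "group i u \<subseteq> V" unfolding G by auto
        show "sol (group i u) \<subseteq> answers"
        proof
          fix v assume v: "v \<in> sol (group i u)"
          then have vg: "v \<in> group i u" using sol_props(1)[OF CV] by auto
          then have vs: "sig i v = sig i u" "free i v" "v \<in> V" unfolding G by auto
          then have "group i v = group i u" using group_eq[of v i] ne G by simp
          then show "v \<in> answers" using v vs ne i by (auto simp: answer_def)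
        qed
      qed
    qed
  qed
qed

text \<open>Three budgets: rings are paid by \<open>rough\<close>; the classes are disjoint and
  avoid the vertices free at level \<open>t\<close>; the cores contain only such vertices. So
  classes and cores together cost one optimum plus the multiplicity excess on free vertices, which
  are light.\<close>

lemma answers_cost:
  assumes hit: "hitting" and bd: "runs_bounded" and "m > 0"
    and total: "sum rough V \<le> 3 * m * sum wt (sol V)"
  shows "real (sum wt answers) \<le> real (sum wt (sol V))
    + real (\<Sum>u\<in>sol V \<inter> light. wt u * (mult k u - 1))
    + (\<Sum>i<t. \<Sum>s\<in>{s\<in>V. sampled i s}. real (sum rough (ring i s (pick i s)))) / real m"
proof -
  let ?O = "sol V"
  note O = sol_props[OF subset_refl]
  define F where "F = {u\<in>V. free t u}"
  \<comment> \<open>A set of vertex sets, so that a class is counted once and not once per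
    member.\<close>
  define \<G> where "\<G> = {group i u |i u. i < t \<and> u \<in> V \<and> free i u \<and> sig i u \<noteq> {}}"
  define R where "R = (\<Union>i<t. \<Union>s\<in>{s\<in>V. sampled i s}. sol (ring i s (pick i s)))"
  have GV: "C \<subseteq> V" if "C \<in> \<G>" for C
  proof -
    obtain i u where "C = group i u" "u \<in> V" using \<open>C \<in> \<G>\<close> by (auto simp: \<G>_def)
    then show ?thesis using ball_subset[of u] by (auto simp: group_def)
  qed
  have fG: "finite \<G>" using GV finV by (intro finite_subset[of \<G> "Pow V"]) auto
  have coreV: "core c \<subseteq> V" if "c \<in> V" for c using cluster_subset[OF that] by (auto simp: core_def)
  have fR: "finite R" unfolding R_def using finV ring_subset finite_sol by auto
  have sub: "answers \<subseteq> R \<union> (\<Union>C\<in>\<G>. sol C) \<union> (\<Union>c\<in>V. sol (core c))"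
  proof
    fix u assume "u \<in> answers"
    then have u: "u \<in> V" "answer u" by auto
    from u(2) consider (1) i s where "i < t" "s \<in> ball (rad 0) u" "sampled i s" "u \<in> sol (ring i s (pick i s))"
      | (2) i where "i < t" "free i u" "sig i u \<noteq> {}" "u \<in> sol (group i u)"
      | (3) c where "c \<in> ball cap u" "u \<in> sol (core c)"
      unfolding answer_def by blast
    then show "u \<in> R \<union> (\<Union>C\<in>\<G>. sol C) \<union> (\<Union>c\<in>V. sol (core c))"
    proof cases
      case 1
      then have "s \<in> V" using u ball_subset by blast
      then show ?thesis using 1 by (auto simp: R_def)
    next
      case 2
      then have "group i u \<in> \<G>" using u unfolding \<G>_def by blast
      then show ?thesis using 2 by auto
    next
      case 3
      then have "c \<in> V" using u ball_subset by blast
      then show ?thesis using 3 by auto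
    qed
  qed
  have fin: "finite (\<Union>C\<in>\<G>. sol C)" "finite (\<Union>c\<in>V. sol (core c))"
    using fG GV finV coreV finite_sol by auto
  have "sum wt answers \<le> sum wt (R \<union> (\<Union>C\<in>\<G>. sol C) \<union> (\<Union>c\<in>V. sol (core c)))"
    using sub fR fin by (intro sum_mono2) auto
  also have "\<dots> \<le> sum wt (R \<union> (\<Union>C\<in>\<G>. sol C)) + sum wt (\<Union>c\<in>V. sol (core c))"
    using fR fin by (subst sum.union_inter[symmetric]) auto
  also have "sum wt (R \<union> (\<Union>C\<in>\<G>. sol C)) \<le> sum wt R + sum wt (\<Union>C\<in>\<G>. sol C)"
    using fR fin by (subst sum.union_inter[symmetric]) auto
  finally have three: "sum wt answers \<le> sum wt R + sum wt (\<Union>C\<in>\<G>. sol C) + sum wt (\<Union>c\<in>V. sol (core c))"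
    by simp
  have "sum wt (\<Union>C\<in>\<G>. sol C) \<le> (\<Sum>C\<in>\<G>. sum wt (sol C))"
    using fG GV finite_sol by (intro sum_UN_le) auto
  also have "\<dots> \<le> (\<Sum>C\<in>\<G>. sum wt (?O \<inter> C))"
    using GV O by (intro sum_mono sol_le) auto
  also have "\<dots> = sum wt (\<Union>C\<in>\<G>. ?O \<inter> C)"
  proof (rule sum.UNION_disjoint[symmetric])
    show "finite \<G>" by fact
    show "\<forall>C\<in>\<G>. finite (?O \<inter> C)" using finite_sol[OF subset_refl] by auto
    show "\<forall>C\<in>\<G>. \<forall>C'\<in>\<G>. C \<noteq> C' \<longrightarrow> ?O \<inter> C \<inter> (?O \<inter> C') = {}"
    proof (intro ballI impI)
      fix C C' assume C: "C \<in> \<G>" "C' \<in> \<G>" "C \<noteq> C'"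
      show "?O \<inter> C \<inter> (?O \<inter> C') = {}"
      proof (rule ccontr)
        assume "?O \<inter> C \<inter> (?O \<inter> C') \<noteq> {}"
        then obtain v where v: "v \<in> C" "v \<in> C'" by auto
        obtain i u where iu: "C = group i u" "u \<in> V" "sig i u \<noteq> {}" using C by (auto simp: \<G>_def)
        obtain i' u' where iu': "C' = group i' u'" "u' \<in> V" "sig i' u' \<noteq> {}" using C by (auto simp: \<G>_def)
        have a: "sig i v = sig i u" "free i v" "sig i' v = sig i' u'" "free i' v"
          using v iu iu' by (auto simp: group_def)
        \<comment> \<open>A vertex enclosed at some level is not free at any later one, so it
          belongs to classes of only one level.\<close>
        have "i = i'" using a iu iu' sig_not_free[of i v i'] sig_not_free[of i' v i] by (metis nat_neq_iff)
        then have "C = C'" using a iu iu' group_eq[of u i] group_eq[of u' i'] by simp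
        then show False using C by simp
      qed
    qed
  qed
  also have "\<dots> \<le> sum wt (?O - F)"
  proof (rule sum_mono2)
    show "finite (?O - F)" using finite_sol[OF subset_refl] by auto
    show "(\<Union>C\<in>\<G>. ?O \<inter> C) \<subseteq> ?O - F"
    proof
      fix v assume "v \<in> (\<Union>C\<in>\<G>. ?O \<inter> C)"
      then obtain i u where "v \<in> ?O" "v \<in> group i u" "i < t" "sig i u \<noteq> {}" by (auto simp: \<G>_def)
      then show "v \<in> ?O - F" using sig_not_free[of i v t] by (auto simp: group_def F_def)
    qed
  qed simp
  finally have two: "sum wt (\<Union>C\<in>\<G>. sol C) \<le> sum wt (?O - F)" .
  have "sum wt (\<Union>c\<in>V. sol (core c)) \<le> (\<Sum>c\<in>V. sum wt (sol (core c)))"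
    using finV coreV finite_sol by (intro sum_UN_le) auto
  also have "\<dots> \<le> (\<Sum>c\<in>V. sum wt (?O \<inter> core c))"
    using coreV O by (intro sum_mono sol_le) auto
  also have "\<dots> = (\<Sum>c\<in>V. \<Sum>u\<in>?O \<inter> F. if u \<in> cluster k c then wt u else 0)"
  proof (rule sum.cong)
    fix c assume "c \<in> V"
    have "?O \<inter> core c = {u\<in>?O \<inter> F. u \<in> cluster k c}" using O(1) by (auto simp: core_def F_def)
    then show "sum wt (?O \<inter> core c) = (\<Sum>u\<in>?O \<inter> F. if u \<in> cluster k c then wt u else 0)"
      using finite_sol[OF subset_refl] by (simp add: sum.If_cases Int_def)
  qed simp
  also have "\<dots> = (\<Sum>u\<in>?O \<inter> F. \<Sum>c\<in>V. if u \<in> cluster k c then wt u else 0)" by (rule sum.swap)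
  also have "\<dots> = (\<Sum>u\<in>?O \<inter> F. wt u * mult k u)"
    using finV by (intro sum.cong) (auto simp: mult_eq F_def sum.If_cases Int_def mult.commute)
  also have "\<dots> \<le> (\<Sum>u\<in>?O \<inter> F. wt u + wt u * (mult k u - 1))"
  proof (rule sum_mono)
    fix u
    show "wt u * mult k u \<le> wt u + wt u * (mult k u - 1)" by (cases "mult k u") auto
  qed
  also have "\<dots> = sum wt (?O \<inter> F) + (\<Sum>u\<in>?O \<inter> F. wt u * (mult k u - 1))"
    by (rule sum.distrib)
  also have "(\<Sum>u\<in>?O \<inter> F. wt u * (mult k u - 1)) \<le> (\<Sum>u\<in>?O \<inter> light. wt u * (mult k u - 1))"
  proof (rule sum_mono2)
    show "finite (?O \<inter> light)" using finite_sol[OF subset_refl] by auto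
    have "F \<subseteq> light" using free_thin[OF hit order_refl] thin_light[OF bd \<open>m > 0\<close> total] by (auto simp: F_def)
    then show "?O \<inter> F \<subseteq> ?O \<inter> light" by auto
  qed simp
  finally have three': "sum wt (\<Union>c\<in>V. sol (core c))
    \<le> sum wt (?O \<inter> F) + (\<Sum>u\<in>?O \<inter> light. wt u * (mult k u - 1))" by simp
  have OF: "sum wt (?O - F) + sum wt (?O \<inter> F) = sum wt ?O"
    using finite_sol[OF subset_refl] by (subst sum.union_disjoint[symmetric]) (auto intro: arg_cong[of _ _ "sum wt"])
  have "sum wt R \<le> (\<Sum>i<t. sum wt (\<Union>s\<in>{s\<in>V. sampled i s}. sol (ring i s (pick i s))))"
    unfolding R_def using finV ring_subset finite_sol by (intro sum_UN_le) auto
  also have "\<dots> \<le> (\<Sum>i<t. \<Sum>s\<in>{s\<in>V. sampled i s}. sum wt (sol (ring i s (pick i s))))"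
    using finV ring_subset finite_sol by (intro sum_mono sum_UN_le) auto
  finally have "m * sum wt R \<le> m * (\<Sum>i<t. \<Sum>s\<in>{s\<in>V. sampled i s}. sum wt (sol (ring i s (pick i s))))"
    by simp
  also have "\<dots> = (\<Sum>i<t. \<Sum>s\<in>{s\<in>V. sampled i s}. m * sum wt (sol (ring i s (pick i s))))"
    by (simp add: sum_distrib_left)
  also have "\<dots> \<le> (\<Sum>i<t. \<Sum>s\<in>{s\<in>V. sampled i s}. sum rough (ring i s (pick i s)))"
    using ring_subset by (intro sum_mono sol_le_rough[OF bd]) auto
  finally have "real (m * sum wt R) \<le> real (\<Sum>i<t. \<Sum>s\<in>{s\<in>V. sampled i s}. sum rough (ring i s (pick i s)))"
    by (rule of_nat_mono)
  then have one: "real (sum wt R) \<le> (\<Sum>i<t. \<Sum>s\<in>{s\<in>V. sampled i s}. real (sum rough (ring i s (pick i s)))) / real m"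
    using \<open>m > 0\<close> by (simp add: pos_le_divide_eq mult.commute)
  have "real (sum wt answers) \<le> real (sum wt R + sum wt ?O + (\<Sum>u\<in>?O \<inter> light. wt u * (mult k u - 1)))"
    using three two three' OF by (intro of_nat_mono) linarith
  then show ?thesis using one unfolding of_nat_add by linarith
qed

end

subsection \<open>Random carvings\<close>

text \<open>Turns a geometric variable into a coin of prescribed bias. For positive
  \<open>\<pi>\<close> the event is a tail \<open>{a..}\<close> of probability
  \<open>(1 - q) ^ a\<close>, where \<open>a\<close> is the first exponent with
  \<open>(1 - q) ^ a \<le> \<pi>\<close>. If \<open>a\<close> is positive, the previous power
  exceeds \<open>\<pi>\<close>, so at most the factor \<open>1 - q \<ge> 1 / 2\<close> is
  lost.\<close>

lemma prob_geometric_power_le: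
  assumes q: "0 < q" "q \<le> 1 / 2"
  shows "measure_pmf.prob (geometric_pmf q) {x. (1 - q) ^ x \<le> \<pi>} \<le> max 0 \<pi>"
    and "min 1 (\<pi> / 2) \<le> measure_pmf.prob (geometric_pmf q) {x. (1 - q) ^ x \<le> \<pi>}"
proof -
  let ?S = "{x. (1 - q) ^ x \<le> \<pi>}"
  have pos: "0 < (1 - q) ^ x" for x using q by simp
  have "measure_pmf.prob (geometric_pmf q) ?S \<le> max 0 \<pi> \<and>
    min 1 (\<pi> / 2) \<le> measure_pmf.prob (geometric_pmf q) ?S"
  proof (cases "\<pi> > 0")
    case False
    then have "\<not> (1 - q) ^ x \<le> \<pi>" for x using pos[of x] by linarith
    then have "?S = {}" by simp
    then show ?thesis using False by simp
  next
    case True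
    have "\<exists>x. (1 - q) ^ x < \<pi>" using q True by (intro real_arch_pow_inv) auto
    then have ex: "\<exists>x. (1 - q) ^ x \<le> \<pi>" by (auto intro: less_imp_le)
    define a where "a = (LEAST x. (1 - q) ^ x \<le> \<pi>)"
    have a: "(1 - q) ^ a \<le> \<pi>" unfolding a_def using ex by (rule LeastI_ex)
    have S: "?S = {a..}"
    proof (intro set_eqI iffI)
      fix x assume "x \<in> ?S"
      then show "x \<in> {a..}" unfolding a_def by (simp add: Least_le)
    next
      fix x assume "x \<in> {a..}"
      then have "(1 - q) ^ x \<le> (1 - q) ^ a" using q by (intro power_decreasing) auto
      then show "x \<in> ?S" using a by simp
    qed
    have P: "measure_pmf.prob (geometric_pmf q) ?S = (1 - q) ^ a"
      unfolding S using q by (simp add: prob_geometric_atLeast)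
    have "min 1 (\<pi> / 2) \<le> (1 - q) ^ a"
    proof (cases a)
      case (Suc a')
      have "\<not> (1 - q) ^ a' \<le> \<pi>" using not_less_Least[of a' "\<lambda>x. (1 - q) ^ x \<le> \<pi>"] Suc
        by (simp add: a_def)
      then have "\<pi> * (1 / 2) \<le> (1 - q) ^ a' * (1 - q)" using q True by (intro mult_mono) auto
      then show ?thesis using Suc by (simp add: mult.commute)
    qed simp
    then show ?thesis using P a by simp
  qed
  then show "measure_pmf.prob (geometric_pmf q) ?S \<le> max 0 \<pi>"
    "min 1 (\<pi> / 2) \<le> measure_pmf.prob (geometric_pmf q) ?S" by auto
qed

lemma exp_minus_le_half_power: "exp (- real k) \<le> (1 / 2) ^ k"
proof -
  have "(2::real) \<le> exp 1" using exp_ge_add_one_self[of 1] by simp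
  then have "exp (-1::real) \<le> 1 / 2" by (simp add: exp_minus field_simps)
  then have "exp (-1::real) ^ k \<le> (1 / 2) ^ k" by (intro power_mono) auto
  then show ?thesis by (simp flip: exp_of_nat_mult)
qed

lemma one_minus_inverse_power_le: "(1 - 1 / 2 ^ b :: real) ^ (k * 2 ^ b) \<le> (1 / 2) ^ k"
proof -
  have "(1 - 1 / 2 ^ b :: real) ^ (k * 2 ^ b) \<le> exp (- (1 / 2 ^ b)) ^ (k * 2 ^ b)"
    using exp_ge_add_one_self[of "- (1 / 2 ^ b) :: real"] by (intro power_mono) auto
  also have "\<dots> = exp (- real k)" by (simp flip: exp_of_nat_mult)
  finally show ?thesis using exp_minus_le_half_power[of k] by simp
qed

lemma Pi_pmf_coordinate:
  assumes "finite A" "x \<in> A"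
  shows "measure_pmf.prob (Pi_pmf A d p) {\<omega>. \<omega> x \<in> S} = measure_pmf.prob (p x) S"
proof -
  have "measure_pmf.prob (map_pmf (\<lambda>f. f x) (Pi_pmf A d p)) S = measure_pmf.prob (p x) S"
    using assms by (simp add: Pi_pmf_component)
  then show ?thesis by (simp add: vimage_def)
qed

text \<open>If some \<open>\<pi> s \<ge> 2\<close>, then \<open>s\<close> is hit for sure. Otherwise
  each \<open>s\<close> is hit with probability at least \<open>\<pi> s / 2\<close>, and
  \<open>1 - x \<le> exp (- x)\<close> bounds the product over independent \<open>s\<close> by
  \<open>exp (- real k)\<close>.\<close>

lemma prob_all_missed_le:
  fixes \<pi> :: "'v \<Rightarrow> real"
  assumes q: "0 < q" "q \<le> 1 / 2" and A: "finite A" and J: "J ` W \<subseteq> A" "inj_on J W" and W: "finite W"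
    and \<pi>: "\<And>s. s \<in> W \<Longrightarrow> 0 \<le> \<pi> s" and sum: "2 * real k \<le> (\<Sum>s\<in>W. \<pi> s)"
  shows "measure_pmf.prob (Pi_pmf A d (\<lambda>_. geometric_pmf q)) {\<omega>. \<forall>s\<in>W. \<not> (1 - q) ^ \<omega> (J s) \<le> \<pi> s}
    \<le> (1 / 2) ^ k"
proof -
  let ?S = "\<lambda>s. {x. (1 - q) ^ x \<le> \<pi> s}"
  let ?B = "\<lambda>i. if i \<in> J ` W then UNIV - ?S (the_inv_into W J i) else UNIV"
  have "{\<omega>. \<forall>s\<in>W. \<not> (1 - q) ^ \<omega> (J s) \<le> \<pi> s} = Pi A ?B"
  proof (intro set_eqI iffI)
    fix \<omega> assume \<omega>: "\<omega> \<in> Pi A ?B"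
    have "\<not> (1 - q) ^ \<omega> (J s) \<le> \<pi> s" if "s \<in> W" for s
    proof -
      have "\<omega> (J s) \<in> ?B (J s)" using \<omega> J(1) that by (intro Pi_mem[OF \<omega>]) auto
      then show ?thesis using that J(2) by (simp add: the_inv_into_f_f)
    qed
    then show "\<omega> \<in> {\<omega>. \<forall>s\<in>W. \<not> (1 - q) ^ \<omega> (J s) \<le> \<pi> s}" by simp
  qed (use J in \<open>auto simp: Pi_def the_inv_into_f_f\<close>)
  then have "measure_pmf.prob (Pi_pmf A d (\<lambda>_. geometric_pmf q)) {\<omega>. \<forall>s\<in>W. \<not> (1 - q) ^ \<omega> (J s) \<le> \<pi> s}
    = (\<Prod>i\<in>A. measure_pmf.prob (geometric_pmf q) (?B i))"
    using A by (simp add: measure_Pi_pmf_Pi)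
  also have "\<dots> = (\<Prod>i\<in>J ` W. measure_pmf.prob (geometric_pmf q) (?B i))"
    using A J(1) by (intro prod.mono_neutral_right) auto
  also have "\<dots> = (\<Prod>s\<in>W. measure_pmf.prob (geometric_pmf q) (UNIV - ?S s))"
    using J(2) by (subst prod.reindex) (auto simp: the_inv_into_f_f intro!: prod.cong)
  also have "\<dots> = (\<Prod>s\<in>W. 1 - measure_pmf.prob (geometric_pmf q) (?S s))"
    using measure_pmf.prob_compl by (intro prod.cong) auto
  also have "\<dots> \<le> (1 / 2) ^ k"
  proof (cases "\<exists>s\<in>W. 2 \<le> \<pi> s")
    case True
    then obtain s where s: "s \<in> W" "2 \<le> \<pi> s" by auto
    have "1 \<le> measure_pmf.prob (geometric_pmf q) (?S s)"
      using prob_geometric_power_le(2)[OF q, of "\<pi> s"] s by simp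
    then have "1 - measure_pmf.prob (geometric_pmf q) (?S s) = 0"
      using measure_pmf.prob_le_1[of "geometric_pmf q" "?S s"] by linarith
    then have "(\<Prod>s\<in>W. 1 - measure_pmf.prob (geometric_pmf q) (?S s)) = 0"
      using s W by (intro prod_zero) auto
    then show ?thesis by simp
  next
    case False
    have "(\<Prod>s\<in>W. 1 - measure_pmf.prob (geometric_pmf q) (?S s)) \<le> (\<Prod>s\<in>W. exp (- (\<pi> s / 2)))"
    proof (intro prod_mono conjI)
      fix s assume s: "s \<in> W"
      then have "\<pi> s / 2 \<le> measure_pmf.prob (geometric_pmf q) (?S s)"
        using prob_geometric_power_le(2)[OF q, of "\<pi> s"] False by auto
      then show "1 - measure_pmf.prob (geometric_pmf q) (?S s) \<le> exp (- (\<pi> s / 2))"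
        using exp_ge_add_one_self[of "- (\<pi> s / 2)"] by linarith
    qed simp
    also have "\<dots> = exp (- ((\<Sum>s\<in>W. \<pi> s) / 2))"
      using W by (simp add: sum_negf sum_divide_distrib flip: exp_sum)
    also have "\<dots> \<le> exp (- real k)" using sum by simp
    finally show ?thesis using exp_minus_le_half_power[of k] by simp
  qed
  finally show ?thesis .
qed

text \<open>The bound on \<open>b\<close> makes \<open>p \<le> 1 / 4\<close>, so that twice the
  expected excess \<open>2 * p * OPT\<close> of a run is at most \<open>OPT\<close>. The bound on
  \<open>m\<close> is what concentration over the runs needs, since the excess of a single run may
  reach \<open>card V * OPT\<close>.\<close>

locale random_carving = covering_network wt adj con V
  for wt :: "'v \<Rightarrow> nat" and adj con V +
  fixes k b t g m :: nat
  assumes k: "0 < k" and b: "4 \<le> b" and g: "0 < g" and m: "0 < m" "k * card V \<le> m"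
begin

abbreviation "q \<equiv> 1 / 2 ^ b :: real"
abbreviation "p \<equiv> 1 - (1 - q) ^ 3"
abbreviation "OPT \<equiv> sum wt (sol V)"
abbreviation "slots A \<equiv> Pi_pmf (V \<times> A) 0 (\<lambda>_. geometric_pmf q)"
abbreviation "copies \<omega> \<equiv> covering_carving.mult adj k b (curry \<omega>)"
abbreviation "light \<equiv> covering_carving.light wt adj con V k b t"
abbreviation "cap \<equiv> carving.cap k b"

lemma covering_carvingI: "covering_carving adj con V"
  by (simp add: covering_carving_def covering_network_axioms)

lemma q_bounds: "0 < q" "q \<le> 1 / 16" "q \<le> 1 / 2" "q \<le> 1"
proof -
  have "(2::real) ^ 4 \<le> 2 ^ b" using b by (intro power_increasing) auto
  then have *: "(16::real) \<le> 2 ^ b" by simp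
  show "0 < q" by simp
  show "q \<le> 1 / 16" using * by (intro divide_left_mono) auto
  then show "q \<le> 1 / 2" "q \<le> 1" by linarith+
qed

lemma p_bounds: "0 \<le> p" "p \<le> 3 * q" "p \<le> 1 / 4"
proof -
  show "0 \<le> p" using q_bounds by (simp add: power_le_one)
  have "1 - 3 * q \<le> (1 - q) ^ 3" using Bernoulli_inequality[of "- q" 3] q_bounds by simp
  then show "p \<le> 3 * q" by linarith
  then show "p \<le> 1 / 4" using q_bounds by linarith
qed

lemma copies_def: "copies \<omega> j u = card {c\<in>ball cap u. \<forall>c'\<in>ball cap u. \<omega> (c', j) + hop u c \<le> \<omega> (c, j) + hop u c' + 2}"
  using covering_carving.mult_def[OF covering_carvingI, of k b "curry \<omega>" j u] by simp

lemma copies_le: "u \<in> V \<Longrightarrow> copies \<omega> j u \<le> card V"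
  unfolding copies_def using ball_subset finV by (intro card_mono) auto

lemma copies_cong: "(\<And>c. c \<in> ball cap u \<Longrightarrow> f (c, j) = h (c, j)) \<Longrightarrow> copies f j u = copies h j u"
  unfolding copies_def by (intro arg_cong[of _ _ card]) auto

section \<open>Tail bounds for the random covers\<close>

lemma expected_excess:
  assumes "finite A" "j \<in> A" "u \<in> V"
  shows "(\<integral>\<^sup>+\<omega>. ennreal (real (copies \<omega> j u - 1)) \<partial>slots A) \<le> ennreal (2 * p)"
  unfolding copies_def
  by (rule nn_integral_near_max_excess) (use assms q_bounds p_bounds finV ball_subset in \<open>auto simp: inj_on_def\<close>)

lemma prob_runs_bounded:
  assumes "finite A"
  shows "measure_pmf.prob (slots A) {\<omega>. \<exists>u\<in>V. \<exists>j\<in>A. cap \<le> \<omega> (u, j)} \<le> real (card V * card A) * (1 / 2) ^ k"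
proof -
  have "measure_pmf.prob (slots A) {\<omega>. \<exists>u\<in>V. \<exists>j\<in>A. cap \<le> \<omega> (u, j)}
      \<le> measure_pmf.prob (slots A) (\<Union>x\<in>V \<times> A. {\<omega>. \<omega> x \<in> {cap..}})"
    by (intro measure_pmf.finite_measure_mono) auto
  also have "\<dots> \<le> (\<Sum>x\<in>V \<times> A. measure_pmf.prob (slots A) {\<omega>. \<omega> x \<in> {cap..}})"
    using assms finV by (intro measure_pmf.finite_measure_subadditive_finite) auto
  also have "\<dots> = (\<Sum>x\<in>V \<times> A. (1 - q) ^ cap)"
  proof (rule sum.cong[OF refl])
    fix x assume x: "x \<in> V \<times> A"
    show "measure_pmf.prob (slots A) {\<omega>. \<omega> x \<in> {cap..}} = (1 - q) ^ cap"
      using x assms finV q_bounds by (subst Pi_pmf_coordinate) (auto simp: prob_geometric_atLeast)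
  qed
  also have "\<dots> \<le> real (card V * card A) * (1 / 2) ^ k"
    using one_minus_inverse_power_le[of b k]
    by (simp add: card_cartesian_product carving.cap_def mult_left_mono)
  finally show ?thesis .
qed

lemma prob_many_clusters:
  assumes "finite A" "j \<in> A" "u \<in> V"
  shows "measure_pmf.prob (slots A) {\<omega>. k + 1 \<le> copies \<omega> j u} \<le> (1 / 2) ^ k"
proof -
  have "measure_pmf.prob (slots A) {\<omega>. k + 1 \<le> copies \<omega> j u} \<le> p ^ k"
    unfolding copies_def
    by (rule prob_many_near_max) (use assms q_bounds p_bounds finV ball_subset in \<open>auto simp: inj_on_def\<close>)
  also have "\<dots> \<le> (1 / 2) ^ k" using p_bounds by (intro power_mono) auto
  finally show ?thesis .
qed

lemma sol_V: "sol V \<subseteq> V" "finite (sol V)"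
  using sol_props(1)[OF subset_refl] finite_sol[OF subset_refl] by auto

text \<open>Multiplicities are truncated at \<open>k\<close>, which changes something only when a
  vertex lies in more than \<open>k\<close> clusters, see \<open>prob_many_clusters\<close>.
  Truncated terms that share a shift with the term of \<open>u\<close> lie in a ball of radius
  \<open>2 * cap\<close>, where the optimum has at most \<open>3 * OPT / 2 ^ t\<close>; so
  \<open>B\<close> carries one factor \<open>k\<close> and the concentration lemma adds another. The
  term \<open>4 * p\<close> is twice the expectation.\<close>

lemma prob_light_excess:
  assumes "finite A" "j \<in> A"
  shows "measure_pmf.prob (slots A) {\<omega>. (\<Sum>u\<in>sol V \<inter> light. real (wt u * (copies \<omega> j u - 1)))
      > (4 * p + 3 * real k ^ 2 / 2 ^ t) * real OPT} \<le> real (card V + 1) * (1 / 2) ^ k"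
proof -
  let ?U = "sol V \<inter> light"
  define Z where "Z u \<omega> = real (wt u) * (if copies \<omega> j u \<le> k then real (copies \<omega> j u - 1) else 0)" for u \<omega>
  define e where "e u = real (wt u) * (2 * p)" for u
  define B where "B = real k * (3 * real OPT / 2 ^ t)"
  let ?J = "\<lambda>u. ball cap u \<times> {j}"
  have conc: "measure_pmf.prob (slots A) {\<omega>. (\<Sum>u\<in>?U. Z u \<omega>) > 2 * (2 * p * real OPT) + real k * B} \<le> (1 / 2) ^ k"
  proof (rule Pi_pmf_concentration[where J = ?J and e = e])
    show "finite ?U" "finite (V \<times> A)" using sol_V finV assms by auto
    show "0 \<le> Z u \<omega>" for u \<omega> by (simp add: Z_def)
    show "0 \<le> e u" for u unfolding e_def using p_bounds by (intro mult_nonneg_nonneg) (simp_all del: of_nat_sum)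
    show "?J u \<subseteq> V \<times> A" if "u \<in> ?U" for u using that sol_V ball_subset assms by blast
    show "0 \<le> B" by (simp add: B_def del: of_nat_sum)
    have "(\<Sum>u\<in>?U. e u) \<le> (\<Sum>u\<in>sol V. e u)" using sol_V p_bounds by (intro sum_mono2) (auto simp: e_def)
    also have "\<dots> = 2 * p * real OPT" by (simp add: e_def sum_distrib_right sum_distrib_left mult.commute)
    finally show "(\<Sum>u\<in>?U. e u) \<le> 2 * p * real OPT" .
    show "(\<integral>\<^sup>+\<omega>. ennreal (Z u \<omega>) \<partial>slots A) \<le> ennreal (e u)" if "u \<in> ?U" for u
    proof -
      have "(\<integral>\<^sup>+\<omega>. ennreal (Z u \<omega>) \<partial>slots A)
          \<le> (\<integral>\<^sup>+\<omega>. ennreal (real (wt u)) * ennreal (real (copies \<omega> j u - 1)) \<partial>slots A)"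
        by (intro nn_integral_mono) (auto simp: Z_def simp flip: ennreal_mult intro!: ennreal_leI)
      also have "\<dots> = ennreal (real (wt u)) * (\<integral>\<^sup>+\<omega>. ennreal (real (copies \<omega> j u - 1)) \<partial>slots A)"
        by (simp add: nn_integral_cmult)
      also have "\<dots> \<le> ennreal (real (wt u)) * ennreal (2 * p)"
        using that sol_V assms by (intro mult_left_mono expected_excess) auto
      also have "\<dots> = ennreal (e u)" using p_bounds by (simp add: e_def flip: ennreal_mult)
      finally show ?thesis .
    qed
    show "Z u f = Z u h" if "\<And>x. x \<in> ?J u \<Longrightarrow> f x = h x" for u and f h :: "_ \<Rightarrow> nat"
      using copies_cong[of u f j h] that by (simp add: Z_def)
    show "(\<Sum>v\<in>{v\<in>?U. v = u \<or> ?J v \<inter> ?J u \<noteq> {}}. Z v \<omega>) \<le> B" if u: "u \<in> ?U" for u \<omega>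
    proof -
      have near: "v \<in> ball (2 * cap) u" if vu: "v = u \<or> ?J v \<inter> ?J u \<noteq> {}" for v
      proof (cases "v = u")
        case False
        then obtain c where "c \<in> ball cap v" "c \<in> ball cap u" using vu by auto
        then show ?thesis using ball_trans[of c cap u v cap] ball_sym by (simp add: mult_2)
      qed simp
      have "(\<Sum>v\<in>{v\<in>?U. v = u \<or> ?J v \<inter> ?J u \<noteq> {}}. Z v \<omega>)
        \<le> (\<Sum>v\<in>{v\<in>?U. v = u \<or> ?J v \<inter> ?J u \<noteq> {}}. real (wt v) * real k)"
        by (intro sum_mono) (auto simp: Z_def intro!: mult_left_mono)
      also have "\<dots> \<le> (\<Sum>v\<in>sol V \<inter> ball (2 * cap) u. real (wt v) * real k)"
        using sol_V near by (intro sum_mono2) auto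
      also have "\<dots> = real k * real (sum wt (sol V \<inter> ball (2 * cap) u))"
        by (simp add: sum_distrib_right sum_distrib_left mult.commute)
      also have "\<dots> \<le> B"
      proof -
        have "2 ^ t * sum wt (sol V \<inter> ball (2 * cap) u) \<le> 3 * OPT"
          using u by (simp add: covering_carving.light_def[OF covering_carvingI])
        then have "real (2 ^ t * sum wt (sol V \<inter> ball (2 * cap) u)) \<le> real (3 * OPT)" by (rule of_nat_mono)
        then have "real (sum wt (sol V \<inter> ball (2 * cap) u)) \<le> 3 * real OPT / 2 ^ t"
          by (simp add: pos_le_divide_eq mult.commute del: of_nat_sum)
        then show ?thesis unfolding B_def by (intro mult_left_mono) auto
      qed
      finally show ?thesis .
    qed
  qed
  have eq: "2 * (2 * p * real OPT) + real k * B = (4 * p + 3 * real k ^ 2 / 2 ^ t) * real OPT"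
    by (simp add: B_def power2_eq_square algebra_simps del: of_nat_sum)
  have "measure_pmf.prob (slots A) {\<omega>. (\<Sum>u\<in>?U. real (wt u * (copies \<omega> j u - 1)))
      > (4 * p + 3 * real k ^ 2 / 2 ^ t) * real OPT}
    \<le> measure_pmf.prob (slots A) ({\<omega>. (\<Sum>u\<in>?U. Z u \<omega>) > 2 * (2 * p * real OPT) + real k * B}
        \<union> (\<Union>u\<in>V. {\<omega>. k + 1 \<le> copies \<omega> j u}))"
  proof (rule measure_pmf.finite_measure_mono)
    show "{\<omega>. (\<Sum>u\<in>?U. real (wt u * (copies \<omega> j u - 1))) > (4 * p + 3 * real k ^ 2 / 2 ^ t) * real OPT}
      \<subseteq> {\<omega>. (\<Sum>u\<in>?U. Z u \<omega>) > 2 * (2 * p * real OPT) + real k * B} \<union> (\<Union>u\<in>V. {\<omega>. k + 1 \<le> copies \<omega> j u})"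
    proof
      fix \<omega> assume \<omega>: "\<omega> \<in> {\<omega>. (\<Sum>u\<in>?U. real (wt u * (copies \<omega> j u - 1))) > (4 * p + 3 * real k ^ 2 / 2 ^ t) * real OPT}"
      show "\<omega> \<in> {\<omega>. (\<Sum>u\<in>?U. Z u \<omega>) > 2 * (2 * p * real OPT) + real k * B} \<union> (\<Union>u\<in>V. {\<omega>. k + 1 \<le> copies \<omega> j u})"
      proof (cases "\<exists>u\<in>V. k + 1 \<le> copies \<omega> j u")
        case False
        then have "Z u \<omega> = real (wt u * (copies \<omega> j u - 1))" if "u \<in> ?U" for u
          using that sol_V by (force simp: Z_def)
        then have "(\<Sum>u\<in>?U. Z u \<omega>) = (\<Sum>u\<in>?U. real (wt u * (copies \<omega> j u - 1)))"
          by (intro sum.cong) auto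
        then show ?thesis using \<omega> unfolding eq by auto
      qed auto
    qed
  qed simp
  also have "\<dots> \<le> measure_pmf.prob (slots A) {\<omega>. (\<Sum>u\<in>?U. Z u \<omega>) > 2 * (2 * p * real OPT) + real k * B}
      + measure_pmf.prob (slots A) (\<Union>u\<in>V. {\<omega>. k + 1 \<le> copies \<omega> j u})"
    by (intro measure_Un_le) auto
  also have "measure_pmf.prob (slots A) (\<Union>u\<in>V. {\<omega>. k + 1 \<le> copies \<omega> j u})
      \<le> (\<Sum>u\<in>V. measure_pmf.prob (slots A) {\<omega>. k + 1 \<le> copies \<omega> j u})"
    using finV by (intro measure_pmf.finite_measure_subadditive_finite) auto
  also have "\<dots> \<le> (\<Sum>u\<in>V. (1 / 2) ^ k)" using assms by (intro sum_mono prob_many_clusters)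
  finally show ?thesis using conc by (simp add: algebra_simps)
qed

text \<open>Here the independent units are whole runs. The three multiples of \<open>m * OPT\<close>
  are the optimum counted once per run, twice the expected excess, as \<open>4 * p \<le> 1\<close>,
  and \<open>k\<close> times the largest excess \<open>card V * OPT\<close> of a single run.\<close>

lemma prob_rough_total:
  assumes A: "finite A" "{k..<k + m} \<subseteq> A"
  shows "measure_pmf.prob (slots A) {\<omega>. (\<Sum>j\<in>{k..<k + m}. \<Sum>u\<in>sol V. wt u * copies \<omega> j u) > 3 * m * OPT}
    \<le> (1 / 2) ^ k"
proof -
  let ?U = "{k..<k + m}"
  define Z where "Z j \<omega> = (\<Sum>u\<in>sol V. real (wt u) * real (copies \<omega> j u - 1))" for j \<omega>
  define e where "e j = 2 * p * real OPT" for j :: nat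
  define B where "B = real (card V) * real OPT"
  let ?J = "\<lambda>j. V \<times> {j}"
  have conc: "measure_pmf.prob (slots A) {\<omega>. (\<Sum>j\<in>?U. Z j \<omega>) > 2 * (real m * (2 * p * real OPT)) + real k * B} \<le> (1 / 2) ^ k"
  proof (rule Pi_pmf_concentration[where J = ?J and e = e])
    show "finite ?U" "finite (V \<times> A)" using finV assms by auto
    show "0 \<le> Z u \<omega>" for u \<omega> by (simp add: Z_def sum_nonneg)
    show "0 \<le> e u" for u unfolding e_def using p_bounds by (intro mult_nonneg_nonneg) (simp_all del: of_nat_sum)
    show "?J u \<subseteq> V \<times> A" if "u \<in> ?U" for u using that A by auto
    show "0 \<le> B" by (simp add: B_def del: of_nat_sum)
    show "(\<Sum>u\<in>?U. e u) \<le> real m * (2 * p * real OPT)" by (simp add: e_def)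
    show "(\<integral>\<^sup>+\<omega>. ennreal (Z j \<omega>) \<partial>slots A) \<le> ennreal (e j)" if "j \<in> ?U" for j
    proof -
      have "(\<integral>\<^sup>+\<omega>. ennreal (Z j \<omega>) \<partial>slots A)
          = (\<Sum>u\<in>sol V. \<integral>\<^sup>+\<omega>. ennreal (real (wt u)) * ennreal (real (copies \<omega> j u - 1)) \<partial>slots A)"
        by (subst nn_integral_sum[symmetric]) (auto simp: Z_def sum_ennreal simp flip: ennreal_mult)
      also have "\<dots> = (\<Sum>u\<in>sol V. ennreal (real (wt u)) * (\<integral>\<^sup>+\<omega>. ennreal (real (copies \<omega> j u - 1)) \<partial>slots A))"
        by (simp add: nn_integral_cmult)
      also have "\<dots> \<le> (\<Sum>u\<in>sol V. ennreal (real (wt u)) * ennreal (2 * p))"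
        using that sol_V assms by (intro sum_mono mult_left_mono expected_excess) auto
      also have "\<dots> = (\<Sum>u\<in>sol V. ennreal (real (wt u) * (2 * p)))" using p_bounds by (simp flip: ennreal_mult)
      also have "\<dots> = ennreal (\<Sum>u\<in>sol V. real (wt u) * (2 * p))" using p_bounds by (intro sum_ennreal) auto
      also have "\<dots> = ennreal (e j)" by (simp add: e_def mult.commute mult.left_commute flip: sum_distrib_right)
      finally show ?thesis .
    qed
    show "Z j f = Z j h" if "\<And>x. x \<in> ?J j \<Longrightarrow> f x = h x" for j and f h :: "_ \<Rightarrow> nat"
    proof -
      have "copies f j u = copies h j u" if "u \<in> sol V" for u
      proof (rule copies_cong)
        fix c assume "c \<in> ball cap u"
        then have "c \<in> V" using \<open>u \<in> sol V\<close> sol_V ball_subset by blast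
        then show "f (c, j) = h (c, j)" using \<open>\<And>x. x \<in> ?J j \<Longrightarrow> f x = h x\<close> by simp
      qed
      then show ?thesis by (simp add: Z_def)
    qed
    show "(\<Sum>v\<in>{v\<in>?U. v = u \<or> ?J v \<inter> ?J u \<noteq> {}}. Z v \<omega>) \<le> B" if u: "u \<in> ?U" for u \<omega>
    proof -
      have "{v\<in>?U. v = u \<or> ?J v \<inter> ?J u \<noteq> {}} = {u}" using u by auto
      then have "(\<Sum>v\<in>{v\<in>?U. v = u \<or> ?J v \<inter> ?J u \<noteq> {}}. Z v \<omega>) = Z u \<omega>" by simp
      also have "\<dots> \<le> (\<Sum>x\<in>sol V. real (wt x) * real (card V))"
        unfolding Z_def
      proof (intro sum_mono mult_left_mono)
        fix x assume "x \<in> sol V"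
        then have "copies \<omega> u x \<le> card V" using sol_V by (intro copies_le) auto
        then show "real (copies \<omega> u x - 1) \<le> real (card V)" by simp
      qed simp
      also have "\<dots> = B" by (simp add: B_def sum_distrib_left mult.commute)
      finally show ?thesis .
    qed
  qed
  have sub: "{\<omega>. (\<Sum>j\<in>?U. \<Sum>u\<in>sol V. wt u * copies \<omega> j u) > 3 * m * OPT}
    \<subseteq> {\<omega>. (\<Sum>j\<in>?U. Z j \<omega>) > 2 * (real m * (2 * p * real OPT)) + real k * B}"
  proof
    fix \<omega> assume "\<omega> \<in> {\<omega>. (\<Sum>j\<in>?U. \<Sum>u\<in>sol V. wt u * copies \<omega> j u) > 3 * m * OPT}"
    then have "real (3 * m * OPT) < real (\<Sum>j\<in>?U. \<Sum>u\<in>sol V. wt u * copies \<omega> j u)"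
      by (simp only: mem_Collect_eq of_nat_less_iff)
    also have "\<dots> \<le> (\<Sum>j\<in>?U. real OPT + Z j \<omega>)"
      unfolding of_nat_sum Z_def sum.distrib[symmetric]
    proof (intro sum_mono)
      fix j x
      show "real (wt x * copies \<omega> j x) \<le> real (wt x) + real (wt x) * real (copies \<omega> j x - 1)"
        by (cases "copies \<omega> j x") (auto simp: algebra_simps)
    qed
    also have "\<dots> = real m * real OPT + (\<Sum>j\<in>?U. Z j \<omega>)" by (simp add: sum.distrib)
    finally have *: "3 * real m * real OPT < real m * real OPT + (\<Sum>j\<in>?U. Z j \<omega>)" by simp
    have "2 * (real m * (2 * p * real OPT)) = 4 * p * (real m * real OPT)" by simp
    also have "\<dots> \<le> 1 * (real m * real OPT)" using p_bounds by (intro mult_right_mono) (simp_all del: of_nat_sum)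
    finally have 1: "2 * (real m * (2 * p * real OPT)) \<le> real m * real OPT" by simp
    have "real (k * card V) * real OPT \<le> real m * real OPT"
      using m by (intro mult_right_mono of_nat_mono) (simp_all del: of_nat_sum)
    then have 2: "real k * B \<le> real m * real OPT" by (simp add: B_def)
    show "\<omega> \<in> {\<omega>. (\<Sum>j\<in>?U. Z j \<omega>) > 2 * (real m * (2 * p * real OPT)) + real k * B}"
      using * 1 2 by simp
  qed
  have "measure_pmf.prob (slots A) {\<omega>. (\<Sum>j\<in>?U. \<Sum>u\<in>sol V. wt u * copies \<omega> j u) > 3 * m * OPT}
    \<le> measure_pmf.prob (slots A) {\<omega>. (\<Sum>j\<in>?U. Z j \<omega>) > 2 * (real m * (2 * p * real OPT)) + real k * B}"
    using sub by (intro measure_pmf.finite_measure_mono) auto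
  then show ?thesis using conc by linarith
qed

section \<open>Sampling of centres\<close>

lemma prob_missed:
  fixes \<omega>0 :: "'v \<times> nat \<Rightarrow> nat"
  assumes "finite A" "k + m + i \<in> A" and u: "u \<in> V"
    and dens: "1 / 2 ^ Suc i < (\<Sum>v\<in>ball r u. carving.dens wt adj con k b t g m T v)"
  shows "measure_pmf.prob (slots A) {\<omega>. \<forall>s\<in>ball r u.
      \<not> (1 - q) ^ \<omega> (s, k + m + i) \<le> 2 ^ i * (4 * real k) * carving.dens wt adj con k b t g m T s}
    \<le> (1 / 2) ^ k"
proof -
  interpret C: covering_carving wt adj con V k b t g m T by (rule covering_carvingI)
  show ?thesis
  proof (rule prob_all_missed_le)
    \<comment> \<open>The factor \<open>4 * k\<close> in \<open>sampled\<close> is chosen for this: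
      a ball of density above \<open>1 / 2 ^ Suc i\<close> gets total rate at least
      \<open>2 * k\<close>, which makes a miss as unlikely as \<open>(1 / 2) ^ k\<close>.\<close>
    have "2 * real k = 2 ^ i * (4 * real k) * (1 / 2 ^ Suc i)" by simp
    also have "\<dots> \<le> 2 ^ i * (4 * real k) * (\<Sum>v\<in>ball r u. C.dens v)"
      using dens by (intro mult_left_mono) auto
    finally show "2 * real k \<le> (\<Sum>s\<in>ball r u. 2 ^ i * (4 * real k) * C.dens s)"
      by (simp add: sum_distrib_left)
    show "(\<lambda>s. (s, k + m + i)) ` ball r u \<subseteq> V \<times> A" using assms ball_subset by auto
    show "0 \<le> 2 ^ i * (4 * real k) * C.dens s" for s using C.dens_nonneg by simp
  qed (use assms q_bounds finV in \<open>auto simp: inj_on_def\<close>)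
qed

text \<open>Double counting: a thin vertex \<open>v\<close> is charged for a centre \<open>s\<close>
  only if \<open>v\<close> is in \<open>ball (rad i) s\<close>, and such centres have total density
  at most \<open>1 / 2 ^ i\<close>. This cancels the factor \<open>2 ^ i\<close> of the sampling
  rate, and picking the cheapest ring saves the factor \<open>g\<close>.\<close>

lemma ring_mean:
  fixes T
  defines "c i s \<equiv> real (sum (carving.rough wt adj con k b m T)
      (carving.ring wt adj con k b t g m T i s (carving.pick wt adj con k b t g m T i s)))"
    and "Q \<equiv> real (sum (carving.rough wt adj con k b m T) V)"
  shows "(\<Sum>s\<in>V. c i s * (2 ^ i * (4 * real k) * carving.dens wt adj con k b t g m T s)) \<le> 4 * real k * Q / real g"
    and "s \<in> V \<Longrightarrow> c i s \<le> Q / real g"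
proof -
  interpret C: covering_carving wt adj con V k b t g m T by (rule covering_carvingI)
  let ?R = "\<lambda>s. {v\<in>ball (C.rad i) s. C.thin i v}"
  have cg: "c i s \<le> real (sum C.rough (?R s)) / real g" if "s \<in> V" for s
  proof -
    have "real (g * sum C.rough (C.ring i s (C.pick i s))) \<le> real (sum C.rough (?R s))"
      using C.ring_cheap[OF that] by (rule of_nat_mono)
    then show ?thesis using g by (simp add: c_def pos_le_divide_eq mult.commute del: of_nat_sum)
  qed
  have fin: "finite (?R s)" "?R s \<subseteq> V" if "s \<in> V" for s
    using that ball_subset by auto
  show "c i s \<le> Q / real g" if "s \<in> V"
  proof -
    have "real (sum C.rough (?R s)) \<le> Q"
      unfolding Q_def using fin[OF that] finV by (intro of_nat_mono sum_mono2) auto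
    then show ?thesis using cg[OF that] g by (meson divide_right_mono of_nat_0_le_iff order_trans)
  qed
  have "(\<Sum>s\<in>V. c i s * C.dens s) \<le> (\<Sum>s\<in>V. real (sum C.rough (?R s)) / real g * C.dens s)"
    using cg C.dens_nonneg by (intro sum_mono mult_right_mono) auto
  also have "\<dots> = (\<Sum>s\<in>V. (\<Sum>v\<in>V. if v \<in> ?R s then real (C.rough v) * C.dens s else 0) / real g)"
  proof (rule sum.cong[OF refl])
    fix s assume s: "s \<in> V"
    have "(\<Sum>v\<in>V. if v \<in> ?R s then real (C.rough v) * C.dens s else 0) = (\<Sum>v\<in>V \<inter> ?R s. real (C.rough v) * C.dens s)"
      using finV by (subst sum.inter_restrict) auto
    also have "V \<inter> ?R s = ?R s" using fin[OF s] by auto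
    finally show "real (sum C.rough (?R s)) / real g * C.dens s
      = (\<Sum>v\<in>V. if v \<in> ?R s then real (C.rough v) * C.dens s else 0) / real g"
      by (simp add: sum_distrib_right)
  qed
  also have "\<dots> = (\<Sum>s\<in>V. \<Sum>v\<in>V. if v \<in> ?R s then real (C.rough v) * C.dens s else 0) / real g"
    by (rule sum_divide_distrib[symmetric])
  finally have mean: "(\<Sum>s\<in>V. c i s * C.dens s)
    \<le> (\<Sum>s\<in>V. \<Sum>v\<in>V. if v \<in> ?R s then real (C.rough v) * C.dens s else 0) / real g" .
  have "(\<Sum>s\<in>V. \<Sum>v\<in>V. if v \<in> ?R s then real (C.rough v) * C.dens s else 0)
    = (\<Sum>v\<in>V. \<Sum>s\<in>V. if v \<in> ?R s then real (C.rough v) * C.dens s else 0)" by (rule sum.swap)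
  also have "\<dots> \<le> (\<Sum>v\<in>V. real (C.rough v) * (1 / 2 ^ i))"
  proof (rule sum_mono)
    fix v assume v: "v \<in> V"
    show "(\<Sum>s\<in>V. if v \<in> ?R s then real (C.rough v) * C.dens s else 0) \<le> real (C.rough v) * (1 / 2 ^ i)"
    proof (cases "C.thin i v")
      case True
      have "(\<Sum>s\<in>V. if v \<in> ?R s then real (C.rough v) * C.dens s else 0)
        = (\<Sum>s\<in>V. if s \<in> ball (C.rad i) v then real (C.rough v) * C.dens s else 0)"
        using True ball_sym by (intro sum.cong) auto
      also have "\<dots> = (\<Sum>s\<in>V \<inter> ball (C.rad i) v. real (C.rough v) * C.dens s)"
        using finV by (subst sum.inter_restrict) auto
      also have "V \<inter> ball (C.rad i) v = ball (C.rad i) v" using v ball_subset by auto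
      also have "(\<Sum>s\<in>ball (C.rad i) v. real (C.rough v) * C.dens s) = real (C.rough v) * (\<Sum>s\<in>ball (C.rad i) v. C.dens s)"
        by (simp add: sum_distrib_left)
      also have "\<dots> \<le> real (C.rough v) * (1 / 2 ^ i)"
        using True by (intro mult_left_mono) (auto simp: C.thin_def)
      finally show ?thesis .
    qed simp
  qed
  also have "\<dots> = Q / 2 ^ i" by (simp add: Q_def sum_divide_distrib)
  finally have "(\<Sum>s\<in>V. \<Sum>v\<in>V. if v \<in> ?R s then real (C.rough v) * C.dens s else 0) / real g
    \<le> Q / 2 ^ i / real g" by (rule divide_right_mono) simp
  with mean have *: "(\<Sum>s\<in>V. c i s * C.dens s) \<le> Q / 2 ^ i / real g" by (rule order_trans)
  have "(\<Sum>s\<in>V. c i s * (2 ^ i * (4 * real k) * C.dens s)) = 2 ^ i * (4 * real k) * (\<Sum>s\<in>V. c i s * C.dens s)"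
    by (simp add: sum_distrib_left mult_ac)
  also have "\<dots> \<le> 2 ^ i * (4 * real k) * (Q / 2 ^ i / real g)"
    using * by (intro mult_left_mono) auto
  finally show "(\<Sum>s\<in>V. c i s * (2 ^ i * (4 * real k) * C.dens s)) \<le> 4 * real k * Q / real g" by simp
qed

text \<open>Centres are sampled independently, so \<open>B\<close> is just the largest cost
  \<open>Q / g\<close> of one ring. Twice the mean \<open>4 * k * Q / g\<close> plus
  \<open>k * B\<close> gives the constant nine.\<close>

lemma prob_rings:
  fixes T
  defines "c i s \<equiv> real (sum (carving.rough wt adj con k b m T)
      (carving.ring wt adj con k b t g m T i s (carving.pick wt adj con k b t g m T i s)))"
    and "Q \<equiv> real (sum (carving.rough wt adj con k b m T) V)"
  assumes "finite A" "k + m + i \<in> A"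
  shows "measure_pmf.prob (slots A) {\<omega>. 9 * real k * Q / real g <
      (\<Sum>s\<in>{s\<in>V. (1 - q) ^ \<omega> (s, k + m + i) \<le> 2 ^ i * (4 * real k) * carving.dens wt adj con k b t g m T s}. c i s)}
    \<le> (1 / 2) ^ k"
proof -
  interpret C: covering_carving wt adj con V k b t g m T by (rule covering_carvingI)
  let ?\<pi> = "\<lambda>s. 2 ^ i * (4 * real k) * C.dens s"
  have c0: "0 \<le> c i s" for s by (simp add: c_def sum_nonneg del: of_nat_sum)
  have pi0: "0 \<le> ?\<pi> s" for s using C.dens_nonneg by simp
  have Q0: "0 \<le> Q" by (simp add: Q_def del: of_nat_sum)
  define Z where "Z s \<omega> = (if (1 - q) ^ \<omega> (s, k + m + i) \<le> ?\<pi> s then c i s else 0)" for s and \<omega> :: "_ \<Rightarrow> nat"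
  let ?J = "\<lambda>s. {(s, k + m + i)}"
  have "measure_pmf.prob (slots A) {\<omega>. (\<Sum>s\<in>V. Z s \<omega>) > 2 * (4 * real k * Q / real g) + real k * (Q / real g)} \<le> (1 / 2) ^ k"
  proof (rule Pi_pmf_concentration[where J = ?J and e = "\<lambda>s. c i s * ?\<pi> s"])
    show "finite V" "finite (V \<times> A)" using finV assms by auto
    show "0 \<le> Z s \<omega>" for s \<omega> by (simp add: Z_def c0)
    show "0 \<le> c i s * ?\<pi> s" for s by (rule mult_nonneg_nonneg[OF c0 pi0])
    show "?J s \<subseteq> V \<times> A" if "s \<in> V" for s using that assms by auto
    show "0 \<le> Q / real g" using Q0 by simp
    show "(\<Sum>s\<in>V. c i s * ?\<pi> s) \<le> 4 * real k * Q / real g"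
      using ring_mean(1) unfolding c_def Q_def .
    show "(\<integral>\<^sup>+\<omega>. ennreal (Z s \<omega>) \<partial>slots A) \<le> ennreal (c i s * ?\<pi> s)" if "s \<in> V" for s
    proof -
      let ?E = "{\<omega>. \<omega> (s, k + m + i) \<in> {x. (1 - q) ^ x \<le> ?\<pi> s}}"
      have "(\<integral>\<^sup>+\<omega>. ennreal (Z s \<omega>) \<partial>slots A) = (\<integral>\<^sup>+\<omega>. ennreal (c i s) * indicator ?E \<omega> \<partial>slots A)"
        by (intro nn_integral_cong) (auto simp: Z_def indicator_def)
      also have "\<dots> = ennreal (c i s) * ennreal (measure_pmf.prob (slots A) ?E)"
        by (simp add: nn_integral_cmult measure_pmf.emeasure_eq_measure)
      also have "measure_pmf.prob (slots A) ?E = measure_pmf.prob (geometric_pmf q) {x. (1 - q) ^ x \<le> ?\<pi> s}"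
        using that finV assms by (intro Pi_pmf_coordinate) auto
      also have "ennreal (c i s) * ennreal \<dots> \<le> ennreal (c i s) * ennreal (?\<pi> s)"
        using prob_geometric_power_le(1)[OF q_bounds(1,3), of "?\<pi> s"] pi0[of s] by (intro mult_left_mono ennreal_leI) auto
      also have "\<dots> = ennreal (c i s * ?\<pi> s)" using c0 pi0 by (simp flip: ennreal_mult)
      finally show ?thesis .
    qed
    show "Z s f = Z s h" if "\<And>x. x \<in> ?J s \<Longrightarrow> f x = h x" for s and f h :: "_ \<Rightarrow> nat"
      using that by (simp add: Z_def)
    show "(\<Sum>v\<in>{v\<in>V. v = s \<or> ?J v \<inter> ?J s \<noteq> {}}. Z v \<omega>) \<le> Q / real g" if s: "s \<in> V" for s \<omega>
    proof -
      have "{v\<in>V. v = s \<or> ?J v \<inter> ?J s \<noteq> {}} = {s}" using s by auto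
      then have "(\<Sum>v\<in>{v\<in>V. v = s \<or> ?J v \<inter> ?J s \<noteq> {}}. Z v \<omega>) = Z s \<omega>" by simp
      also have "\<dots> \<le> c i s" using c0 by (simp add: Z_def)
      also have "\<dots> \<le> Q / real g" using ring_mean(2)[OF s] unfolding c_def Q_def .
      finally show ?thesis .
    qed
  qed
  moreover have "2 * (4 * real k * Q / real g) + real k * (Q / real g) = 9 * real k * Q / real g"
    by (simp add: field_simps)
  moreover have "(\<Sum>s\<in>V. Z s \<omega>) = (\<Sum>s\<in>{s\<in>V. (1 - q) ^ \<omega> (s, k + m + i) \<le> ?\<pi> s}. c i s)" for \<omega>
    using finV by (simp add: Z_def sum.If_cases Int_def)
  ultimately show ?thesis by (simp only:)
qed

text \<open>Rings and their costs are functions of the run slots alone. Conditioned on these, the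
  sampling slots are fresh randomness.\<close>

lemma run_slots_cong:
  assumes "\<And>v j. j \<in> {k..<k + m} \<Longrightarrow> T v j = T' v j"
  shows "carving.rough wt adj con k b m T = carving.rough wt adj con k b m T'"
    and "carving.dens wt adj con k b t g m T = carving.dens wt adj con k b t g m T'"
    and "carving.ring wt adj con k b t g m T = carving.ring wt adj con k b t g m T'"
    and "carving.pick wt adj con k b t g m T = carving.pick wt adj con k b t g m T'"
proof -
  have joins: "carving.joins adj k b T j = carving.joins adj k b T' j" if "j \<in> {k..<k + m}" for j
    using assms[OF that] by (simp add: carving.joins_def fun_eq_iff)
  have chosen: "carving.chosen wt adj con k b T j = carving.chosen wt adj con k b T' j" if "j \<in> {k..<k + m}" for j
    using joins[OF that] by (simp add: carving.chosen_def carving.cluster_def fun_eq_iff)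
  show rough: "carving.rough wt adj con k b m T = carving.rough wt adj con k b m T'"
  proof
    fix u
    have "{j\<in>{k..<k + m}. carving.chosen wt adj con k b T j u} = {j\<in>{k..<k + m}. carving.chosen wt adj con k b T' j u}"
      using chosen by auto
    then show "carving.rough wt adj con k b m T u = carving.rough wt adj con k b m T' u"
      by (simp add: carving.rough_def)
  qed
  show dens: "carving.dens wt adj con k b t g m T = carving.dens wt adj con k b t g m T'"
    by (simp add: carving.dens_def rough fun_eq_iff)
  show ring: "carving.ring wt adj con k b t g m T = carving.ring wt adj con k b t g m T'"
    by (simp add: carving.ring_def carving.thin_def dens fun_eq_iff)
  show "carving.pick wt adj con k b t g m T = carving.pick wt adj con k b t g m T'"
    by (simp add: carving.pick_def ring rough fun_eq_iff)
qed

abbreviation "sampling_fails T \<equiv>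
  \<not> covering_carving.hitting wt adj con V k b t g m T \<or>
  (\<exists>i<t. 9 * real k * real (sum (carving.rough wt adj con k b m T) V) / real g <
    (\<Sum>s\<in>{s\<in>V. carving.sampled wt adj con k b t g m T i s}. real (sum (carving.rough wt adj con k b m T)
      (carving.ring wt adj con k b t g m T i s (carving.pick wt adj con k b t g m T i s)))))"

lemma prob_sampling_fails:
  "measure_pmf.prob (slots {k..<k + m + t}) {\<omega>. sampling_fails (curry \<omega>)}
    \<le> real (t * card V + t) * (1 / 2) ^ k"
proof -
  let ?A = "V \<times> {k..<k + m}" and ?S = "{k + m..<k + m + t}"
  let ?B = "V \<times> ?S"
  have AB: "V \<times> {k..<k + m + t} = ?A \<union> ?B" by auto
  show ?thesis
    unfolding AB
  proof (rule Pi_pmf_union_prob_le)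
    fix f :: "'v \<times> nat \<Rightarrow> nat"
    let ?mg = "\<lambda>h x. if x \<in> ?A then f x else h x"
    define T where "T = curry (\<lambda>x. if x \<in> ?A then f x else 0)"
    interpret C: covering_carving wt adj con V k b t g m T by (rule covering_carvingI)
    \<comment> \<open>Almost surely a function drawn from the product is 0 outside
      \<open>?B\<close>. Composing with \<open>?cut\<close> makes this hold everywhere, so the run
      slots agree with \<open>T\<close> also at arguments outside \<open>V\<close>, as
      \<open>run_slots_cong\<close> requires.\<close>
    let ?cut = "\<lambda>h x. if x \<in> ?B then h x else (0::nat)"
    have sup: "Pi_pmf ?B 0 (\<lambda>_. geometric_pmf q) = map_pmf ?cut (Pi_pmf ?B 0 (\<lambda>_. geometric_pmf q))"
      using finV by (intro Pi_pmf_default_swap[symmetric]) auto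
    define H where "H i u = {h. 1 / 2 ^ Suc i < (\<Sum>v\<in>ball (C.rad (Suc i)) u. C.dens v) \<and>
      (\<forall>s\<in>ball (C.rad (Suc i)) u. \<not> (1 - q) ^ h (s, k + m + i) \<le> 2 ^ i * (4 * real k) * C.dens s)}" for i u
    define K where "K i = {h. 9 * real k * real (sum C.rough V) / real g <
      (\<Sum>s\<in>{s\<in>V. (1 - q) ^ h (s, k + m + i) \<le> 2 ^ i * (4 * real k) * C.dens s}.
        real (sum C.rough (C.ring i s (C.pick i s))))}" for i
    have sub: "{h. sampling_fails (curry (?mg (?cut h)))} \<subseteq> (\<Union>i<t. (\<Union>u\<in>V. H i u) \<union> K i)"
    proof
      fix h assume "h \<in> {h. sampling_fails (curry (?mg (?cut h)))}"
      then have fails: "sampling_fails (curry (?mg (?cut h)))" by simp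
      let ?T = "curry (?mg (?cut h))"
      interpret D: covering_carving wt adj con V k b t g m ?T by (rule covering_carvingI)
      have "?T v j = T v j" if "j \<in> {k..<k + m}" for v j using that by (auto simp: T_def)
      note eq = run_slots_cong[OF this]
      have sampled: "D.sampled i s \<longleftrightarrow> (1 - q) ^ h (s, k + m + i) \<le> 2 ^ i * (4 * real k) * C.dens s"
        if "i < t" "s \<in> V" for i s
      proof -
        have "?T s (k + m + i) = h (s, k + m + i)" using that by simp
        then show ?thesis unfolding D.sampled_def using eq(2) by (simp only:)
      qed
      have "h \<in> (\<Union>i<t. (\<Union>u\<in>V. H i u))" if "\<not> D.hitting"
      proof -
        obtain i u where iu: "i < t" "u \<in> V" "1 / 2 ^ Suc i < (\<Sum>v\<in>ball (D.rad (Suc i)) u. D.dens v)"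
          "\<forall>s\<in>ball (D.rad (Suc i)) u. \<not> D.sampled i s"
          using \<open>\<not> D.hitting\<close> unfolding D.hitting_def by blast
        have "h \<in> H i u" unfolding H_def mem_Collect_eq
        proof
          show "1 / 2 ^ Suc i < (\<Sum>v\<in>ball (C.rad (Suc i)) u. C.dens v)" using iu(3) eq(2) by (simp only:)
          show "\<forall>s\<in>ball (C.rad (Suc i)) u. \<not> (1 - q) ^ h (s, k + m + i) \<le> 2 ^ i * (4 * real k) * C.dens s"
            using iu(4) sampled[OF iu(1)] ball_subset[OF iu(2)] by blast
        qed
        then show ?thesis using iu by blast
      qed
      moreover have "h \<in> (\<Union>i<t. K i)" if hit: "D.hitting"
      proof -
        obtain i where i: "i < t" "9 * real k * real (sum D.rough V) / real g <
            (\<Sum>s\<in>{s\<in>V. D.sampled i s}. real (sum D.rough (D.ring i s (D.pick i s))))"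
          using fails hit by blast
        have "{s\<in>V. D.sampled i s} = {s\<in>V. (1 - q) ^ h (s, k + m + i) \<le> 2 ^ i * (4 * real k) * C.dens s}"
          using sampled[OF i(1)] by blast
        then have "h \<in> K i" using i(2) by (simp only: K_def eq mem_Collect_eq)
        then show ?thesis using i by blast
      qed
      ultimately show "h \<in> (\<Union>i<t. (\<Union>u\<in>V. H i u) \<union> K i)" by blast
    qed
    have "measure_pmf.prob (Pi_pmf ?B 0 (\<lambda>_. geometric_pmf q)) {h. sampling_fails (curry (?mg h))}
      = measure_pmf.prob (slots ?S) {h. sampling_fails (curry (?mg (?cut h)))}"
      by (subst sup) (simp add: vimage_def)
    also have "\<dots> \<le> measure_pmf.prob (slots ?S) (\<Union>i<t. (\<Union>u\<in>V. H i u) \<union> K i)"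
      using sub by (rule measure_pmf.finite_measure_mono) simp
    also have "\<dots> \<le> (\<Sum>i<t. measure_pmf.prob (slots ?S) ((\<Union>u\<in>V. H i u) \<union> K i))"
      by (intro measure_pmf.finite_measure_subadditive_finite) auto
    also have "\<dots> \<le> (\<Sum>i<t. real (card V + 1) * (1 / 2) ^ k)"
    proof (rule sum_mono)
      fix i assume i: "i \<in> {..<t}"
      have H: "measure_pmf.prob (slots ?S) (H i u) \<le> (1 / 2) ^ k" if "u \<in> V" for u
      proof (cases "1 / 2 ^ Suc i < (\<Sum>v\<in>ball (C.rad (Suc i)) u. C.dens v)")
        case True
        then show ?thesis using prob_missed[OF _ _ that True, of ?S] i by (simp add: H_def)
      qed (simp add: H_def)
      have "measure_pmf.prob (slots ?S) ((\<Union>u\<in>V. H i u) \<union> K i)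
        \<le> measure_pmf.prob (slots ?S) (\<Union>u\<in>V. H i u) + measure_pmf.prob (slots ?S) (K i)"
        by (intro measure_Un_le) auto
      also have "measure_pmf.prob (slots ?S) (\<Union>u\<in>V. H i u) \<le> (\<Sum>u\<in>V. measure_pmf.prob (slots ?S) (H i u))"
        using finV by (intro measure_pmf.finite_measure_subadditive_finite) auto
      also have "\<dots> \<le> (\<Sum>u\<in>V. (1 / 2) ^ k)" by (intro sum_mono H)
      also have "measure_pmf.prob (slots ?S) (K i) \<le> (1 / 2) ^ k"
        using prob_rings[of ?S i T] i by (simp add: K_def)
      finally show "measure_pmf.prob (slots ?S) ((\<Union>u\<in>V. H i u) \<union> K i) \<le> real (card V + 1) * (1 / 2) ^ k"
        by (simp add: algebra_simps)
    qed
    also have "\<dots> = real (t * card V + t) * (1 / 2) ^ k" by (simp add: algebra_simps)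
    finally show "measure_pmf.prob (Pi_pmf ?B 0 (\<lambda>_. geometric_pmf q)) {h. sampling_fails (curry (?mg h))}
      \<le> real (t * card V + t) * (1 / 2) ^ k" .
  qed (use finV in auto)
qed

abbreviation "answers T \<equiv> {u\<in>V. carving.answer wt adj con k b t g m T u}"

text \<open>Outside four bad events the deterministic bounds apply. The constant 27 is the nine of
  \<open>prob_rings\<close> times the three of \<open>prob_rough_total\<close>.\<close>

theorem prob_answers:
  assumes \<epsilon>: "4 * p + 3 * real k ^ 2 / 2 ^ t + 27 * real t * real k / real g \<le> \<epsilon>" and "0 < t"
  shows "measure_pmf.prob (slots {k..<k + m + t})
     {\<omega>. \<not> (covers (answers (curry \<omega>)) V \<and> real (sum wt (answers (curry \<omega>))) \<le> (1 + \<epsilon>) * real OPT)}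
    \<le> real (card V * (m + t) + card V + 2 + t * card V + t) * (1 / 2) ^ k"
proof -
  let ?I = "{k..<k + m + t}"
  let ?P = "measure_pmf.prob (slots ?I)"
  define E1 where "E1 = {\<omega>. \<exists>u\<in>V. \<exists>j\<in>?I. cap \<le> \<omega> (u, j)}"
  define E2 where "E2 = {\<omega>. (\<Sum>u\<in>sol V \<inter> light. real (wt u * (copies \<omega> k u - 1)))
      > (4 * p + 3 * real k ^ 2 / 2 ^ t) * real OPT}"
  define E3 where "E3 = {\<omega>. (\<Sum>j\<in>{k..<k + m}. \<Sum>u\<in>sol V. wt u * copies \<omega> j u) > 3 * m * OPT}"
  define E4 where "E4 = {\<omega>. sampling_fails (curry \<omega>)}"
  have "covers (answers (curry \<omega>)) V \<and> real (sum wt (answers (curry \<omega>))) \<le> (1 + \<epsilon>) * real OPT"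
    if "\<omega> \<notin> E1" "\<omega> \<notin> E2" "\<omega> \<notin> E3" "\<omega> \<notin> E4" for \<omega>
  proof -
    interpret C: covering_carving wt adj con V k b t g m "curry \<omega>" by (rule covering_carvingI)
    have rb: "C.runs_bounded" using \<open>\<omega> \<notin> E1\<close> by (force simp: E1_def C.runs_bounded_def not_le)
    have hit: "C.hitting" using \<open>\<omega> \<notin> E4\<close> by (simp add: E4_def)
    have total: "sum C.rough V \<le> 3 * m * OPT"
      using C.rough_total_le \<open>\<omega> \<notin> E3\<close> by (simp add: E3_def)
    have Q: "real (sum C.rough V) \<le> 3 * real m * real OPT" using of_nat_mono[OF total, where 'a = real] by simp
    have "(\<Sum>i<t. \<Sum>s\<in>{s\<in>V. C.sampled i s}. real (sum C.rough (C.ring i s (C.pick i s))))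
      \<le> (\<Sum>i<t. 9 * real k * real (sum C.rough V) / real g)"
    proof (rule sum_mono)
      fix i assume "i \<in> {..<t}"
      then have "\<not> 9 * real k * real (sum C.rough V) / real g
          < (\<Sum>s\<in>{s\<in>V. C.sampled i s}. real (sum C.rough (C.ring i s (C.pick i s))))"
        using \<open>\<omega> \<notin> E4\<close> unfolding E4_def by blast
      then show "(\<Sum>s\<in>{s\<in>V. C.sampled i s}. real (sum C.rough (C.ring i s (C.pick i s))))
          \<le> 9 * real k * real (sum C.rough V) / real g" by (simp only: not_less)
    qed
    also have "\<dots> \<le> (\<Sum>i<t. 9 * real k * (3 * real m * real OPT) / real g)"
      by (intro sum_mono divide_right_mono mult_left_mono Q) auto
    also have "\<dots> = 27 * real t * real k / real g * real OPT * real m" by (simp add: algebra_simps del: of_nat_sum)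
    finally have rings: "(\<Sum>i<t. \<Sum>s\<in>{s\<in>V. C.sampled i s}. real (sum C.rough (C.ring i s (C.pick i s)))) / real m
      \<le> 27 * real t * real k / real g * real OPT" using m by (simp add: pos_divide_le_eq del: of_nat_sum)
    have "real (\<Sum>u\<in>sol V \<inter> light. wt u * (copies \<omega> k u - 1)) \<le> (4 * p + 3 * real k ^ 2 / 2 ^ t) * real OPT"
      using \<open>\<omega> \<notin> E2\<close> by (simp add: E2_def not_less)
    then have "real (sum wt C.answers) \<le> real OPT + (4 * p + 3 * real k ^ 2 / 2 ^ t) * real OPT
        + 27 * real t * real k / real g * real OPT"
      using C.answers_cost[OF hit rb m(1) total] rings by linarith
    also have "\<dots> = real OPT + (4 * p + 3 * real k ^ 2 / 2 ^ t + 27 * real t * real k / real g) * real OPT"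
      by (simp only: distrib_right add.assoc)
    also have "\<dots> \<le> real OPT + \<epsilon> * real OPT" using \<epsilon> by (intro add_left_mono mult_right_mono) (simp_all del: of_nat_sum)
    finally have "real (sum wt C.answers) \<le> (1 + \<epsilon>) * real OPT" by (simp only: distrib_right mult_1)
    then show ?thesis using C.answers_cover[OF hit rb m(1) g] by blast
  qed
  then have "?P {\<omega>. \<not> (covers (answers (curry \<omega>)) V \<and> real (sum wt (answers (curry \<omega>))) \<le> (1 + \<epsilon>) * real OPT)}
    \<le> ?P (E1 \<union> E2 \<union> (E3 \<union> E4))"
    by (intro measure_pmf.finite_measure_mono) (blast, simp)
  also have "\<dots> \<le> ?P (E1 \<union> E2) + ?P (E3 \<union> E4)" by (intro measure_Un_le) auto
  also have "?P (E1 \<union> E2) \<le> ?P E1 + ?P E2" by (intro measure_Un_le) auto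
  also have "?P (E3 \<union> E4) \<le> ?P E3 + ?P E4" by (intro measure_Un_le) auto
  also have "?P E1 \<le> real (card V * (m + t)) * (1 / 2) ^ k"
    using prob_runs_bounded[of ?I] by (simp add: E1_def)
  also have "?P E2 \<le> real (card V + 1) * (1 / 2) ^ k"
    unfolding E2_def using m by (intro prob_light_excess) auto
  also have "?P E3 \<le> (1 / 2) ^ k"
    unfolding E3_def by (intro prob_rough_total) auto
  also have "?P E4 \<le> real (t * card V + t) * (1 / 2) ^ k"
    unfolding E4_def by (rule prob_sampling_fails)
  finally show ?thesis by (simp add: algebra_simps)
qed

end

subsection \<open>Simulation in the LOCAL model\<close>

text \<open>Counts the blocks of \<open>b\<close> bits before the first block of ones, which gives a geometric variable
  with parameter \<open>1 / 2 ^ b\<close>.\<close>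

definition first_ones :: "nat \<Rightarrow> (nat \<Rightarrow> bool) \<Rightarrow> nat \<Rightarrow> nat" where
  "first_ones b \<beta> j = (if \<exists>l. \<forall>i<b. \<beta> (prod_encode (prod_encode (j, l), i))
     then LEAST l. \<forall>i<b. \<beta> (prod_encode (prod_encode (j, l), i)) else 0)"

fun num :: "data \<Rightarrow> real" where
  "num (Num r) = r"
| "num _ = 0"

fun items :: "data \<Rightarrow> data list" where
  "items (Seq xs) = xs"
| "items _ = []"

definition encode_constraint :: "real \<times> real \<times> real list \<Rightarrow> data" where
  "encode_constraint = (\<lambda>(r, a, as). Seq [Num r, Num a, Seq (map Num as)])"

text \<open>Sets are not \<open>data\<close>, so the finite set of constraints is listed in an
  arbitrary order, which decoding forgets. The approximation parameter and the bound are stored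
  because \<open>result\<close> sees nothing but the final state.\<close>

definition encode_input :: "local_input \<Rightarrow> nat list \<Rightarrow> data" where
  "encode_input li slots =
     Seq [Num (in_eps li), Num (real (in_bound li)), Num (real (in_weight li)),
          Seq (map encode_constraint (SOME xs. set xs = in_constraints li)),
          Seq (map (Num \<circ> real) slots)]"

abbreviation "the_nat d \<equiv> nat \<lfloor>num d\<rfloor>"

definition slot :: "data \<Rightarrow> nat \<Rightarrow> nat" where
  "slot R j = the_nat (items (items R ! 4) ! j)"

definition ident :: "nat \<Rightarrow> data \<Rightarrow> nat list" where
  "ident k R = map (slot R) [0..<k]"

text \<open>
  A fact \<open>Seq (R # Rs)\<close> consists of the record of a vertex and the records of its neighbours
  in the order of the ports.
\<close>

definition fact_weight :: "data \<Rightarrow> nat" where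
  "fact_weight K = the_nat (items (hd (items K)) ! 2)"

definition fact_adj :: "nat \<Rightarrow> data \<Rightarrow> nat list set" where
  "fact_adj k K = ident k ` set (tl (items K))"

text \<open>Coefficients arrive in port order and are re-indexed by names. With distinct names the
  \<open>LEAST\<close> port is the only one; a vertex behind no port gets zero, which is its true
  coefficient in every constraint of this vertex.\<close>

definition decode_constraint :: "nat \<Rightarrow> data \<Rightarrow> data \<Rightarrow> nat list constraint" where
  "decode_constraint k K d = (num (items d ! 0), \<lambda>y.
     if y = ident k (hd (items K)) then num (items d ! 1)
     else if \<exists>p<length (tl (items K)). ident k (tl (items K) ! p) = y
       then num (items (items d ! 2) ! (LEAST p. ident k (tl (items K) ! p) = y))
     else 0)"

definition fact_con :: "nat \<Rightarrow> data \<Rightarrow> nat list constraint set" where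
  "fact_con k K = decode_constraint k K ` set (items (items (hd (items K)) ! 3))"

text \<open>The name slots are set to zero: names are fixed before the analysis, and only the
  remaining slots are random values of the carving.\<close>

definition fact_slots :: "nat \<Rightarrow> nat \<Rightarrow> data \<Rightarrow> nat \<Rightarrow> nat" where
  "fact_slots k s K j = (if j \<in> {k..<s} then slot (hd (items K)) j else 0)"

definition lookup :: "nat \<Rightarrow> data set \<Rightarrow> nat list \<Rightarrow> data" where
  "lookup k F x = (SOME K. K \<in> F \<and> ident k (hd (items K)) = x)"

text \<open>A state is the own record followed by the facts known so far. A fact contains the
  neighbours' records and so first appears after one round, whence the \<open>Suc\<close> in the
  number of rounds.\<close>

definition gather :: "data \<Rightarrow> data list \<Rightarrow> data" where
  "gather s ms = Seq (hd (items s) # Seq (hd (items s) # map (hd \<circ> items) ms)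
     # tl (items s) @ concat (map (tl \<circ> items) ms))"

definition decide :: "nat \<Rightarrow> nat \<Rightarrow> nat \<Rightarrow> nat \<Rightarrow> nat \<Rightarrow> data \<Rightarrow> nat" where
  "decide k b t g m s =
     (let L = lookup k (set (tl (items s))) in
      if carving.answer (fact_weight \<circ> L) (fact_adj k \<circ> L) (fact_con k \<circ> L) k b t g m
           (fact_slots k (k + m + t) \<circ> L) (ident k (hd (items s)))
      then 1 else 0)"

definition carving_algorithm ::
  "(real \<Rightarrow> nat \<Rightarrow> nat) \<Rightarrow> (real \<Rightarrow> nat \<Rightarrow> nat) \<Rightarrow> (real \<Rightarrow> nat \<Rightarrow> nat) \<Rightarrow> (real \<Rightarrow> nat \<Rightarrow> nat) \<Rightarrow>
   (real \<Rightarrow> nat \<Rightarrow> nat) \<Rightarrow> (data, data) local_algorithm" where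
  "carving_algorithm k b t g m =
     \<lparr> rounds = (\<lambda>\<epsilon> N. Suc (10 * carving.rad (k \<epsilon> N) (b \<epsilon> N) (t \<epsilon> N) (g \<epsilon> N) 0)),
       start = (\<lambda>li \<beta>. let \<epsilon> = in_eps li; N = in_bound li in
         Seq [encode_input li (map (first_ones (b \<epsilon> N) \<beta>) [0..<k \<epsilon> N + m \<epsilon> N + t \<epsilon> N])]),
       send = (\<lambda>s p. s),
       receive = gather,
       result = (\<lambda>s. let \<epsilon> = num (items (hd (items s)) ! 0); N = the_nat (items (hd (items s)) ! 1) in
         decide (k \<epsilon> N) (b \<epsilon> N) (t \<epsilon> N) (g \<epsilon> N) (m \<epsilon> N) s) \<rparr>"

section \<open>Collecting neighbourhoods by flooding\<close>

primrec flood :: "(nat \<Rightarrow> data) \<Rightarrow> (nat \<Rightarrow> nat list) \<Rightarrow> nat \<Rightarrow> nat \<Rightarrow> data" where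
  "flood R nb 0 = (\<lambda>v. Seq [R v])"
| "flood R nb (Suc r) = (\<lambda>v. gather (flood R nb r v) (map (flood R nb r) (nb v)))"

lemma flood_cong:
  assumes "\<And>v. v < n \<Longrightarrow> set (nb v) \<subseteq> {..<n}" "\<And>v. v < n \<Longrightarrow> R v = R' v" "v < n"
  shows "flood R nb r v = flood R' nb r v"
  using assms(3)
proof (induction r arbitrary: v)
  case (Suc r)
  have "map (flood R nb r) (nb v) = map (flood R' nb r) (nb v)"
    using Suc assms(1)[OF Suc.prems] by (intro map_cong) auto
  then show ?case using Suc.IH[OF Suc.prems] by (simp only: flood.simps)
qed (simp add: assms(2))

lemma hd_flood [simp]: "hd (items (flood R nb r v)) = R v"
  by (induction r arbitrary: v) (simp_all add: gather_def)

definition fact :: "(nat \<Rightarrow> data) \<Rightarrow> (nat \<Rightarrow> nat list) \<Rightarrow> nat \<Rightarrow> data" where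
  "fact R nb v = Seq (R v # map R (nb v))"

text \<open>Balls grow at their boundary in the definition, but from their centre in flooding: in
  each round a vertex learns what its neighbours knew one round earlier.\<close>

lemma (in network) ball_Suc_left: "ball (Suc r) v = ball r v \<union> (\<Union>u\<in>adj v. ball r u)"
proof (rule set_eqI)
  fix x
  show "x \<in> ball (Suc r) v \<longleftrightarrow> x \<in> ball r v \<union> (\<Union>u\<in>adj v. ball r u)"
  proof (induction r arbitrary: x)
    case (Suc r)
    have "x \<in> ball (Suc (Suc r)) v \<longleftrightarrow> x \<in> ball (Suc r) v \<or> (\<exists>y\<in>ball (Suc r) v. x \<in> adj y)"
      by auto
    also have "\<dots> \<longleftrightarrow> x \<in> ball (Suc r) v \<or> (\<exists>y\<in>ball r v. x \<in> adj y)
        \<or> (\<exists>u\<in>adj v. \<exists>y\<in>ball r u. x \<in> adj y)"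
      using Suc by blast
    also have "\<dots> \<longleftrightarrow> x \<in> ball (Suc r) v \<or> (\<exists>u\<in>adj v. \<exists>y\<in>ball r u. x \<in> adj y)" by auto
    also have "\<dots> \<longleftrightarrow> x \<in> ball (Suc r) v \<or> (\<exists>u\<in>adj v. x \<in> ball (Suc r) u)"
      using Suc[of x] by auto
    finally show ?case by blast
  qed auto
qed

lemma set_tl_flood:
  "set (tl (items (flood R nb (Suc r) v))) = fact R nb ` network.ball (\<lambda>u. set (nb u)) r v"
proof (induction r arbitrary: v)
  case 0
  have "(hd \<circ> items) \<circ> (\<lambda>v. Seq [R v]) = R" by auto
  then show ?case by (simp add: gather_def fact_def network.ball.simps comp_def)
next
  case (Suc r)
  have R: "map (hd \<circ> items) (map (flood R nb (Suc r)) (nb v)) = map R (nb v)"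
    by (simp add: comp_def del: flood.simps)
  have "set (tl (items (flood R nb (Suc (Suc r)) v)))
    = insert (fact R nb v) (set (tl (items (flood R nb (Suc r) v)))
      \<union> (\<Union>u\<in>set (nb v). set (tl (items (flood R nb (Suc r) u)))))"
    unfolding flood.simps(2)[of R nb "Suc r"] gather_def R hd_flood
    by (simp add: fact_def del: flood.simps)
  also have "\<dots> = insert (fact R nb v) (fact R nb ` network.ball (\<lambda>u. set (nb u)) (Suc r) v)"
    unfolding Suc network.ball_Suc_left by auto
  also have "\<dots> = fact R nb ` network.ball (\<lambda>u. set (nb u)) (Suc r) v"
    using network.center_in_ball[of v "\<lambda>u. set (nb u)" "Suc r"] by blast
  finally show ?case .
qed

lemma state_after_carving_algorithm:
  "state_after (carving_algorithm k b t g m) P \<epsilon> N nb \<omega> r v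
    = flood (\<lambda>u. encode_input (input_of P \<epsilon> N nb u)
        (map (first_ones (b \<epsilon> N) (\<omega> u)) [0..<k \<epsilon> N + m \<epsilon> N + t \<epsilon> N])) nb r v"
  by (induction r arbitrary: v) (simp_all add: carving_algorithm_def input_of_def Let_def)

definition vertex_record ::
  "covering_problem \<Rightarrow> real \<Rightarrow> nat \<Rightarrow> (nat \<Rightarrow> nat list) \<Rightarrow> nat \<Rightarrow> (nat \<times> nat \<Rightarrow> nat) \<Rightarrow> nat \<Rightarrow> data" where
  "vertex_record P \<epsilon> N nb s h u = encode_input (input_of P \<epsilon> N nb u) (map (\<lambda>j. h (u, j)) [0..<s])"

text \<open>Vertices do not know their indices, so the network is transported to the random names.
  \<open>distinct_ids\<close> makes this an isomorphic copy of the instance.\<close>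

locale simulation =
  fixes P :: covering_problem and \<epsilon> :: real and N :: nat and nb :: "nat \<Rightarrow> nat list"
    and k b t g m :: nat and h :: "nat \<times> nat \<Rightarrow> nat"
  assumes valid: "valid_problem P" and feasible: "\<exists>x. feasible P x" and ports: "port_numbering P nb"
    and distinct_ids: "inj_on (\<lambda>v. map (\<lambda>j. h (v, j)) [0..<k]) {..<num_vars P}"
begin

abbreviation "n \<equiv> num_vars P"
abbreviation "s \<equiv> k + m + t"

definition name :: "nat \<Rightarrow> nat list" where "name v = map (\<lambda>j. h (v, j)) [0..<k]"
abbreviation "R \<equiv> vertex_record P \<epsilon> N nb s h"
definition index :: "nat list \<Rightarrow> nat" where "index = the_inv_into {..<n} name"
definition V :: "nat list set" where "V = name ` {..<n}"
definition wt :: "nat list \<Rightarrow> nat" where "wt x = weight P (index x)"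
definition adj :: "nat list \<Rightarrow> nat list set" where
  "adj x = (if x \<in> V then name ` neighbours P (index x) else {})"
definition row :: "nat \<Rightarrow> nat list constraint" where
  "row j = (rhs P j, \<lambda>y. if y \<in> V then coef P j (index y) else 0)"
definition con :: "nat list \<Rightarrow> nat list constraint set" where
  "con x = row ` {j. j < num_cons P \<and> index x \<in> hyperedge P j}"
definition T :: "nat list \<Rightarrow> nat \<Rightarrow> nat" where
  "T x j = (if x \<in> V \<and> j \<in> {k..<s} then h (index x, j) else 0)"

lemma inj_name: "inj_on name {..<n}"
  using distinct_ids by (simp add: name_def[abs_def])

lemma index_name [simp]: "v < n \<Longrightarrow> index (name v) = v"
  unfolding index_def by (intro the_inv_into_f_f inj_name) simp

lemma name_in_V [simp]: "v < n \<Longrightarrow> name v \<in> V"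
  by (simp add: V_def)

lemma V_cases: "x \<in> V \<Longrightarrow> (\<And>v. v < n \<Longrightarrow> x = name v \<Longrightarrow> Q) \<Longrightarrow> Q"
  by (auto simp: V_def)

lemma name_eq_iff [simp]: "u < n \<Longrightarrow> v < n \<Longrightarrow> name u = name v \<longleftrightarrow> u = v"
  using inj_name by (auto simp: inj_on_def)

lemma neighbours_less: "neighbours P v \<subseteq> {..<n}"
  by (auto simp: neighbours_def hyperedge_def)

lemma hyperedge_less: "hyperedge P j \<subseteq> {..<n}"
  by (auto simp: hyperedge_def)

lemma nb_props: "v < n \<Longrightarrow> set (nb v) = neighbours P v" "v < n \<Longrightarrow> distinct (nb v)"
  using ports by (auto simp: port_numbering_def)

lemma supp_row: "supp (row j) = name ` hyperedge P j"
  by (auto simp: supp_def row_def hyperedge_def elim!: V_cases)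

lemma sum_row: "A \<subseteq> {..<n} \<Longrightarrow> (\<Sum>y\<in>name ` A. snd (row j) y) = (\<Sum>i\<in>A. coef P j i)"
  by (subst sum.reindex) (auto simp: row_def inj_on_subset[OF inj_name] intro!: sum.cong)

lemma satisfied_row:
  assumes "A \<subseteq> {..<n}"
  shows "satisfied (name ` A) (row j) \<longleftrightarrow> rhs P j \<le> (\<Sum>i<n. coef P j i * (if i \<in> A then 1 else 0))"
proof -
  have "supp (row j) \<inter> name ` A = name ` (hyperedge P j \<inter> A)"
    unfolding supp_row using inj_name assms hyperedge_less by (subst inj_on_image_Int[of name "{..<n}"]) auto
  then have "satisfied (name ` A) (row j) \<longleftrightarrow> rhs P j \<le> (\<Sum>i\<in>hyperedge P j \<inter> A. coef P j i)"
  proof -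
    have "hyperedge P j \<inter> A \<subseteq> {..<n}" using assms by auto
    note sum_row[OF this, of j]
    moreover have "fst (row j) = rhs P j" by (simp add: row_def)
    ultimately show "satisfied (name ` A) (row j) \<longleftrightarrow> rhs P j \<le> (\<Sum>i\<in>hyperedge P j \<inter> A. coef P j i)"
      if "supp (row j) \<inter> name ` A = name ` (hyperedge P j \<inter> A)"
      unfolding satisfied_def that by simp
  qed
  also have "(\<Sum>i\<in>hyperedge P j \<inter> A. coef P j i) = (\<Sum>i<n. coef P j i * (if i \<in> A then 1 else 0))"
    by (rule sum.mono_neutral_cong_left) (use hyperedge_less assms in \<open>auto simp: hyperedge_def\<close>)
  finally show ?thesis .
qed

lemma feasible_indicator:
  assumes "feasible P x"
  shows "(\<Sum>i<n. coef P j i * (if i \<in> {i. i < n \<and> x i = 1} then 1 else 0)) = (\<Sum>i<n. coef P j i * real (x i))"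
  using assms by (intro sum.cong) (auto simp: feasible_def)

lemma covering_network: "covering_network adj con V"
proof
  show "finite V" by (simp add: V_def)
  show "adj v \<subseteq> V" if "v \<in> V" for v
    using neighbours_less by (auto simp: adj_def V_def)
  show "v \<in> adj u" if uv: "u \<in> adj v" for u v
  proof -
    have v: "v \<in> V" using uv by (auto simp: adj_def split: if_splits)
    then obtain i where i: "v = name i" "i < n" by (auto simp: V_def)
    then obtain j where j: "u = name j" "j \<in> neighbours P i" using uv v by (auto simp: adj_def)
    then have "i \<in> neighbours P j" "j < n" using neighbours_less by (auto simp: neighbours_def)
    then show ?thesis using i j by (auto simp: adj_def)
  qed
  fix v e assume v: "v \<in> V" and e: "e \<in> con v"
  obtain i where i: "v = name i" "i < n" using v by (auto simp: V_def)
  obtain j where j: "e = row j" "j < num_cons P" "i \<in> hyperedge P j" using e i by (auto simp: con_def)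
  show "v \<in> supp e \<and> supp e \<subseteq> V"
    using i j hyperedge_less by (auto simp: supp_row V_def)
  show "e \<in> con u" if ue: "u \<in> supp e" for u
  proof -
    obtain i' where "u = name i'" "i' \<in> hyperedge P j" using ue j by (auto simp: supp_row)
    moreover have "i' < n" using calculation hyperedge_less by auto
    ultimately show ?thesis using j by (auto simp: con_def)
  qed
  show "u \<in> adj v" if ue: "u \<in> supp e" "u \<noteq> v" for u
  proof -
    obtain i' where i': "u = name i'" "i' \<in> hyperedge P j" using ue j by (auto simp: supp_row)
    then have "i' \<in> neighbours P i" using i j ue by (auto simp: neighbours_def)
    then show ?thesis using i i' by (auto simp: adj_def)
  qed
  show "0 \<le> snd e u" for u
    using valid j by (auto simp: row_def valid_problem_def elim!: V_cases)
  show "satisfied V e"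
  proof -
    obtain x where x: "feasible P x" using feasible by auto
    have "rhs P j \<le> (\<Sum>i<n. coef P j i * real (x i))" using x j by (auto simp: feasible_def)
    also have "\<dots> \<le> (\<Sum>i<n. coef P j i * 1)"
      using x valid j by (intro sum_mono mult_left_mono) (auto simp: feasible_def valid_problem_def)
    finally show ?thesis using satisfied_row[of "{..<n}" j] j by (simp add: V_def)
  qed
qed

sublocale I: covering_network wt adj con V
  by (rule covering_network)

lemma slot_R: "j < s \<Longrightarrow> slot (R v) j = h (v, j)"
  by (simp add: slot_def vertex_record_def encode_input_def)

lemma ident_R: "ident k (R v) = name v"
  by (simp add: ident_def name_def slot_R)

lemma finite_constraints: "finite (in_constraints (input_of P \<epsilon> N nb v))"
proof -
  have "in_constraints (input_of P \<epsilon> N nb v) \<subseteq> (\<lambda>j. (rhs P j, coef P j v, map (coef P j) (nb v))) ` {..<num_cons P}"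
    by (auto simp: input_of_def)
  then show ?thesis by (rule finite_subset) simp
qed

lemma constraints_R:
  "set (items (items (R v) ! 3)) = (\<lambda>j. encode_constraint (rhs P j, coef P j v, map (coef P j) (nb v)))
     ` {j. j < num_cons P \<and> v \<in> hyperedge P j}"
proof -
  let ?S = "in_constraints (input_of P \<epsilon> N nb v)"
  have "set (SOME xs. set xs = ?S) = ?S"
    using finite_list[OF finite_constraints] by (rule someI_ex)
  then have "set (items (items (R v) ! 3)) = encode_constraint ` ?S"
    by (simp add: vertex_record_def encode_input_def)
  then show ?thesis by (auto simp: input_of_def)
qed

abbreviation "K \<equiv> fact R nb"

lemma fact_own [simp]: "hd (items (K v)) = R v" "tl (items (K v)) = map R (nb v)"
  by (simp_all add: fact_def)

lemma fact_weight_K: "v < n \<Longrightarrow> fact_weight (K v) = wt (name v)"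
  by (simp add: fact_weight_def wt_def vertex_record_def encode_input_def input_of_def)

lemma fact_adj_K: "v < n \<Longrightarrow> fact_adj k (K v) = adj (name v)"
  by (simp add: fact_adj_def adj_def ident_R image_image nb_props)

lemma fact_slots_K: "v < n \<Longrightarrow> fact_slots k s (K v) = T (name v)"
  by (auto simp: fact_slots_def T_def slot_R)

lemma fact_con_K:
  assumes v: "v < n"
  shows "fact_con k (K v) = con (name v)"
proof -
  have "decode_constraint k (K v) (encode_constraint (rhs P j, coef P j v, map (coef P j) (nb v))) = row j"
    if j: "j < num_cons P" "v \<in> hyperedge P j" for j
  proof -
    have "(if y = name v then coef P j v
       else if \<exists>p<length (nb v). ident k (map R (nb v) ! p) = y
         then num (map Num (map (coef P j) (nb v)) ! (LEAST p. ident k (map R (nb v) ! p) = y)) else 0)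
      = (if y \<in> V then coef P j (index y) else 0)" for y
    proof (cases "y = name v")
      case True
      then show ?thesis using v by simp
    next
      case neq: False
      show ?thesis
      proof (cases "\<exists>p<length (nb v). name (nb v ! p) = y")
        case True
        then obtain p where p: "p < length (nb v)" "name (nb v ! p) = y" by auto
        have lt: "nb v ! p' < n" if "p' < length (nb v)" for p'
          using nb_props(1)[OF v] neighbours_less nth_mem[OF that] by auto
        have "(LEAST p. ident k (map R (nb v) ! p) = y) = p"
        proof (rule Least_equality)
          show "ident k (map R (nb v) ! p) = y" using p by (simp add: ident_R)
          fix p' assume p': "ident k (map R (nb v) ! p') = y"
          show "p \<le> p'"
          proof (rule ccontr)
            assume "\<not> p \<le> p'"
            then have "p' < length (nb v)" "p' \<noteq> p" using p by auto
            then have "name (nb v ! p') = name (nb v ! p)" using p' p by (simp add: ident_R)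
            then have "nb v ! p' = nb v ! p"
              using name_eq_iff[OF lt lt] p(1) \<open>p' < length (nb v)\<close> by blast
            then show False using nb_props(2)[OF v] p \<open>p' < length (nb v)\<close> \<open>p' \<noteq> p\<close>
              by (simp add: nth_eq_iff_index_eq)
          qed
        qed
        moreover have "\<exists>p<length (nb v). ident k (map R (nb v) ! p) = y" using p by (auto simp: ident_R)
        moreover have "y \<in> V" "index y = nb v ! p" using p lt by auto
        ultimately show ?thesis using neq p by simp
      next
        \<comment> \<open>The name \<open>y\<close> belongs to no port. A nonzero coefficient would
          put its vertex into a common hyperedge with \<open>v\<close>, and hence behind a
          port.\<close>
        case False
        then have none: "\<not> (\<exists>p<length (nb v). ident k (map R (nb v) ! p) = y)" by (simp add: ident_R)
        have "coef P j (index y) = 0" if "y \<in> V"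
        proof (rule ccontr)
          assume nz: "coef P j (index y) \<noteq> 0"
          obtain u where u: "y = name u" "u < n" using \<open>y \<in> V\<close> by (auto simp: V_def)
          then have "u \<in> hyperedge P j" "u \<noteq> v" using nz neq by (auto simp: hyperedge_def)
          then have "u \<in> neighbours P v" using j by (auto simp: neighbours_def)
          then have "u \<in> set (nb v)" using nb_props(1)[OF v] by simp
          then obtain p where "p < length (nb v)" "nb v ! p = u" by (auto simp: in_set_conv_nth)
          then show False using False u by auto
        qed
        then show ?thesis unfolding if_not_P[OF neq] if_not_P[OF none] by simp
      qed
    qed
    note eq = this
    have dec: "items (encode_constraint (x, y, zs)) ! 0 = Num x" "items (encode_constraint (x, y, zs)) ! 1 = Num y"
      "items (encode_constraint (x, y, zs)) ! 2 = Seq (map Num zs)" for x y zs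
      by (simp_all add: encode_constraint_def)
    show ?thesis
      unfolding decode_constraint_def dec num.simps items.simps fact_own ident_R length_map eq row_def ..
  qed
  then show ?thesis
    unfolding fact_con_def fact_own constraints_R con_def image_image using v by (auto intro!: image_cong)
qed

lemma ball_name:
  assumes v: "v < n"
  shows "network.ball (\<lambda>u. set (nb u)) r v \<subseteq> {..<n}" "I.ball r (name v) = name ` network.ball (\<lambda>u. set (nb u)) r v"
proof -
  have "network.ball (\<lambda>u. set (nb u)) r v \<subseteq> {..<n} \<and> I.ball r (name v) = name ` network.ball (\<lambda>u. set (nb u)) r v"
  proof (induction r)
    case 0
    then show ?case using v by (simp add: network.ball.simps)
  next
    case (Suc r)
    have sub: "network.ball (\<lambda>u. set (nb u)) r v \<subseteq> {..<n}" using Suc by auto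
    have nbs: "set (nb u) = neighbours P u" if "u \<in> network.ball (\<lambda>u. set (nb u)) r v" for u
      using nb_props(1) that sub by auto
    have "adj (name u) = name ` set (nb u)" if "u \<in> network.ball (\<lambda>u. set (nb u)) r v" for u
      using nbs[OF that] that sub by (auto simp: adj_def)
    then have "I.ball (Suc r) (name v) = name ` network.ball (\<lambda>u. set (nb u)) (Suc r) v"
      using Suc by (simp add: network.ball.simps image_Un image_UN)
    moreover have "network.ball (\<lambda>u. set (nb u)) (Suc r) v \<subseteq> {..<n}"
      unfolding network.ball.simps by (intro Un_least UN_least) (simp_all add: sub nbs neighbours_less)
    ultimately show ?case by blast
  qed
  then show "network.ball (\<lambda>u. set (nb u)) r v \<subseteq> {..<n}" "I.ball r (name v) = name ` network.ball (\<lambda>u. set (nb u)) r v"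
    by auto
qed

text \<open>\<open>lookup\<close> returns the true facts for names in the collected ball and
  arbitrary ones elsewhere. Locality says that the answer does not depend on the latter.\<close>

lemma decide_flood:
  assumes v: "v < n"
  shows "decide k b t g m (flood R nb (Suc (10 * carving.rad k b t g 0)) v)
    = (if carving.answer wt adj con k b t g m T (name v) then 1 else 0)"
proof -
  let ?\<rho> = "10 * carving.rad k b t g 0"
  let ?F = "fact R nb ` network.ball (\<lambda>u. set (nb u)) ?\<rho> v"
  define L where "L = lookup k ?F"
  have L: "L (name u) = K u" if u: "u \<in> network.ball (\<lambda>u. set (nb u)) ?\<rho> v" for u
  proof -
    have "L (name u) \<in> ?F \<and> ident k (hd (items (L (name u)))) = name u"
      unfolding L_def lookup_def by (rule someI[of _ "K u"]) (use u in \<open>simp add: ident_R\<close>)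
    then obtain u' where u': "u' \<in> network.ball (\<lambda>u. set (nb u)) ?\<rho> v" "L (name u) = K u'" "name u' = name u"
      by (auto simp: ident_R)
    then have "u' = u" using ball_name(1)[OF v] u by (metis lessThan_iff name_eq_iff subset_iff)
    then show ?thesis using u' by simp
  qed
  interpret two: two_networks wt "fact_weight \<circ> L" adj "fact_adj k \<circ> L" con "fact_con k \<circ> L" k b t g m
    T "fact_slots k s \<circ> L"
    by unfold_locales (rule I.adj_sym)
  have "two.agree ?\<rho> (name v)"
    unfolding two.agree_def ball_name(2)[OF v]
  proof
    fix x assume "x \<in> name ` network.ball (\<lambda>u. set (nb u)) ?\<rho> v"
    then obtain u where u: "x = name u" "u \<in> network.ball (\<lambda>u. set (nb u)) ?\<rho> v" by auto
    then have "u < n" using ball_name(1)[OF v] by auto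
    then show "wt x = (fact_weight \<circ> L) x \<and> adj x = (fact_adj k \<circ> L) x \<and> con x = (fact_con k \<circ> L) x
        \<and> T x = (fact_slots k s \<circ> L) x"
      using L[OF u(2)] u by (simp add: fact_weight_K fact_adj_K fact_con_K fact_slots_K)
  qed
  then have "carving.answer (fact_weight \<circ> L) (fact_adj k \<circ> L) (fact_con k \<circ> L) k b t g m (fact_slots k s \<circ> L) (name v)
    = carving.answer wt adj con k b t g m T (name v)"
    by (rule two.answer_eq)
  then show ?thesis
    unfolding decide_def Let_def set_tl_flood hd_flood ident_R L_def[symmetric] by simp
qed

lemma approx_solution_of_cover:
  assumes cov: "I.covers X V" and X: "X \<subseteq> V" and cost: "real (sum wt X) \<le> (1 + \<delta>) * real (sum wt (I.sol V))"
    and \<delta>: "0 \<le> \<delta>" and out: "\<And>v. v < n \<Longrightarrow> x v = (if name v \<in> X then 1 else 0)"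
  shows "approx_solution P \<delta> x"
proof -
  have opt: "sum wt (I.sol V) \<le> opt P"
  proof -
    have "opt P \<in> cost P ` {x. feasible P x}"
      unfolding opt_def using feasible by (intro Inf_nat_def1) auto
    then obtain y where y: "feasible P y" "opt P = cost P y" by auto
    let ?A = "{i. i < n \<and> y i = 1}"
    have "I.covers (name ` ?A) V"
      unfolding I.covers_def
    proof
      fix e assume "e \<in> I.cons_in V"
      then obtain j where j: "e = row j" "j < num_cons P" by (auto simp: I.cons_in_def con_def)
      show "satisfied (name ` ?A) e"
        using y j feasible_indicator[OF y(1), of j] satisfied_row[of ?A j] by (auto simp: feasible_def)
    qed
    moreover have "name ` ?A \<subseteq> V" by (auto simp: V_def)
    ultimately have "sum wt (I.sol V) \<le> sum wt (name ` ?A)" using I.sol_props(3)[OF subset_refl] by blast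
    also have "\<dots> = (\<Sum>i\<in>?A. weight P i)"
      by (subst sum.reindex) (auto simp: wt_def intro!: sum.cong inj_on_subset[OF inj_name])
    also have "\<dots> = cost P y"
      unfolding cost_def by (rule sum.mono_neutral_cong_left) (use y in \<open>auto simp: feasible_def\<close>)
    finally show ?thesis using y by simp
  qed
  let ?A = "{v. v < n \<and> name v \<in> X}"
  have XA: "X = name ` ?A" using X by (auto simp: V_def)
  have ind: "(\<Sum>i<n. coef P j i * (if i \<in> ?A then 1 else 0)) = (\<Sum>i<n. coef P j i * real (x i))" for j
    by (intro sum.cong) (auto simp: out)
  have "feasible P x"
    unfolding feasible_def
  proof (intro conjI allI impI)
    show "x i \<in> {0, 1}" if "i < n" for i using out[OF that] by simp
    fix j assume j: "j < num_cons P"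
    show "rhs P j \<le> (\<Sum>i<n. coef P j i * real (x i))"
    proof (cases "hyperedge P j = {}")
      \<comment> \<open>A row of zeros is seen by no vertex; the mere existence of a feasible point
        shows that its right-hand side is at most zero.\<close>
      case True
      then have z: "coef P j i = 0" if "i < n" for i using that by (auto simp: hyperedge_def)
      obtain y where "feasible P y" using feasible by auto
      then have "rhs P j \<le> (\<Sum>i<n. coef P j i * real (y i))" using j by (auto simp: feasible_def)
      also have "\<dots> = 0" using z by (intro sum.neutral) auto
      also have "0 = (\<Sum>i<n. coef P j i * real (x i))" using z by (intro sum.neutral[symmetric]) auto
      finally show ?thesis .
    next
      case False
      then obtain v where v: "v \<in> hyperedge P j" by auto
      then have "v < n" using hyperedge_less by blast
      then have "row j \<in> con (name v)" "name v \<in> V" using j v by (auto simp: con_def)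
      moreover have "supp (row j) \<subseteq> V" using hyperedge_less by (auto simp: supp_row V_def)
      ultimately have "row j \<in> I.cons_in V" by (auto simp: I.cons_in_def)
      then have "satisfied X (row j)" using cov by (auto simp: I.covers_def)
      then have "satisfied (name ` ?A) (row j)" by (subst XA[symmetric])
      then show ?thesis using satisfied_row[of ?A j] ind[of j] by auto
    qed
  qed
  moreover have "real (cost P x) \<le> (1 + \<delta>) * real (opt P)"
  proof -
    have "sum wt X = (\<Sum>i\<in>?A. weight P i)"
      by (subst XA, subst sum.reindex) (auto simp: wt_def intro!: sum.cong inj_on_subset[OF inj_name])
    also have "\<dots> = cost P x"
      unfolding cost_def by (rule sum.mono_neutral_cong_left) (auto simp: out)
    finally have "real (cost P x) \<le> (1 + \<delta>) * real (sum wt (I.sol V))" using cost by (simp only:)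
    also have "\<dots> \<le> (1 + \<delta>) * real (opt P)" using opt \<delta> by (intro mult_left_mono of_nat_mono) simp_all
    finally show ?thesis .
  qed
  ultimately show ?thesis by (simp add: approx_solution_def)
qed

end

subsection \<open>Geometric variables from random bits\<close>

abbreviation "coin \<equiv> measure_pmf (bernoulli_pmf (1 / 2))"
abbreviation "coins \<equiv> \<Pi>\<^sub>M i\<in>(UNIV :: nat set). coin"

lemma prob_space_coins: "prob_space coins"
  by (intro prob_space_PiM measure_pmf.prob_space_axioms)

lemma product_prob_space_coins: "product_prob_space (\<lambda>_. coin)"
  by (intro product_prob_spaceI measure_pmf.prob_space_axioms)

lemma space_coins [simp]: "space coins = UNIV"
  by (auto simp: space_PiM)

lemma indep_coins: "prob_space.indep_vars coins (\<lambda>_. coin) (\<lambda>i \<beta>. \<beta> i) UNIV"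
proof -
  interpret prob_space coins by (rule prob_space_coins)
  have "distr coins coins (\<lambda>x. \<lambda>i\<in>UNIV. x i) = coins"
  proof -
    have "(\<lambda>x :: nat \<Rightarrow> bool. \<lambda>i\<in>UNIV. x i) = (\<lambda>x. x)" by (auto simp: restrict_def)
    then show ?thesis by (simp only: distr_id)
  qed
  also have "coins = (\<Pi>\<^sub>M i\<in>UNIV. distr coins coin (\<lambda>\<beta>. \<beta> i))"
    by (intro PiM_cong refl distr_PiM_component[symmetric] measure_pmf.prob_space_axioms) auto
  finally show ?thesis
    by (subst indep_vars_iff_distr_eq_PiM') auto
qed

abbreviation all_ones :: "nat \<Rightarrow> nat \<Rightarrow> (nat \<Rightarrow> bool) \<Rightarrow> bool" where
  "all_ones b \<kappa> \<beta> \<equiv> \<forall>i<b. \<beta> (prod_encode (\<kappa>, i))"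

lemma prob_all_ones: "measure coins {\<beta>. all_ones b \<kappa> \<beta>} = 1 / 2 ^ b"
proof -
  interpret product_prob_space "\<lambda>_. coin" UNIV by (rule product_prob_space_coins)
  let ?J = "(\<lambda>i. prod_encode (\<kappa>, i)) ` {..<b}"
  have inj: "inj_on (\<lambda>i. prod_encode (\<kappa>, i)) {..<b}" by (auto simp: inj_on_def prod_encode_eq)
  have "{\<beta>. all_ones b \<kappa> \<beta>} = {\<beta>\<in>space coins. \<forall>i\<in>?J. \<beta> i \<in> {True}}" by auto
  then have "emeasure coins {\<beta>. all_ones b \<kappa> \<beta>} = (\<Prod>i\<in>?J. emeasure coin {True})"
    by (simp only:) (rule emeasure_PiM_Collect, auto)
  also have "\<dots> = ennreal (1 / 2 ^ b)"
  proof -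
    have "emeasure coin {True} = ennreal (1 / 2)" by (simp add: emeasure_pmf_single)
    then show ?thesis using inj by (simp only: prod_constant card_image card_lessThan ennreal_power) (simp add: power_one_over)
  qed
  finally show ?thesis by (simp add: measure_def)
qed

lemma prob_blocks:
  assumes "finite J"
  shows "measure coins {\<beta>. \<forall>\<kappa>\<in>J. all_ones b \<kappa> \<beta> = c \<kappa>} = (\<Prod>\<kappa>\<in>J. if c \<kappa> then 1 / 2 ^ b else 1 - 1 / 2 ^ b)"
proof (cases "J = {}")
  case True
  then show ?thesis using prob_space.prob_space[OF prob_space_coins] by simp
next
  case False
  interpret prob_space coins by (rule prob_space_coins)
  let ?K = "\<lambda>\<kappa>. (\<lambda>i. prod_encode (\<kappa>, i)) ` {..<b}"
  let ?Y = "\<lambda>\<kappa> f. \<forall>i\<in>?K \<kappa>. f i"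
  have "indep_vars (\<lambda>\<kappa>. PiM (?K \<kappa>) (\<lambda>_. coin)) (\<lambda>\<kappa> \<beta>. restrict (\<lambda>i. \<beta> i) (?K \<kappa>)) (UNIV :: nat set)"
    by (rule indep_vars_restrict[OF indep_coins]) (auto simp: disjoint_family_on_def prod_encode_eq)
  then have ind: "indep_vars (\<lambda>_. count_space UNIV) (\<lambda>\<kappa> \<beta>. ?Y \<kappa> (restrict (\<lambda>i. \<beta> i) (?K \<kappa>))) (UNIV :: nat set)"
    by (rule indep_vars_compose2) measurable
  have Y: "?Y \<kappa> (restrict (\<lambda>i. \<beta> i) (?K \<kappa>)) \<longleftrightarrow> all_ones b \<kappa> \<beta>" for \<kappa> \<beta> by auto
  have *: "prob (\<Inter>\<kappa>\<in>J. all_ones b \<kappa> -` {c \<kappa>} \<inter> space coins) = (\<Prod>\<kappa>\<in>J. prob (all_ones b \<kappa> -` {c \<kappa>} \<inter> space coins))"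
    using indep_varsD[OF ind, of J "\<lambda>\<kappa>. {c \<kappa>}"] False assms unfolding Y by simp
  have 1: "prob (all_ones b \<kappa> -` {True} \<inter> space coins) = 1 / 2 ^ b" for \<kappa>
    using prob_all_ones[of b \<kappa>] by (simp add: vimage_def)
  have "prob (all_ones b \<kappa> -` {c \<kappa>} \<inter> space coins) = (if c \<kappa> then 1 / 2 ^ b else 1 - 1 / 2 ^ b)" for \<kappa>
  proof (cases "c \<kappa>")
    case False
    have "all_ones b \<kappa> -` {False} \<inter> space coins = space coins - (all_ones b \<kappa> -` {True} \<inter> space coins)" by auto
    moreover have "all_ones b \<kappa> -` {True} \<inter> space coins \<in> events" by measurable
    ultimately have "prob (all_ones b \<kappa> -` {False} \<inter> space coins) = 1 - prob (all_ones b \<kappa> -` {True} \<inter> space coins)"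
      by (simp only: prob_compl)
    then show ?thesis using False 1 by simp
  qed (use 1 in simp)
  moreover have "{\<beta>. \<forall>\<kappa>\<in>J. all_ones b \<kappa> \<beta> = c \<kappa>} = (\<Inter>\<kappa>\<in>J. all_ones b \<kappa> -` {c \<kappa>} \<inter> space coins)"
    using False by auto
  ultimately show ?thesis using * by simp
qed

text \<open>A lower bound for each outcome suffices, since only lower bounds on success
  probabilities are derived from it. So bit sequences without any block of ones need no treatment:
  the event contains the one that prescribes, in every slot, the finitely many blocks up to the
  first success.\<close>

lemma prob_first_ones_ge:
  "ennreal (\<Prod>j<s. pmf (geometric_pmf (1 / 2 ^ b)) (\<tau> j)) \<le> emeasure coins {\<beta>. \<forall>j<s. first_ones b \<beta> j = \<tau> j}"
proof -
  interpret prob_space coins by (rule prob_space_coins)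
  let ?q = "1 / 2 ^ b :: real"
  let ?J = "\<Union>j<s. (\<lambda>l. prod_encode (j, l)) ` {..\<tau> j}"
  define c where "c \<kappa> \<longleftrightarrow> snd (prod_decode \<kappa>) = \<tau> (fst (prod_decode \<kappa>))" for \<kappa>
  let ?f = "\<lambda>\<kappa>. if c \<kappa> then ?q else 1 - ?q"
  have "(\<Prod>\<kappa>\<in>?J. ?f \<kappa>) = (\<Prod>j<s. \<Prod>\<kappa>\<in>(\<lambda>l. prod_encode (j, l)) ` {..\<tau> j}. ?f \<kappa>)"
    by (rule prod.UNION_disjoint) (auto simp: prod_encode_eq)
  also have "\<dots> = (\<Prod>j<s. \<Prod>l\<le>\<tau> j. if l = \<tau> j then ?q else 1 - ?q)"
  proof (rule prod.cong[OF refl])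
    fix j
    have "inj_on (\<lambda>l. prod_encode (j, l)) {..\<tau> j}" by (auto simp: inj_on_def prod_encode_eq)
    then show "(\<Prod>\<kappa>\<in>(\<lambda>l. prod_encode (j, l)) ` {..\<tau> j}. ?f \<kappa>) = (\<Prod>l\<le>\<tau> j. if l = \<tau> j then ?q else 1 - ?q)"
      by (subst prod.reindex) (auto simp: c_def intro!: prod.cong)
  qed
  also have "\<dots> = (\<Prod>j<s. (1 - ?q) ^ \<tau> j * ?q)"
  proof (rule prod.cong[OF refl])
    fix j
    have "{..\<tau> j} = insert (\<tau> j) {..<\<tau> j}" by auto
    then have "(\<Prod>l\<le>\<tau> j. if l = \<tau> j then ?q else 1 - ?q) = ?q * (\<Prod>l<\<tau> j. if l = \<tau> j then ?q else 1 - ?q)" by simp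
    also have "(\<Prod>l<\<tau> j. if l = \<tau> j then ?q else 1 - ?q) = (\<Prod>l<\<tau> j. 1 - ?q)" by (intro prod.cong) auto
    finally show "(\<Prod>l\<le>\<tau> j. if l = \<tau> j then ?q else 1 - ?q) = (1 - ?q) ^ \<tau> j * ?q" by simp
  qed
  also have "\<dots> = (\<Prod>j<s. pmf (geometric_pmf ?q) (\<tau> j))" by (simp add: mult.commute)
  finally have eq: "(\<Prod>\<kappa>\<in>?J. ?f \<kappa>) = (\<Prod>j<s. pmf (geometric_pmf ?q) (\<tau> j))" .
  have sub: "{\<beta>. \<forall>\<kappa>\<in>?J. all_ones b \<kappa> \<beta> = c \<kappa>} \<subseteq> {\<beta>. \<forall>j<s. first_ones b \<beta> j = \<tau> j}"
  proof safe
    fix \<beta> j assume \<beta>: "\<forall>\<kappa>\<in>?J. all_ones b \<kappa> \<beta> = c \<kappa>" and j: "j < s"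
    have blk: "all_ones b (prod_encode (j, l)) \<beta> \<longleftrightarrow> l = \<tau> j" if "l \<le> \<tau> j" for l
    proof -
      have "prod_encode (j, l) \<in> ?J" using that j by auto
      from bspec[OF \<beta> this] show ?thesis by (simp add: c_def)
    qed
    have "(LEAST l. all_ones b (prod_encode (j, l)) \<beta>) = \<tau> j"
    proof (rule Least_equality)
      show "all_ones b (prod_encode (j, \<tau> j)) \<beta>" using blk[of "\<tau> j"] by simp
      show "\<tau> j \<le> l" if "all_ones b (prod_encode (j, l)) \<beta>" for l
        using blk[of l] that by (cases "l \<le> \<tau> j") auto
    qed
    moreover have "\<exists>l. all_ones b (prod_encode (j, l)) \<beta>" using blk[of "\<tau> j"] by blast
    ultimately show "first_ones b \<beta> j = \<tau> j" by (simp add: first_ones_def)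
  qed
  have "{\<beta>\<in>space coins. \<forall>j<s. first_ones b \<beta> j = \<tau> j} \<in> sets coins"
    unfolding first_ones_def by measurable
  then have "emeasure coins {\<beta>. \<forall>\<kappa>\<in>?J. all_ones b \<kappa> \<beta> = c \<kappa>} \<le> emeasure coins {\<beta>. \<forall>j<s. first_ones b \<beta> j = \<tau> j}"
    using sub by (intro emeasure_mono) auto
  moreover have "emeasure coins {\<beta>. \<forall>\<kappa>\<in>?J. all_ones b \<kappa> \<beta> = c \<kappa>} = ennreal (\<Prod>\<kappa>\<in>?J. ?f \<kappa>)"
    unfolding emeasure_eq_measure by (subst prob_blocks) auto
  ultimately show ?thesis using eq by simp
qed

definition slot_values :: "nat \<Rightarrow> nat \<Rightarrow> nat \<Rightarrow> (nat \<Rightarrow> nat \<Rightarrow> bool) \<Rightarrow> nat \<times> nat \<Rightarrow> nat" where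
  "slot_values b n s \<omega> = (\<lambda>(v, j). if v < n \<and> j < s then first_ones b (\<omega> v) j else 0)"

text \<open>The values lie in a countable set \<open>G\<close> and have measurable fibres, so every
  predicate of them is an event, and summing the bounds for single outcomes compares the two
  laws.\<close>

lemma random_bits_slot_values:
  fixes P :: covering_problem and \<Phi> :: "(nat \<times> nat \<Rightarrow> nat) \<Rightarrow> bool"
  defines "n \<equiv> num_vars P"
  shows "{\<omega>\<in>space (random_bits P). \<Phi> (slot_values b n s \<omega>)} \<in> sets (random_bits P)"
    and "measure_pmf.prob (Pi_pmf ({..<n} \<times> {..<s}) 0 (\<lambda>_. geometric_pmf (1 / 2 ^ b))) {h. \<Phi> h}
      \<le> measure (random_bits P) {\<omega>\<in>space (random_bits P). \<Phi> (slot_values b n s \<omega>)}"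
proof -
  let ?M = "random_bits P"
  let ?p = "Pi_pmf ({..<n} \<times> {..<s}) 0 (\<lambda>_. geometric_pmf (1 / 2 ^ b))"
  define G where "G = {h :: nat \<times> nat \<Rightarrow> nat. \<forall>x. x \<notin> {..<n} \<times> {..<s} \<longrightarrow> h x = 0}"
  define E where "E h = {\<omega>\<in>space ?M. \<forall>v\<in>{..<n}. \<omega> v \<in> {\<beta>. \<forall>j<s. first_ones b \<beta> j = h (v, j)}}" for h
  have M: "?M = PiM {..<n} (\<lambda>_. coins)" by (simp add: random_bits_def n_def)
  interpret pp: product_prob_space "\<lambda>_. coins" "{..<n}"
    by (intro product_prob_spaceI prob_space_coins)
  interpret M: prob_space ?M unfolding M by (rule pp.P.prob_space_axioms)
  have inG: "slot_values b n s \<omega> \<in> G" for \<omega> by (auto simp: slot_values_def G_def)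
  have E: "E h = {\<omega>\<in>space ?M. slot_values b n s \<omega> = h}" if "h \<in> G" for h
  proof -
    have "slot_values b n s \<omega> = h \<longleftrightarrow> (\<forall>v<n. \<forall>j<s. first_ones b (\<omega> v) j = h (v, j))" for \<omega>
      using that by (auto simp: slot_values_def G_def fun_eq_iff)
    then show ?thesis by (auto simp: E_def)
  qed
  have countable: "countable G"
  proof -
    have "inj_on (\<lambda>h. restrict h ({..<n} \<times> {..<s})) G"
    proof (rule inj_onI)
      fix h h' assume hh: "h \<in> G" "h' \<in> G" "restrict h ({..<n} \<times> {..<s}) = restrict h' ({..<n} \<times> {..<s})"
      show "h = h'"
      proof
        fix x show "h x = h' x"
        proof (cases "x \<in> {..<n} \<times> {..<s}")
          case True
          then show ?thesis using fun_cong[OF hh(3), of x] by (simp only: restrict_apply if_True)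
        next
          case False
          then show ?thesis using hh(1,2) unfolding G_def mem_Collect_eq by metis
        qed
      qed
    qed
    moreover have "countable ((\<lambda>h. restrict h ({..<n} \<times> {..<s})) ` G)"
    proof (rule countable_subset)
      show "(\<lambda>h. restrict h ({..<n} \<times> {..<s})) ` G \<subseteq> ({..<n} \<times> {..<s}) \<rightarrow>\<^sub>E UNIV"
        unfolding restrict_PiE_iff image_subset_iff by blast
      show "countable (({..<n} \<times> {..<s}) \<rightarrow>\<^sub>E (UNIV :: nat set))" by (intro countable_PiE) auto
    qed
    ultimately show ?thesis by (rule countable_image_inj_on[rotated])
  qed
  have cyl: "{\<beta>. \<forall>j<s. first_ones b \<beta> j = \<tau> j} \<in> sets coins" for \<tau>
  proof -
    have "{\<beta>\<in>space coins. \<forall>j<s. first_ones b \<beta> j = \<tau> j} \<in> sets coins"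
      unfolding first_ones_def by measurable
    then show ?thesis by simp
  qed
  have sE: "E h \<in> sets ?M" for h
    unfolding E_def M using cyl
    by (intro sets.sets_Collect_finite_All sets_Collect_single') auto
  let ?S = "{h\<in>G. \<Phi> h}"
  have cS: "countable ?S" using countable by (rule countable_subset[rotated]) auto
  have event: "{\<omega>\<in>space ?M. \<Phi> (slot_values b n s \<omega>)} = (\<Union>h\<in>?S. E h)"
    using inG by (auto simp: E)
  show "{\<omega>\<in>space ?M. \<Phi> (slot_values b n s \<omega>)} \<in> sets ?M"
    unfolding event using cS sE by (intro sets.countable_UN'') auto
  have "emeasure ?p ?S = (\<integral>\<^sup>+h. emeasure ?p {h} \<partial>count_space ?S)"
    using cS by (intro emeasure_countable_singleton) auto
  also have "\<dots> \<le> (\<integral>\<^sup>+h. emeasure ?M (E h) \<partial>count_space ?S)"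
  proof (rule nn_integral_mono)
    fix h assume "h \<in> space (count_space ?S)"
    then have h: "h \<in> G" by simp
    have "emeasure ?p {h} = ennreal (\<Prod>x\<in>{..<n} \<times> {..<s}. pmf (geometric_pmf (1 / 2 ^ b)) (h x))"
    proof -
      have "h x = 0" if "x \<notin> {..<n} \<times> {..<s}" for x using h that unfolding G_def by blast
      then show ?thesis by (subst emeasure_pmf_single, subst pmf_Pi') auto
    qed
    also have "\<dots> = ennreal (\<Prod>v<n. \<Prod>j<s. pmf (geometric_pmf (1 / 2 ^ b)) (h (v, j)))"
      by (subst prod.cartesian_product) (simp add: case_prod_unfold)
    also have "\<dots> = (\<Prod>v<n. ennreal (\<Prod>j<s. pmf (geometric_pmf (1 / 2 ^ b)) (h (v, j))))"
      by (intro prod_ennreal[symmetric] prod_nonneg) (auto simp: pmf_nonneg)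
    also have "\<dots> \<le> (\<Prod>v<n. emeasure coins {\<beta>. \<forall>j<s. first_ones b \<beta> j = h (v, j)})"
      by (intro prod_mono_ennreal prob_first_ones_ge)
    also have "\<dots> = emeasure ?M (E h)"
      unfolding E_def M by (rule pp.emeasure_PiM_Collect[symmetric]) (use cyl in auto)
    finally show "emeasure ?p {h} \<le> emeasure ?M (E h)" .
  qed
  also have "\<dots> = emeasure ?M (\<Union>h\<in>?S. E h)"
  proof (rule emeasure_UN_countable[symmetric])
    show "disjoint_family_on E ?S" by (auto simp: disjoint_family_on_def E)
  qed (use cS sE in auto)
  finally have "emeasure ?p ?S \<le> emeasure ?M {\<omega>\<in>space ?M. \<Phi> (slot_values b n s \<omega>)}" unfolding event .
  then have "measure_pmf.prob ?p ?S \<le> measure ?M {\<omega>\<in>space ?M. \<Phi> (slot_values b n s \<omega>)}"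
    by (simp add: measure_pmf.emeasure_eq_measure M.emeasure_eq_measure)
  moreover have "measure_pmf.prob ?p ?S = measure_pmf.prob ?p {h. \<Phi> h}"
  proof (rule measure_prob_cong_0)
    fix h assume "h \<in> {h. \<Phi> h} - ?S"
    then have "\<exists>x. x \<notin> {..<n} \<times> {..<s} \<and> h x \<noteq> 0" unfolding G_def by blast
    then show "pmf ?p h = 0" by (intro pmf_Pi_outside) auto
  qed auto
  ultimately show "measure_pmf.prob ?p {h. \<Phi> h} \<le> measure ?M {\<omega>\<in>space ?M. \<Phi> (slot_values b n s \<omega>)}"
    by simp
qed

subsection \<open>Success probability\<close>

lemma approx_solution_cong:
  assumes "\<And>v. v < num_vars P \<Longrightarrow> x v = y v"
  shows "approx_solution P \<epsilon> x \<longleftrightarrow> approx_solution P \<epsilon> y"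
proof -
  have "cost P x = cost P y" unfolding cost_def using assms by (intro sum.cong) auto
  moreover have "(\<Sum>i<num_vars P. coef P j i * real (x i)) = (\<Sum>i<num_vars P. coef P j i * real (y i))" for j
    using assms by (intro sum.cong) auto
  ultimately show ?thesis using assms by (simp add: approx_solution_def feasible_def)
qed

text \<open>An approximation ratio below \<open>1 + 1 / opt P\<close> already forces optimality.\<close>

lemma approx_solution_max:
  assumes "approx_solution P (max \<epsilon> (1 / (2 * real N))) x" "opt P \<le> N" "0 < N" "0 < \<epsilon>"
  shows "approx_solution P \<epsilon> x"
proof (cases "1 / (2 * real N) \<le> \<epsilon>")
  case True
  then show ?thesis using assms(1) by (simp add: max_def split: if_splits)
next
  case False
  then have "real (cost P x) \<le> (1 + 1 / (2 * real N)) * real (opt P)"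
    using assms(1) by (simp add: approx_solution_def max_def)
  also have "\<dots> = real (opt P) + real (opt P) / (2 * real N)" by (simp add: field_simps)
  also have "\<dots> \<le> real (opt P) + 1 / 2" using assms(2,3) by (simp add: field_simps)
  finally have "cost P x \<le> opt P" by linarith
  also have "real (opt P) \<le> (1 + \<epsilon>) * real (opt P)" using assms(4) by (simp add: algebra_simps)
  finally show ?thesis using assms(1) by (simp add: approx_solution_def)
qed

lemma pmf_geometric_le:
  assumes "0 < q" "q \<le> 1"
  shows "pmf (geometric_pmf q) x \<le> q"
proof -
  have "(1 - q) ^ x * q \<le> 1 * q" using assms by (intro mult_right_mono power_le_one) auto
  then show ?thesis using assms by simp
qed

text \<open>Fix everything but the name of \<open>v\<close>. Each of its \<open>k\<close> slots then
  has to hit one prescribed value, and no value has probability above \<open>1 / 2\<close>. The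
  square comes from the union bound over pairs.\<close>

lemma prob_names_collide:
  assumes b: "1 \<le> b" and "k \<le> s"
  shows "measure_pmf.prob (Pi_pmf ({..<n} \<times> {..<s}) 0 (\<lambda>_. geometric_pmf (1 / 2 ^ b)))
    {h. \<not> inj_on (\<lambda>v. map (\<lambda>j. h (v, j)) [0..<k]) {..<n}} \<le> real (n ^ 2) * (1 / 2) ^ k"
proof -
  let ?p = "Pi_pmf ({..<n} \<times> {..<s}) 0 (\<lambda>_. geometric_pmf (1 / 2 ^ b))"
  let ?q = "1 / 2 ^ b :: real"
  let ?X = "{x\<in>{..<n} \<times> {..<n}. fst x \<noteq> snd x}"
  have q: "0 < ?q" "?q \<le> 1 / 2" "?q \<le> 1"
  proof -
    have "(2::real) ^ 1 \<le> 2 ^ b" using b by (intro power_increasing) auto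
    then show "?q \<le> 1 / 2" by (intro divide_left_mono) auto
    then show "?q \<le> 1" by linarith
  qed simp
  have pair: "measure_pmf.prob ?p {h. \<forall>j<k. h (u, j) = h (v, j)} \<le> (1 / 2) ^ k" if "u < n" "v < n" "u \<noteq> v" for u v
  proof -
    let ?B = "{v} \<times> {..<k}" and ?A = "{..<n} \<times> {..<s} - {v} \<times> {..<k}"
    have AB: "?A \<union> ?B = {..<n} \<times> {..<s}" using that \<open>k \<le> s\<close> by auto
    have "measure_pmf.prob (Pi_pmf (?A \<union> ?B) 0 (\<lambda>_. geometric_pmf ?q)) {h. \<forall>j<k. h (u, j) = h (v, j)} \<le> (1 / 2) ^ k"
    proof (rule Pi_pmf_union_prob_le)
      fix f :: "nat \<times> nat \<Rightarrow> nat"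
      let ?mg = "\<lambda>g x. if x \<in> ?A then f x else g x"
      have "{g. \<forall>j<k. ?mg g (u, j) = ?mg g (v, j)} \<subseteq> Pi ?B (\<lambda>x. {f (u, snd x)})"
      proof (intro subsetI Pi_I)
        fix g x assume g: "g \<in> {g. \<forall>j<k. ?mg g (u, j) = ?mg g (v, j)}" and "x \<in> ?B"
        then obtain j where j: "x = (v, j)" "j < k" by auto
        then have "?mg g (u, j) = ?mg g (v, j)" using g by blast
        moreover have "(u, j) \<in> ?A" "(v, j) \<notin> ?A" using j that \<open>k \<le> s\<close> by auto
        ultimately show "g x \<in> {f (u, snd x)}" using j by simp
      qed
      then have "measure_pmf.prob (Pi_pmf ?B 0 (\<lambda>_. geometric_pmf ?q)) {g. \<forall>j<k. ?mg g (u, j) = ?mg g (v, j)}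
        \<le> measure_pmf.prob (Pi_pmf ?B 0 (\<lambda>_. geometric_pmf ?q)) (Pi ?B (\<lambda>x. {f (u, snd x)}))"
        by (intro measure_pmf.finite_measure_mono) auto
      also have "\<dots> = (\<Prod>x\<in>?B. pmf (geometric_pmf ?q) (f (u, snd x)))"
        by (subst measure_Pi_pmf_Pi) (auto simp: measure_pmf_single)
      also have "\<dots> \<le> (\<Prod>x\<in>?B. 1 / 2)"
      proof (intro prod_mono conjI pmf_nonneg)
        fix x show "pmf (geometric_pmf ?q) (f (u, snd x)) \<le> 1 / 2"
          using pmf_geometric_le[OF q(1,3)] q(2) by (rule order_trans)
      qed
      also have "\<dots> = (1 / 2) ^ k" by (simp add: card_cartesian_product)
      finally show "measure_pmf.prob (Pi_pmf ?B 0 (\<lambda>_. geometric_pmf ?q)) {g. \<forall>j<k. ?mg g (u, j) = ?mg g (v, j)}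
        \<le> (1 / 2) ^ k" .
    next
      show "?A \<inter> ?B = {}" by blast
    qed simp_all
    then show ?thesis unfolding AB .
  qed
  have sub: "{h. \<not> inj_on (\<lambda>v. map (\<lambda>j. h (v, j)) [0..<k]) {..<n}}
    \<subseteq> (\<Union>x\<in>?X. {h. \<forall>j<k. h (fst x, j) = h (snd x, j)})"
  proof
    fix h assume "h \<in> {h. \<not> inj_on (\<lambda>v. map (\<lambda>j. h (v, j)) [0..<k]) {..<n}}"
    then obtain u v where uv: "u < n" "v < n" "u \<noteq> v"
      and eq: "map (\<lambda>j. h (u, j)) [0..<k] = map (\<lambda>j. h (v, j)) [0..<k]"
      unfolding inj_on_def by blast
    have "h (u, j) = h (v, j)" if "j < k" for j using arg_cong[OF eq, of "\<lambda>xs. xs ! j"] that by simp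
    then have "h \<in> {h. \<forall>j<k. h (fst (u, v), j) = h (snd (u, v), j)}" by simp
    moreover have "(u, v) \<in> ?X" using uv by simp
    ultimately show "h \<in> (\<Union>x\<in>?X. {h. \<forall>j<k. h (fst x, j) = h (snd x, j)})" by (rule UN_I[rotated])
  qed
  have fX: "finite ?X" by (rule finite_subset[of _ "{..<n} \<times> {..<n}"]) auto
  have "measure_pmf.prob ?p {h. \<not> inj_on (\<lambda>v. map (\<lambda>j. h (v, j)) [0..<k]) {..<n}}
    \<le> measure_pmf.prob ?p (\<Union>x\<in>?X. {h. \<forall>j<k. h (fst x, j) = h (snd x, j)})"
    using sub by (intro measure_pmf.finite_measure_mono) auto
  also have "\<dots> \<le> (\<Sum>x\<in>?X. measure_pmf.prob ?p {h. \<forall>j<k. h (fst x, j) = h (snd x, j)})"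
    using fX by (intro measure_pmf.finite_measure_subadditive_finite) auto
  also have "\<dots> \<le> (\<Sum>x\<in>?X. (1 / 2) ^ k)" by (intro sum_mono pair) auto
  also have "\<dots> = real (card ?X) * (1 / 2) ^ k" by simp
  also have "\<dots> \<le> real (n ^ 2) * (1 / 2) ^ k"
  proof (intro mult_right_mono of_nat_mono)
    have "card ?X \<le> card ({..<n} \<times> {..<n})" by (intro card_mono) auto
    then show "card ?X \<le> n ^ 2" by (simp add: card_cartesian_product power2_eq_square)
  qed simp
  finally show ?thesis .
qed

text \<open>\<open>\<delta>\<close> is the error that the parameters guarantee,
  \<open>\<epsilon>\<close> the one written into the records; they differ when
  \<open>\<epsilon>\<close> is tiny.\<close>

locale instance_with_parameters =
  fixes P :: covering_problem and \<epsilon> :: real and N :: nat and nb :: "nat \<Rightarrow> nat list"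
    and k b t g m :: nat and \<delta> :: real
  assumes valid: "valid_problem P" and feasible: "\<exists>x. feasible P x" and ports: "port_numbering P nb"
    and params: "0 < k" "4 \<le> b" "0 < g" "0 < t" "0 < m" "k * num_vars P \<le> m"
    and \<delta>: "4 * (1 - (1 - 1 / 2 ^ b) ^ 3) + 3 * real k ^ 2 / 2 ^ t + 27 * real t * real k / real g \<le> \<delta>"
begin

abbreviation "nv \<equiv> num_vars P"
abbreviation "ns \<equiv> k + m + t"
abbreviation "geo \<equiv> geometric_pmf (1 / 2 ^ b :: real)"
abbreviation "records \<equiv> vertex_record P \<epsilon> N nb ns"
abbreviation "outcome h v \<equiv> decide k b t g m (flood (records h) nb (Suc (10 * carving.rad k b t g 0)) v)"
abbreviation "names h \<equiv> (\<lambda>v. map (\<lambda>j. h (v, j)) [0..<k])"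

lemma card_simulation_V:
  assumes "simulation P nb k h"
  shows "card (simulation.V P k h) = nv"
proof -
  interpret simulation P \<epsilon> N nb k b t g m h by (rule assms)
  show ?thesis unfolding V_def by (simp add: card_image inj_name)
qed

text \<open>Names are random and at the same time the vertices of the network. They are fixed first:
  for distinct names the network no longer varies and the other slots are independent of it, so
  \<open>prob_answers\<close> applies.\<close>

lemma prob_fail_given_names:
  fixes f :: "nat \<times> nat \<Rightarrow> nat"
  defines "mg w \<equiv> \<lambda>x. if x \<in> {..<nv} \<times> {..<k} then f x else w x"
  shows "measure_pmf.prob (Pi_pmf ({..<nv} \<times> {k..<ns}) 0 (\<lambda>_. geo))
      {w. inj_on (names (mg w)) {..<nv} \<and> \<not> approx_solution P \<delta> (outcome (mg w))}
    \<le> real (nv * (m + t) + nv + 2 + t * nv + t) * (1 / 2) ^ k"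
proof -
  let ?S = "{k..<ns}"
  let ?B = "{..<nv} \<times> ?S"
  let ?h0 = "mg (\<lambda>_. 0)"
  have nm: "names (mg w) v = names ?h0 v" if "v < nv" for w v
    using that by (auto simp: mg_def)
  have inj_iff: "inj_on (names (mg w)) {..<nv} \<longleftrightarrow> inj_on (names ?h0) {..<nv}" for w
    by (intro inj_on_cong nm[of _ w]) simp
  show ?thesis
  proof (cases "inj_on (names ?h0) {..<nv}")
    case False
    then have "{w. inj_on (names (mg w)) {..<nv} \<and> \<not> approx_solution P \<delta> (outcome (mg w))} = {}"
      using inj_iff by blast
    then show ?thesis by (simp only: measure_empty) simp
  next
    case inj: True
    have sim: "simulation P nb k (mg w)" for w
      using valid feasible ports iffD2[OF inj_iff inj] by (rule simulation.intro)
    interpret S0: simulation P \<epsilon> N nb k b t g m ?h0 by (rule sim)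
    interpret rc: random_carving S0.wt S0.adj S0.con S0.V k b t g m
    proof (rule random_carving.intro[OF S0.covering_network], rule random_carving_axioms.intro)
      show "k * card S0.V \<le> m" using params card_simulation_V[OF sim[of "\<lambda>_. 0"]] by simp
    qed (fact params)+
    have name_eq: "simulation.name k (mg w) v = S0.name v" if "v < nv" for w v
      unfolding simulation.name_def[OF sim] by (rule nm[OF that])
    have V_eq: "simulation.V P k (mg w) = S0.V" for w
      unfolding simulation.V_def[OF sim] by (intro image_cong refl name_eq[of _ w]) simp
    have index_eq: "simulation.index P k (mg w) = S0.index" for w
    proof
      fix y
      have "(x < nv \<and> simulation.name k (mg w) x = y) = (x < nv \<and> S0.name x = y)" for x
        using name_eq[of x w] by metis
      then show "simulation.index P k (mg w) y = S0.index y"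
        unfolding simulation.index_def[OF sim] the_inv_into_def lessThan_iff by (simp only:)
    qed
    have wt_eq: "simulation.wt P k (mg w) = S0.wt" for w
      unfolding fun_eq_iff simulation.wt_def[OF sim] index_eq[of w] by simp
    have adj_eq: "simulation.adj P k (mg w) = S0.adj" for w
    proof
      fix x
      have "simulation.name k (mg w) ` neighbours P (S0.index x) = S0.name ` neighbours P (S0.index x)"
        using S0.neighbours_less by (intro image_cong refl name_eq[of _ w]) auto
      then show "simulation.adj P k (mg w) x = S0.adj x"
        unfolding simulation.adj_def[OF sim] V_eq[of w] index_eq[of w] by simp
    qed
    have con_eq: "simulation.con P k (mg w) = S0.con" for w
    proof
      fix x
      have "simulation.row P k (mg w) = S0.row"
        unfolding fun_eq_iff simulation.row_def[OF sim] V_eq[of w] index_eq[of w] by simp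
      then show "simulation.con P k (mg w) x = S0.con x"
        unfolding simulation.con_def[OF sim] index_eq[of w] by simp
    qed
    \<comment> \<open>Renames coordinates from names to vertex numbers. All other coordinates go to
      the dummy \<open>(nv, 0)\<close>, which is outside \<open>?B\<close>, so the value there is
      almost surely the default 0 that the slots of the simulation have as well.\<close>
    define \<beta> where "\<beta> = (\<lambda>(x, j). if x \<in> S0.V \<and> j \<in> ?S then (S0.index x, j) else (nv, 0))"
    have \<beta>: "bij_betw \<beta> (S0.V \<times> ?S) ?B"
      unfolding bij_betw_def
    proof
      show "inj_on \<beta> (S0.V \<times> ?S)" by (auto simp: inj_on_def \<beta>_def S0.V_def)
      have "\<beta> (S0.name v, j) = (v, j)" if "v < nv" "j \<in> ?S" for v j using that by (simp add: \<beta>_def)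
      then have "(v, j) \<in> \<beta> ` (S0.V \<times> ?S)" if "v < nv" "j \<in> ?S" for v j
        using that by (intro image_eqI[of _ _ "(S0.name v, j)"]) auto
      then show "\<beta> ` (S0.V \<times> ?S) = ?B" by (auto simp: \<beta>_def S0.V_def)
    qed
    have law: "Pi_pmf (S0.V \<times> ?S) 0 (\<lambda>_. geo) = map_pmf (\<lambda>w. w \<circ> \<beta>) (Pi_pmf ?B 0 (\<lambda>_. geo))"
    proof (rule Pi_pmf_bij_betw[OF _ \<beta>])
      show "finite (S0.V \<times> ?S)" by (simp add: S0.V_def)
      fix x assume "x \<notin> S0.V \<times> ?S"
      then have "\<beta> x = (nv, 0)" by (cases x) (auto simp: \<beta>_def)
      then show "\<beta> x \<notin> ?B" by simp
    qed
    define bad where "bad T \<longleftrightarrow> \<not> (S0.I.covers (rc.answers T) S0.V \<and>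
      real (sum S0.wt (rc.answers T)) \<le> (1 + \<delta>) * real rc.OPT)" for T
    have \<delta>0: "0 \<le> \<delta>"
    proof -
      have "0 \<le> 4 * rc.p" using rc.p_bounds(1) by (intro mult_nonneg_nonneg) auto
      moreover have "0 \<le> 3 * real k ^ 2 / 2 ^ t" "0 \<le> 27 * real t * real k / real g" by simp_all
      ultimately show ?thesis using \<delta> by linarith
    qed
    have fail: "bad (curry (w \<circ> \<beta>))"
      if supp: "w (nv, 0) = 0" and na: "\<not> approx_solution P \<delta> (outcome (mg w))" for w
    proof (rule ccontr)
      assume nb: "\<not> bad (curry (w \<circ> \<beta>))"
      interpret S: simulation P \<epsilon> N nb k b t g m "mg w" by (rule sim)
      have T: "S.T = curry (w \<circ> \<beta>)"
      proof (intro ext)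
        fix x j
        have "mg w (v, j) = w (v, j)" if "j \<in> ?S" for v using that by (simp add: mg_def)
        then show "S.T x j = curry (w \<circ> \<beta>) x j"
          unfolding S.T_def V_eq[of w] index_eq[of w] \<beta>_def using supp by simp
      qed
      have "approx_solution P \<delta> (outcome (mg w))"
      proof (rule S.approx_solution_of_cover)
        let ?X = "rc.answers S.T"
        show "S.I.covers ?X S.V" using nb by (simp add: bad_def T V_eq[of w] con_eq[of w])
        show "?X \<subseteq> S.V" by (auto simp: V_eq[of w])
        show "real (sum S.wt ?X) \<le> (1 + \<delta>) * real (sum S.wt (S.I.sol S.V))"
          using nb by (simp add: bad_def T V_eq[of w] con_eq[of w] wt_eq[of w])
        show "0 \<le> \<delta>" by (rule \<delta>0)
        show "outcome (mg w) v = (if S.name v \<in> ?X then 1 else 0)" if "v < nv" for v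
          using S.decide_flood[OF that] S.name_in_V[OF that]
          by (simp add: wt_eq[of w] adj_eq[of w] con_eq[of w] V_eq[of w])
      qed
      then show False using na by simp
    qed
    have "measure_pmf.prob (Pi_pmf ?B 0 (\<lambda>_. geo)) {w. inj_on (names (mg w)) {..<nv} \<and> \<not> approx_solution P \<delta> (outcome (mg w))}
      \<le> measure_pmf.prob (Pi_pmf ?B 0 (\<lambda>_. geo)) ({w. bad (curry (w \<circ> \<beta>))} \<union> {w. w (nv, 0) \<noteq> 0})"
      using fail by (intro measure_pmf.finite_measure_mono) auto
    also have "\<dots> = measure_pmf.prob (Pi_pmf ?B 0 (\<lambda>_. geo)) {w. bad (curry (w \<circ> \<beta>))}"
    proof (rule measure_prob_cong_0)
      fix w assume "w \<in> {w. bad (curry (w \<circ> \<beta>))} \<union> {w. w (nv, 0) \<noteq> 0} - {w. bad (curry (w \<circ> \<beta>))}"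
      then have "w (nv, 0) \<noteq> 0" by blast
      moreover have "(nv, 0) \<notin> ?B" by simp
      ultimately show "pmf (Pi_pmf ?B 0 (\<lambda>_. geo)) w = 0" by (intro pmf_Pi_outside) blast+
    qed blast
    also have "\<dots> = measure_pmf.prob (Pi_pmf (S0.V \<times> ?S) 0 (\<lambda>_. geo)) {\<omega>. bad (curry \<omega>)}"
      unfolding law by (simp add: vimage_def)
    also have "\<dots> \<le> real (card S0.V * (m + t) + card S0.V + 2 + t * card S0.V + t) * (1 / 2) ^ k"
      unfolding bad_def by (rule rc.prob_answers) (use \<delta> params in auto)
    finally show ?thesis using card_simulation_V[OF sim] by simp
  qed
qed

lemma prob_outcome:
  "1 - real (nv ^ 2 + nv * (m + t) + nv + 2 + t * nv + t) * (1 / 2) ^ k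
    \<le> measure_pmf.prob (Pi_pmf ({..<nv} \<times> {..<ns}) 0 (\<lambda>_. geo)) {h. approx_solution P \<delta> (outcome h)}"
proof -
  let ?p = "Pi_pmf ({..<nv} \<times> {..<ns}) 0 (\<lambda>_. geo)"
  let ?I = "{h. \<not> inj_on (names h) {..<nv}}"
  let ?F = "{h. inj_on (names h) {..<nv} \<and> \<not> approx_solution P \<delta> (outcome h)}"
  have AB: "{..<nv} \<times> {..<ns} = {..<nv} \<times> {..<k} \<union> {..<nv} \<times> {k..<ns}" by auto
  have "measure_pmf.prob ?p ?F \<le> real (nv * (m + t) + nv + 2 + t * nv + t) * (1 / 2) ^ k"
    unfolding AB by (rule Pi_pmf_union_prob_le) (use prob_fail_given_names in auto)
  moreover have "measure_pmf.prob ?p ?I \<le> real (nv ^ 2) * (1 / 2) ^ k"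
    using params by (intro prob_names_collide) auto
  moreover have "measure_pmf.prob ?p (UNIV - {h. approx_solution P \<delta> (outcome h)}) \<le> measure_pmf.prob ?p (?I \<union> ?F)"
    by (intro measure_pmf.finite_measure_mono) auto
  moreover have "measure_pmf.prob ?p (?I \<union> ?F) \<le> measure_pmf.prob ?p ?I + measure_pmf.prob ?p ?F"
    by (intro measure_Un_le) auto
  moreover have "measure_pmf.prob ?p (UNIV - {h. approx_solution P \<delta> (outcome h)})
      = 1 - measure_pmf.prob ?p {h. approx_solution P \<delta> (outcome h)}"
    using measure_pmf.prob_compl[of "{h. approx_solution P \<delta> (outcome h)}" ?p] by simp
  ultimately show ?thesis by (simp add: algebra_simps)
qed

end

context instance_with_parameters
begin

lemma success_probability:
  fixes kf bf tf gf mf :: "real \<Rightarrow> nat \<Rightarrow> nat"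
  assumes fns: "kf \<epsilon> N = k" "bf \<epsilon> N = b" "tf \<epsilon> N = t" "gf \<epsilon> N = g" "mf \<epsilon> N = m"
    and \<delta>': "\<delta> = max \<epsilon> (1 / (2 * real N))" and N: "opt P \<le> N" "0 < N" and \<epsilon>: "0 < \<epsilon>"
  defines "Alg \<equiv> carving_algorithm kf bf tf gf mf"
  shows "success_event Alg P \<epsilon> N nb \<in> sets (random_bits P)"
    and "1 - real (nv ^ 2 + nv * (m + t) + nv + 2 + t * nv + t) * (1 / 2) ^ k
      \<le> measure (random_bits P) (success_event Alg P \<epsilon> N nb)"
proof -
  let ?\<rho> = "Suc (10 * carving.rad k b t g 0)"
  let ?\<Phi> = "\<lambda>h. approx_solution P \<epsilon> (outcome h)"
  have out_eq: "output_of Alg P \<epsilon> N nb \<omega> v = outcome (slot_values b nv ns \<omega>) v" if v: "v < nv" for \<omega> v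
  proof -
    let ?R = "\<lambda>u. encode_input (input_of P \<epsilon> N nb u) (map (first_ones b (\<omega> u)) [0..<ns])"
    let ?h = "slot_values b nv ns \<omega>"
    have nbs: "set (nb u) \<subseteq> {..<nv}" if "u < nv" for u
      using ports that by (auto simp: port_numbering_def neighbours_def hyperedge_def)
    have R: "?R u = records ?h u" if "u < nv" for u
    proof -
      have "map (first_ones b (\<omega> u)) [0..<ns] = map (\<lambda>j. ?h (u, j)) [0..<ns]"
        using that by (simp add: slot_values_def)
      then show ?thesis by (simp only: vertex_record_def)
    qed
    have fl: "flood ?R nb ?\<rho> v = flood (records ?h) nb ?\<rho> v"
      by (rule flood_cong[OF nbs R v])
    have "state_after Alg P \<epsilon> N nb \<omega> (rounds Alg \<epsilon> N) v = flood ?R nb ?\<rho> v"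
      unfolding Alg_def state_after_carving_algorithm fns by (simp add: carving_algorithm_def fns)
    then have "output_of Alg P \<epsilon> N nb \<omega> v = result Alg (flood ?R nb ?\<rho> v)"
      by (simp add: output_of_def)
    also have "\<dots> = decide k b t g m (flood ?R nb ?\<rho> v)"
      unfolding Alg_def carving_algorithm_def
      by (simp add: encode_input_def input_of_def fns Let_def del: flood.simps)
    finally show ?thesis unfolding fl .
  qed
  have ev: "success_event Alg P \<epsilon> N nb = {\<omega>\<in>space (random_bits P). ?\<Phi> (slot_values b nv ns \<omega>)}"
    unfolding success_event_def
    by (intro Collect_cong conj_cong refl approx_solution_cong out_eq)
  show "success_event Alg P \<epsilon> N nb \<in> sets (random_bits P)"
    unfolding ev by (rule random_bits_slot_values)
  have "1 - real (nv ^ 2 + nv * (m + t) + nv + 2 + t * nv + t) * (1 / 2) ^ k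
    \<le> measure_pmf.prob (Pi_pmf ({..<nv} \<times> {..<ns}) 0 (\<lambda>_. geo)) {h. approx_solution P \<delta> (outcome h)}"
    by (rule prob_outcome)
  also have "\<dots> \<le> measure_pmf.prob (Pi_pmf ({..<nv} \<times> {..<ns}) 0 (\<lambda>_. geo)) {h. ?\<Phi> h}"
    using approx_solution_max[of P \<epsilon> N] N \<epsilon> \<delta>' by (intro measure_pmf.finite_measure_mono) auto
  also have "\<dots> \<le> measure (random_bits P) (success_event Alg P \<epsilon> N nb)"
    unfolding ev by (rule random_bits_slot_values)
  finally show "1 - real (nv ^ 2 + nv * (m + t) + nv + 2 + t * nv + t) * (1 / 2) ^ k
      \<le> measure (random_bits P) (success_event Alg P \<epsilon> N nb)" .
qed

end

subsection \<open>Choice of the parameters\<close>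

text \<open>Costs are integers, so ratios closer to one than this bring nothing new. Without the
  lower bound the number of levels would not be polynomial in \<open>N\<close> for extremely small
  \<open>\<epsilon>\<close>, and the union bound over the levels would fail.\<close>

definition slack :: "real \<Rightarrow> nat \<Rightarrow> real" where
  "slack \<epsilon> N = max \<epsilon> (1 / (2 * real N))"

definition log_bound :: "nat \<Rightarrow> nat" where
  "log_bound N = nat \<lceil>log 2 (real N)\<rceil> + 1"

text \<open>Error budget: \<open>12 / 2 ^ b\<close> and \<open>3 * k ^ 2 / 2 ^ t\<close> may each
  use a quarter of \<open>slack\<close>, and \<open>27 * t * k / g\<close> one half. This gives the
  constants 48, 12 and 54 in \<open>block_length\<close>, \<open>levels\<close> and
  \<open>gap\<close>.\<close>

definition block_length :: "real \<Rightarrow> nat \<Rightarrow> nat" where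
  "block_length \<epsilon> N = nat \<lceil>log 2 (48 / slack \<epsilon> N)\<rceil>"

definition levels :: "nat \<Rightarrow> real \<Rightarrow> nat \<Rightarrow> nat" where
  "levels k \<epsilon> N = nat \<lceil>log 2 (12 * real k ^ 2 / slack \<epsilon> N)\<rceil>"

definition gap :: "nat \<Rightarrow> real \<Rightarrow> nat \<Rightarrow> nat" where
  "gap k \<epsilon> N = nat \<lceil>54 * real (levels k \<epsilon> N) * real k / slack \<epsilon> N\<rceil>"

lemma power_nat_ceiling_log:
  assumes "1 \<le> x"
  shows "x \<le> 2 ^ nat \<lceil>log 2 x\<rceil>" "2 ^ nat \<lceil>log 2 x\<rceil> \<le> 2 * x" "real (nat \<lceil>log 2 x\<rceil>) \<le> log 2 x + 1"
proof -
  have l: "0 \<le> log 2 x" using assms by simp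
  have r: "real (nat \<lceil>log 2 x\<rceil>) = of_int \<lceil>log 2 x\<rceil>" using l by simp
  have x: "2 powr (log 2 x) = x" using assms by simp
  have p: "2 ^ nat \<lceil>log 2 x\<rceil> = (2::real) powr real (nat \<lceil>log 2 x\<rceil>)" by (simp add: powr_realpow)
  have "2 powr (log 2 x) \<le> (2::real) powr real (nat \<lceil>log 2 x\<rceil>)" unfolding r by (intro powr_mono) auto
  then show "x \<le> 2 ^ nat \<lceil>log 2 x\<rceil>" unfolding p x .
  show r1: "real (nat \<lceil>log 2 x\<rceil>) \<le> log 2 x + 1" unfolding r by linarith
  have "(2::real) powr real (nat \<lceil>log 2 x\<rceil>) \<le> 2 powr (log 2 x + 1)" using r1 by (intro powr_mono) auto
  also have "\<dots> = 2 * x" using x by (simp add: powr_add)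
  finally show "2 ^ nat \<lceil>log 2 x\<rceil> \<le> 2 * x" unfolding p .
qed

context
  fixes \<epsilon> :: real and N k :: nat
  assumes \<epsilon>: "0 < \<epsilon>" "\<epsilon> < 1" and N: "1 \<le> N" and k: "1 \<le> k"
begin

lemma slack_bounds: "0 < slack \<epsilon> N" "slack \<epsilon> N \<le> 1" "\<epsilon> \<le> slack \<epsilon> N" "1 / slack \<epsilon> N \<le> 2 * real N" "1 / slack \<epsilon> N \<le> 1 / \<epsilon>"
proof -
  show "0 < slack \<epsilon> N" "slack \<epsilon> N \<le> 1" "\<epsilon> \<le> slack \<epsilon> N" using \<epsilon> N by (auto simp: slack_def)
  have "1 / slack \<epsilon> N \<le> 1 / (1 / (2 * real N))"
    using N by (intro divide_left_mono) (auto simp: slack_def less_max_iff_disj)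
  then show "1 / slack \<epsilon> N \<le> 2 * real N" by simp
  show "1 / slack \<epsilon> N \<le> 1 / \<epsilon>" using \<epsilon> by (intro divide_left_mono) (auto simp: slack_def less_max_iff_disj)
qed

lemma ratio_bounds: "1 \<le> 48 / slack \<epsilon> N" "1 \<le> 12 * real k ^ 2 / slack \<epsilon> N" "12 \<le> 12 * real k ^ 2 / slack \<epsilon> N"
proof -
  note s = slack_bounds
  show "1 \<le> 48 / slack \<epsilon> N" using s by simp
  have "1 \<le> real k ^ 2" using k by simp
  then have "12 * 1 / 1 \<le> 12 * real k ^ 2 / slack \<epsilon> N" using s by (intro frac_le) auto
  then show "12 \<le> 12 * real k ^ 2 / slack \<epsilon> N" by simp
  then show "1 \<le> 12 * real k ^ 2 / slack \<epsilon> N" by linarith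
qed

lemma block_length_bounds: "48 / slack \<epsilon> N \<le> 2 ^ block_length \<epsilon> N" "2 ^ block_length \<epsilon> N \<le> 96 / slack \<epsilon> N"
    "4 \<le> block_length \<epsilon> N"
proof -
  show 1: "48 / slack \<epsilon> N \<le> 2 ^ block_length \<epsilon> N" and "2 ^ block_length \<epsilon> N \<le> 96 / slack \<epsilon> N"
    using power_nat_ceiling_log[OF ratio_bounds(1)] by (simp_all add: block_length_def)
  have "48 / 1 \<le> 48 / slack \<epsilon> N" using slack_bounds by (intro divide_left_mono) auto
  then have "(2::real) ^ 4 \<le> 2 ^ block_length \<epsilon> N" using 1 by simp
  then show "4 \<le> block_length \<epsilon> N" by (rule power_le_imp_le_exp[rotated]) simp
qed

lemma levels_bounds: "12 * real k ^ 2 / slack \<epsilon> N \<le> 2 ^ levels k \<epsilon> N" "0 < levels k \<epsilon> N"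
    "real (levels k \<epsilon> N) \<le> log 2 (12 * real k ^ 2 / slack \<epsilon> N) + 1"
proof -
  show 1: "12 * real k ^ 2 / slack \<epsilon> N \<le> 2 ^ levels k \<epsilon> N"
    "real (levels k \<epsilon> N) \<le> log 2 (12 * real k ^ 2 / slack \<epsilon> N) + 1"
    using power_nat_ceiling_log[OF ratio_bounds(2)] by (simp_all add: levels_def)
  show "0 < levels k \<epsilon> N"
  proof (rule ccontr)
    assume "\<not> 0 < levels k \<epsilon> N"
    then show False using 1(1) ratio_bounds(3) by simp
  qed
qed

lemma gap_bounds: "54 * real (levels k \<epsilon> N) * real k / slack \<epsilon> N \<le> real (gap k \<epsilon> N)" "0 < gap k \<epsilon> N"
    "real (gap k \<epsilon> N) \<le> 54 * real (levels k \<epsilon> N) * real k / slack \<epsilon> N + 1"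
proof -
  have pos: "0 < 54 * real (levels k \<epsilon> N) * real k / slack \<epsilon> N"
    using levels_bounds slack_bounds k by simp
  show "54 * real (levels k \<epsilon> N) * real k / slack \<epsilon> N \<le> real (gap k \<epsilon> N)"
    "real (gap k \<epsilon> N) \<le> 54 * real (levels k \<epsilon> N) * real k / slack \<epsilon> N + 1"
    using pos unfolding gap_def by linarith+
  then show "0 < gap k \<epsilon> N" using pos by linarith
qed

lemma total_error:
  "4 * (1 - (1 - 1 / 2 ^ block_length \<epsilon> N) ^ 3) + 3 * real k ^ 2 / 2 ^ levels k \<epsilon> N
    + 27 * real (levels k \<epsilon> N) * real k / real (gap k \<epsilon> N) \<le> slack \<epsilon> N"
proof -
  let ?q = "1 / 2 ^ block_length \<epsilon> N :: real" and ?s = "slack \<epsilon> N"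
  note s = slack_bounds
  have p2: "(1::real) \<le> 2 ^ block_length \<epsilon> N" by simp
  have q: "0 \<le> ?q" "?q \<le> 1" by (simp_all add: field_simps)
  have "1 - 3 * ?q \<le> (1 - ?q) ^ 3" using Bernoulli_inequality[of "- ?q" 3] q by simp
  then have "4 * (1 - (1 - ?q) ^ 3) \<le> 12 * ?q" by simp
  also have "?q \<le> ?s / 48"
    using block_length_bounds(1) s by (simp add: field_simps)
  finally have 1: "4 * (1 - (1 - ?q) ^ 3) \<le> ?s / 4" by simp
  have 2: "3 * real k ^ 2 / 2 ^ levels k \<epsilon> N \<le> ?s / 4"
    using levels_bounds(1) s by (simp add: field_simps)
  have 3: "27 * real (levels k \<epsilon> N) * real k / real (gap k \<epsilon> N) \<le> ?s / 2"
    using gap_bounds(1,2) s by (simp add: field_simps)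
  show ?thesis using 1 2 3 by linarith
qed

lemma levels_le: "real (levels k \<epsilon> N) \<le> 48 * real k ^ 2 * real N + 1"
proof -
  let ?x = "12 * real k ^ 2 / slack \<epsilon> N"
  have "log 2 ?x \<le> 2 * ?x"
  proof -
    have "ln ?x \<le> ?x - 1" using ratio_bounds by (intro ln_le_minus_one) auto
    moreover have "1 / 2 \<le> ln (2::real)" using ln2_ge_two_thirds by simp
    then have "?x \<le> 2 * ?x * ln 2" using ratio_bounds mult_left_mono[of "1 / 2" "ln 2" "2 * ?x"] by simp
    ultimately have "ln ?x \<le> 2 * ?x * ln 2" by linarith
    then show ?thesis by (simp add: log_def pos_divide_le_eq)
  qed
  moreover have "?x \<le> 12 * real k ^ 2 * (2 * real N)"
  proof -
    have "12 * real k ^ 2 * (1 / slack \<epsilon> N) \<le> 12 * real k ^ 2 * (2 * real N)"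
      using slack_bounds by (intro mult_left_mono) auto
    then show ?thesis by simp
  qed
  ultimately show ?thesis using levels_bounds(3) by simp
qed

lemma rounds_le:
  "real (Suc (10 * carving.rad k (block_length \<epsilon> N) (levels k \<epsilon> N) (gap k \<epsilon> N) 0))
    \<le> 3600 * real (levels k \<epsilon> N) ^ 2 * real k / \<epsilon>"
proof -
  let ?t = "real (levels k \<epsilon> N)" and ?g = "real (gap k \<epsilon> N)" and ?k = "real k" and ?s = "slack \<epsilon> N"
  note s = slack_bounds
  have t1: "1 \<le> ?t" using levels_bounds(2) by simp
  have k1: "1 \<le> ?k" using k by simp
  define z where "z = ?k / \<epsilon>"
  have z1: "1 \<le> z" unfolding z_def using k1 \<epsilon> by (simp add: field_simps)
  have ks: "?k / ?s \<le> z" unfolding z_def using \<epsilon> s by (intro divide_left_mono) auto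
  have t2: "?t \<le> ?t ^ 2" using t1 by (simp add: power2_eq_square)
  have tz: "?t \<le> ?t ^ 2 * z" "z \<le> ?t ^ 2 * z" "1 \<le> ?t ^ 2 * z"
  proof -
    have "?t * 1 \<le> ?t ^ 2 * z" using t1 t2 z1 by (intro mult_mono) auto
    then show "?t \<le> ?t ^ 2 * z" by simp
    have "1 * z \<le> ?t ^ 2 * z" using t1 t2 z1 by (intro mult_right_mono) auto
    then show "z \<le> ?t ^ 2 * z" by simp
    then show "1 \<le> ?t ^ 2 * z" using z1 by linarith
  qed
  have "real (carving.cap k (block_length \<epsilon> N)) = ?k * 2 ^ block_length \<epsilon> N" by (simp add: carving.cap_def)
  also have "\<dots> \<le> ?k * (96 / ?s)" using block_length_bounds(2) by (intro mult_left_mono) auto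
  also have "\<dots> = 96 * (?k / ?s)" by simp
  also have "\<dots> \<le> 96 * z" using ks by simp
  finally have cap: "real (carving.cap k (block_length \<epsilon> N)) \<le> 96 * z" .
  have "?g * ?t \<le> (54 * (?t * (?k / ?s)) + 1) * ?t" using gap_bounds(3) t1 by (intro mult_right_mono) (auto simp: algebra_simps)
  also have "\<dots> \<le> (54 * (?t * z) + 1) * ?t" using ks t1 by (intro mult_right_mono add_right_mono mult_left_mono) auto
  also have "\<dots> = 54 * (?t ^ 2 * z) + ?t" by (simp add: algebra_simps power2_eq_square)
  finally have gt: "?g * ?t \<le> 54 * (?t ^ 2 * z) + ?t" .
  \<comment> \<open>With \<open>96 * z\<close> for \<open>cap\<close> and
    \<open>54 * (t ^ 2 * z) + t\<close> for \<open>g * t\<close>, the coefficients add up to 21 +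
    1920 + 1620 + 30 = 3591.\<close>
  have "real (Suc (10 * carving.rad k (block_length \<epsilon> N) (levels k \<epsilon> N) (gap k \<epsilon> N) 0))
    = 21 + 20 * real (carving.cap k (block_length \<epsilon> N)) + 30 * (?g * ?t)"
    by (simp add: carving.rad_def algebra_simps)
  also have "\<dots> \<le> 3600 * (?t ^ 2 * z)" using cap gt tz by linarith
  finally show ?thesis by (simp add: z_def)
qed

end

lemma square_le_two_power: "4 \<le> n \<Longrightarrow> n ^ 2 \<le> (2::nat) ^ n"
proof (induction n rule: nat_induct_at_least)
  case (Suc n)
  have "2 * n + 1 \<le> n * n" using mult_le_mono1[of 3 n n] Suc.hyps by linarith
  then have "(Suc n) ^ 2 \<le> 2 * n ^ 2" by (simp add: power2_eq_square)
  then show ?case using Suc.IH by simp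
qed simp

lemma log_bound_bounds:
  assumes "1 \<le> N"
  shows "real N \<le> 2 ^ log_bound N" "1 \<le> log_bound N" "real (log_bound N) \<le> log 2 (real N) + 2"
proof -
  have l: "real N \<le> 2 ^ nat \<lceil>log 2 (real N)\<rceil>" "real (nat \<lceil>log 2 (real N)\<rceil>) \<le> log 2 (real N) + 1"
    using power_nat_ceiling_log[of "real N"] assms by auto
  have "real (log_bound N) = real (nat \<lceil>log 2 (real N)\<rceil>) + 1" by (simp only: log_bound_def of_nat_add of_nat_1)
  then show "real (log_bound N) \<le> log 2 (real N) + 2" using l(2) by linarith
  have "(2::real) ^ nat \<lceil>log 2 (real N)\<rceil> \<le> 2 ^ log_bound N"
    unfolding log_bound_def by (intro power_increasing le_add1) simp
  with l(1) show "real N \<le> 2 ^ log_bound N" by (rule order_trans)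
  show "1 \<le> log_bound N" by (simp add: log_bound_def)
qed

text \<open>Everything is measured in \<open>M = 2 ^ log_bound N\<close>, which is at least
  \<open>N\<close>: the factor of the union bound is at most \<open>a ^ 2 * M ^ 12\<close>, and
  \<open>(1 / 2) ^ k\<close> is \<open>M ^ -a\<close>. The choice of \<open>a\<close> ensures
  \<open>a ^ 2 \<le> M ^ (a - 12 - C)\<close>, which leaves \<open>M ^ -C\<close>.\<close>

lemma failure_le:
  fixes C N n m t :: nat and c' :: real
  defines "a \<equiv> 2 * (12 + C) + 8"
  defines "k \<equiv> a * log_bound N"
  assumes n: "1 \<le> n" "n \<le> N" and m: "m = k * N" and t: "real t \<le> 48 * real k ^ 2 * real N + 1" and C: "c' \<le> real C"
  shows "real (n ^ 2 + n * (m + t) + n + 2 + t * n + t) * (1 / 2) ^ k \<le> real n powr (- c')"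
proof -
  define l where "l = log_bound N"
  define M where "M = (2::real) ^ l"
  have N: "real N \<le> M" "1 \<le> l" using log_bound_bounds[of N] n by (simp_all add: M_def l_def)
  have lM: "real l \<le> M" unfolding M_def by (rule less_imp_le) (rule of_nat_less_two_power)
  have M2: "2 \<le> M"
  proof -
    have "(2::real) ^ 1 \<le> 2 ^ l" using N by (intro power_increasing) auto
    then show ?thesis by (simp add: M_def)
  qed
  have nM: "real n \<le> M" using n N by linarith
  have a1: "1 \<le> real a" by (simp add: a_def)
  have kM: "real k \<le> real a * M" unfolding k_def using lM by (simp add: l_def mult_left_mono)
  have pow: "M ^ i \<le> M ^ j" if "i \<le> j" for i j using M2 that by (intro power_increasing) auto
  have M1: "1 \<le> M ^ i" for i using M2 by (intro one_le_power) auto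
  have aa: "real a \<le> real a ^ 2" "1 \<le> real a ^ 2"
    using self_le_power[OF a1, of 2] one_le_power[OF a1, of 2] by simp_all
  have kN: "real k ^ 2 * real N \<le> real a ^ 2 * M ^ 3"
  proof -
    have "real k ^ 2 * real N \<le> (real a * M) ^ 2 * M" using kM N M2 by (intro mult_mono power_mono) auto
    then show ?thesis by (simp add: power_mult_distrib power3_eq_cube power2_eq_square mult_ac)
  qed
  have aM: "1 \<le> real a ^ 2 * M ^ i" for i using mult_mono[OF aa(2) M1[of i]] by simp
  have t': "real t \<le> 49 * (real a ^ 2 * M ^ 3)" using t kN aM[of 3] by linarith
  have up: "x \<le> c * (real a ^ 2 * M ^ i) \<Longrightarrow> 0 \<le> c \<Longrightarrow> i \<le> 4 \<Longrightarrow> x \<le> c * (real a ^ 2 * M ^ 4)" for x c i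
    by (rule order_trans) (auto intro!: mult_left_mono pow)
  have t4: "real t \<le> 49 * (real a ^ 2 * M ^ 4)" by (rule up[OF t']) auto
  have n4: "real n \<le> 1 * (real a ^ 2 * M ^ 4)"
  proof (rule up[of _ _ 1])
    have "real n \<le> 1 * M" using nM by simp
    also have "\<dots> \<le> real a ^ 2 * M" using aa M2 by (intro mult_right_mono) auto
    finally show "real n \<le> 1 * (real a ^ 2 * M ^ 1)" by simp
  qed auto
  have nn: "real n * real n \<le> 1 * (real a ^ 2 * M ^ 4)"
  proof (rule up[of _ _ 2])
    have "real n * real n \<le> 1 * (M * M)" using nM by (simp add: mult_mono)
    also have "\<dots> \<le> real a ^ 2 * (M * M)" using aa by (intro mult_right_mono) auto
    finally show "real n * real n \<le> 1 * (real a ^ 2 * M ^ 2)" by (simp add: power2_eq_square)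
  qed auto
  have nm: "real n * real m \<le> 1 * (real a ^ 2 * M ^ 4)"
  proof (rule up[of _ _ 3])
    have "real n * real m \<le> M * (real a * M * M)"
      unfolding m of_nat_mult using nM kM N M2 a1 by (intro mult_mono) auto
    also have "\<dots> = real a * M ^ 3" by (simp add: power3_eq_cube mult_ac)
    also have "\<dots> \<le> real a ^ 2 * M ^ 3" using aa(1) M2 by (intro mult_right_mono) auto
    finally show "real n * real m \<le> 1 * (real a ^ 2 * M ^ 3)" by simp
  qed auto
  have nt: "real n * real t \<le> 49 * (real a ^ 2 * M ^ 4)"
  proof -
    have "real n * real t \<le> M * (49 * (real a ^ 2 * M ^ 3))" using nM t' M2 by (intro mult_mono) auto
    then show ?thesis by (simp add: power_numeral_reduce mult_ac)
  qed
  have "real (n ^ 2 + n * (m + t) + n + 2 + t * n + t)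
    = real n * real n + real n * real m + 2 * (real n * real t) + real n + 2 + real t"
    by (simp add: power2_eq_square algebra_simps)
  \<comment> \<open>The coefficients sum to 152; rounding up to \<open>2 ^ 8 \<le> M ^ 8\<close>
    turns the constant into a power of \<open>M\<close>.\<close>
  also have "\<dots> \<le> 256 * (real a ^ 2 * M ^ 4)" using nn nm nt n4 t4 aM[of 4] by linarith
  also have "\<dots> \<le> M ^ 8 * (real a ^ 2 * M ^ 4)"
  proof (rule mult_right_mono)
    have "(2::real) ^ 8 \<le> M ^ 8" using M2 by (intro power_mono) auto
    then show "256 \<le> M ^ 8" by simp
  qed (use M2 in simp)
  also have "\<dots> = real a ^ 2 * M ^ 12" by (simp add: power_add[symmetric])
  finally have F: "real (n ^ 2 + n * (m + t) + n + 2 + t * n + t) \<le> real a ^ 2 * M ^ 12" .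
  have half: "(1 / 2) ^ k = 1 / M ^ a"
    unfolding k_def M_def l_def[symmetric] power_one_over power_mult[symmetric] by (simp only: mult.commute)
  have a2: "real a ^ 2 \<le> M ^ (a - (12 + C))"
  proof -
    have "(C + 16) ^ 2 \<le> (2::nat) ^ (C + 16)" by (rule square_le_two_power) simp
    moreover have "a = 2 * (C + 16)" by (simp add: a_def)
    moreover have "a - (12 + C) = (C + 16) + 4" by (simp add: a_def)
    moreover have "(2::nat) ^ ((C + 16) + 4) = 2 ^ (C + 16) * 16" unfolding power_add by simp
    ultimately have "a ^ 2 \<le> 2 ^ (a - (12 + C))"
      by (simp only: power_mult_distrib power2_eq_square)
    then have "real (a ^ 2) \<le> real (2 ^ (a - (12 + C)))" by (rule of_nat_mono)
    then have "real a ^ 2 \<le> 2 ^ (a - (12 + C))" by simp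
    also have "\<dots> \<le> M ^ (a - (12 + C))" using M2 by (intro power_mono) auto
    finally show ?thesis .
  qed
  have "real (n ^ 2 + n * (m + t) + n + 2 + t * n + t) * (1 / 2) ^ k \<le> real a ^ 2 * M ^ 12 * (1 / M ^ a)"
    unfolding half using F M2 by (intro mult_right_mono) auto
  also have "\<dots> \<le> M ^ (a - (12 + C)) * M ^ 12 * (1 / M ^ a)"
    using a2 M2 by (intro mult_right_mono) auto
  also have "\<dots> = 1 / M ^ C"
  proof -
    have "M ^ a = M ^ (a - (12 + C)) * M ^ 12 * M ^ C"
      unfolding power_add[symmetric] by (rule arg_cong[of _ _ "\<lambda>i. M ^ i"]) (simp add: a_def)
    then show ?thesis using M2 by simp
  qed
  also have "\<dots> \<le> 1 / real n ^ C" using nM n by (intro divide_left_mono power_mono) auto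
  also have "\<dots> = real n powr (- real C)" using n by (simp add: powr_minus powr_realpow divide_inverse)
  also have "\<dots> \<le> real n powr (- c')" using n C by (intro powr_mono) auto
  finally show ?thesis .
qed

section \<open>The round bound in terms of the number of variables\<close>

lemma opt_le_sum_weight:
  assumes "feasible P x"
  shows "opt P \<le> (\<Sum>i<num_vars P. weight P i)"
proof -
  have "opt P \<le> cost P x" unfolding opt_def using assms by (intro cInf_lower) auto
  also have "\<dots> \<le> (\<Sum>i<num_vars P. weight P i)"
    unfolding cost_def
  proof (rule sum_mono)
    fix i assume "i \<in> {..<num_vars P}"
    then have "x i \<le> 1" using assms by (auto simp: feasible_def)
    then show "weight P i * x i \<le> weight P i" using mult_le_mono2[of "x i" 1 "weight P i"] by simp
  qed
  finally show ?thesis .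
qed

text \<open>Here the polynomial bound on the weights enters: it makes \<open>ln N\<close> linear in
  \<open>ln n\<close>. As \<open>n \<ge> 3\<close>, the factor \<open>ln n \<ge> 1\<close> absorbs
  the constant \<open>ln (K + 1)\<close>.\<close>

lemma ln_bound_le:
  fixes n N w K k :: nat and c :: real
  assumes n: "3 \<le> n" and w: "w \<le> K * n ^ k" and N: "real N \<le> real (max n w) powr c" "1 \<le> N" and c: "1 \<le> c"
  shows "ln (real N) \<le> c * (ln (real K + 1) + real k + 1) * ln (real n)"
proof -
  have ln1: "1 \<le> ln (real n)"
  proof -
    have "exp 1 \<le> real n" using exp_le n by linarith
    then show ?thesis using n by (subst ln_ge_iff) auto
  qed
  have "max n w \<le> (K + 1) * n ^ (k + 1)"
  proof -
    have "1 \<le> n ^ k" using n by simp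
    then have "n * 1 \<le> n * n ^ k" by (rule mult_le_mono2)
    also have "\<dots> \<le> (K + 1) * (n * n ^ k)" by simp
    finally have 1: "n \<le> (K + 1) * n ^ (k + 1)" by simp
    have "n ^ k \<le> n ^ (k + 1)" using n by (intro power_increasing) auto
    then have "K * n ^ k \<le> (K + 1) * n ^ (k + 1)" by (intro mult_le_mono) auto
    then show ?thesis using 1 w by simp
  qed
  then have "real (max n w) \<le> real ((K + 1) * n ^ (k + 1))" by (rule of_nat_mono)
  then have mx: "real (max n w) \<le> (real K + 1) * real n ^ (k + 1)"
    by (simp only: of_nat_mult of_nat_add of_nat_1 of_nat_power)
  have pos: "0 < real (max n w)" using n by simp
  have "ln (real N) \<le> ln (real (max n w) powr c)" using N pos by (subst ln_le_cancel_iff) auto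
  also have "\<dots> = c * ln (real (max n w))" using pos by (simp add: ln_powr)
  also have "\<dots> \<le> c * ln ((real K + 1) * real n ^ (k + 1))"
    using mx pos c n by (intro mult_left_mono) (auto simp: ln_le_cancel_iff)
  also have "ln ((real K + 1) * real n ^ (k + 1)) = ln (real K + 1) + (real k + 1) * ln (real n)"
  proof -
    have "ln (real n ^ (k + 1)) = real (k + 1) * ln (real n)" by (rule ln_realpow)
    moreover have "ln ((real K + 1) * real n ^ (k + 1)) = ln (real K + 1) + ln (real n ^ (k + 1))"
      using n by (intro ln_mult_pos zero_less_power) auto
    ultimately show ?thesis by simp
  qed
  also have "\<dots> \<le> (ln (real K + 1) + real k + 1) * ln (real n)"
  proof -
    have "ln (real K + 1) * 1 \<le> ln (real K + 1) * ln (real n)" using ln1 by (intro mult_left_mono) auto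
    then show ?thesis by (simp add: algebra_simps)
  qed
  finally show ?thesis using c by (simp add: mult.assoc)
qed

text \<open>\<open>levels\<close> is linear in \<open>X = ln (ln n) + ln (1 / \<epsilon>)\<close>,
  and \<open>a * log_bound N\<close> is linear in \<open>ln n\<close>. Additive constants are
  absorbed since \<open>X \<ge> ln (ln 3) > 0\<close> for \<open>n \<ge> 3\<close>.\<close>

lemma round_complexity:
  fixes a :: nat and A :: real
  assumes a: "1 \<le> a" and A: "1 \<le> A"
  obtains C :: real where "\<And>n N \<epsilon>. 3 \<le> n \<Longrightarrow> 1 \<le> N \<Longrightarrow> ln (real N) \<le> A * ln (real n) \<Longrightarrow> 0 < \<epsilon> \<Longrightarrow> \<epsilon> < 1 \<Longrightarrow>
    3600 * real (levels (a * log_bound N) \<epsilon> N) ^ 2 * real (a * log_bound N) / \<epsilon>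
      \<le> C * ((ln (ln (real n)) + ln (1 / \<epsilon>)) ^ 3 * ln (real n) / \<epsilon>)"
proof -
  define A' where "A' = 3 / 2 * A + 2"
  define x0 where "x0 = ln (ln (3::real))"
  define B0 where "B0 = 3 / 2 * ln 12 + 3 * ln (real a * A') + 1"
  define B where "B = B0 / x0 + 3"
  have A'1: "1 \<le> A'" using A by (simp add: A'_def)
  have aA: "1 \<le> real a * A'" using mult_mono[of 1 "real a" 1 A'] a A'1 by simp
  have l3: "1 < ln (3::real)"
  proof -
    have "exp 1 < (3::real)" using e_less_272 by linarith
    then have "ln (exp 1) < ln (3::real)" by (subst ln_less_cancel_iff) auto
    then show ?thesis by simp
  qed
  have x0: "0 < x0" using l3 by (simp add: x0_def)
  have B0: "0 \<le> B0" using aA by (simp add: B0_def)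
  show thesis
  proof (rule that[of "3600 * B ^ 2 * (real a * A') / x0"])
    fix n N :: nat and \<epsilon> :: real
    assume n: "3 \<le> n" and N: "1 \<le> N" and lnN: "ln (real N) \<le> A * ln (real n)" and \<epsilon>: "0 < \<epsilon>" "\<epsilon> < 1"
    let ?k = "a * log_bound N"
    define L where "L = ln (real n)"
    define X where "X = ln L + ln (1 / \<epsilon>)"
    have L: "ln 3 \<le> L" unfolding L_def using n by (subst ln_le_cancel_iff) auto
    have L1: "1 \<le> L" using L l3 by linarith
    have ln_eps: "0 \<le> ln (1 / \<epsilon>)" using \<epsilon> by (simp add: ln_ge_zero)
    have lnL: "x0 \<le> ln L" unfolding x0_def using L l3 by (subst ln_le_cancel_iff) auto
    have X: "x0 \<le> X" using ln_eps lnL by (simp add: X_def)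
    have inv: "y / ln 2 \<le> 3 / 2 * y" if "0 \<le> y" for y :: real
    proof -
      have "y * (2 / 3) \<le> y * ln 2" using ln2_ge_two_thirds that by (intro mult_left_mono) auto
      then show ?thesis by (simp add: pos_divide_le_eq)
    qed
    have k1: "1 \<le> ?k" using a log_bound_bounds(2)[OF N] by simp
    have "real (log_bound N) \<le> ln (real N) / ln 2 + 2" using log_bound_bounds(3)[OF N] by (simp add: log_def)
    also have "\<dots> \<le> 3 / 2 * ln (real N) + 2" using inv[of "ln (real N)"] N by simp
    also have "\<dots> \<le> 3 / 2 * (A * L) + 2 * L" using lnN L1 by (simp add: L_def)
    also have "\<dots> = A' * L" by (simp add: A'_def algebra_simps)
    finally have "real (log_bound N) \<le> A' * L" .
    then have kL: "real ?k \<le> real a * A' * L" using a by (simp add: mult_left_mono mult.assoc)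
    have kpos: "0 < real ?k" using k1 by linarith
    have lnk: "ln (real ?k) \<le> ln (real a * A') + ln L"
    proof -
      have "ln (real ?k) \<le> ln (real a * A' * L)" using kL kpos by (subst ln_le_cancel_iff) auto
      also have "\<dots> = ln (real a * A') + ln L" using aA L1 by (subst ln_mult) auto
      finally show ?thesis .
    qed
    have lnk0: "0 \<le> ln (real ?k)" using k1 by (intro ln_ge_zero) linarith
    note sb = slack_bounds[OF \<epsilon> N k1]
    have "real (levels ?k \<epsilon> N) \<le> log 2 (12 * real ?k ^ 2 / slack \<epsilon> N) + 1"
      by (rule levels_bounds(3)[OF \<epsilon> N k1])
    also have "log 2 (12 * real ?k ^ 2 / slack \<epsilon> N) \<le> log 2 (12 * real ?k ^ 2 * (1 / \<epsilon>))"
    proof (subst log_le_cancel_iff)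
      show "12 * real ?k ^ 2 / slack \<epsilon> N \<le> 12 * real ?k ^ 2 * (1 / \<epsilon>)"
        using mult_left_mono[OF sb(5), of "12 * real ?k ^ 2"] by simp
      show "0 < 12 * real ?k ^ 2 / slack \<epsilon> N" using kpos sb(1) by (intro divide_pos_pos mult_pos_pos zero_less_power) (assumption | simp)+
      show "0 < 12 * real ?k ^ 2 * (1 / \<epsilon>)" using kpos \<epsilon> by (intro mult_pos_pos zero_less_power) (assumption | simp)+
    qed simp
    also have "log 2 (12 * real ?k ^ 2 * (1 / \<epsilon>)) = (ln 12 + 2 * ln (real ?k) + ln (1 / \<epsilon>)) / ln 2"
    proof -
      have "ln (12 * real ?k ^ 2 * (1 / \<epsilon>)) = ln (12 * real ?k ^ 2) + ln (1 / \<epsilon>)"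
        using kpos \<epsilon> by (intro ln_mult_pos mult_pos_pos zero_less_power divide_pos_pos) (assumption | simp)+
      also have "ln (12 * real ?k ^ 2) = ln 12 + 2 * ln (real ?k)"
      proof -
        have "ln (12 * real ?k ^ 2) = ln 12 + ln (real ?k ^ 2)"
          using kpos by (intro ln_mult_pos zero_less_power) (assumption | simp)+
        then show ?thesis using ln_realpow[of "real ?k" 2] by simp
      qed
      finally show ?thesis by (simp add: log_def)
    qed
    also have "\<dots> \<le> 3 / 2 * (ln 12 + 2 * ln (real ?k) + ln (1 / \<epsilon>))"
      using lnk0 ln_eps by (intro inv) (simp add: add_nonneg_nonneg)
    also have "3 / 2 * (ln 12 + 2 * ln (real ?k) + ln (1 / \<epsilon>)) + 1 \<le> B0 + 3 * X"
    proof -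
      have "3 / 2 * (ln 12 + 2 * ln (real ?k) + ln (1 / \<epsilon>)) + 1
        = 3 / 2 * ln 12 + 3 * ln (real ?k) + 3 / 2 * ln (1 / \<epsilon>) + 1" by (simp add: algebra_simps)
      also have "\<dots> \<le> 3 / 2 * ln 12 + 3 * (ln (real a * A') + ln L) + 3 * ln (1 / \<epsilon>) + 1"
        using lnk ln_eps by (intro add_mono mult_left_mono order_refl mult_right_mono) simp_all
      also have "\<dots> = B0 + 3 * X" by (simp add: B0_def X_def algebra_simps)
      finally show ?thesis .
    qed
    also have "B0 + 3 * X \<le> B * X"
    proof -
      have "B0 * 1 \<le> B0 * (X / x0)" using B0 X x0 by (intro mult_left_mono) auto
      then show ?thesis by (simp add: B_def algebra_simps)
    qed
    finally have tX: "real (levels ?k \<epsilon> N) \<le> B * X" by simp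
    have "real (levels ?k \<epsilon> N) ^ 2 \<le> (B * X) ^ 2" using tX by (intro power_mono) auto
    also have "\<dots> = B ^ 2 * (X ^ 2 * 1)" by (simp add: power_mult_distrib)
    \<comment> \<open>The levels enter squared; the third factor \<open>X\<close> of the claimed
      bound is obtained from \<open>1 \<le> X / x0\<close>.\<close>
    also have "\<dots> \<le> B ^ 2 * (X ^ 2 * (X / x0))" using X x0 by (intro mult_left_mono) auto
    also have "\<dots> = B ^ 2 / x0 * X ^ 3" by (simp add: power3_eq_cube power2_eq_square)
    finally have t2: "real (levels ?k \<epsilon> N) ^ 2 \<le> B ^ 2 / x0 * X ^ 3" .
    have X3: "0 \<le> B ^ 2 / x0 * X ^ 3" using X x0 by simp
    have "real (levels ?k \<epsilon> N) ^ 2 * real ?k \<le> (B ^ 2 / x0 * X ^ 3) * (real a * A' * L)"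
      using t2 kL X3 by (intro mult_mono) auto
    then have "3600 * (real (levels ?k \<epsilon> N) ^ 2 * real ?k) / \<epsilon> \<le> 3600 * ((B ^ 2 / x0 * X ^ 3) * (real a * A' * L)) / \<epsilon>"
      using \<epsilon> by (intro divide_right_mono mult_left_mono) auto
    also have "\<dots> = 3600 * B ^ 2 * (real a * A') / x0 * (X ^ 3 * L / \<epsilon>)" by simp
    finally show "3600 * real (levels ?k \<epsilon> N) ^ 2 * real ?k / \<epsilon>
      \<le> 3600 * B ^ 2 * (real a * A') / x0 * ((ln (ln (real n)) + ln (1 / \<epsilon>)) ^ 3 * ln (real n) / \<epsilon>)"
      by (simp add: X_def L_def mult.assoc)
  qed
qed

theorem theorem1p7:
  fixes K k :: nat and c c' :: real
  assumes "c \<ge> 1" and "c' > 0"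
  shows "\<exists>(Alg :: (data, data) local_algorithm) (C :: real).
    \<forall>(P :: covering_problem) (\<epsilon> :: real) (N :: nat) (nb :: nat \<Rightarrow> nat list).
      valid_problem P \<longrightarrow>
      (\<exists>x. feasible P x) \<longrightarrow>
      (\<Sum>i<num_vars P. weight P i) \<le> K * num_vars P ^ k \<longrightarrow>
      0 < \<epsilon> \<longrightarrow> \<epsilon> < 1 \<longrightarrow>
      max (num_vars P) (opt P) \<le> N \<longrightarrow>
      real N \<le> real (max (num_vars P) (opt P)) powr c \<longrightarrow>
      port_numbering P nb \<longrightarrow>
        (num_vars P \<ge> 3 \<longrightarrow>
          real (rounds Alg \<epsilon> N)
            \<le> C * ((ln (ln (real (num_vars P))) + ln (1 / \<epsilon>)) ^ 3 * ln (real (num_vars P)) / \<epsilon>)) \<and>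
        success_event Alg P \<epsilon> N nb \<in> sets (random_bits P) \<and>
        measure (random_bits P) (success_event Alg P \<epsilon> N nb)
          \<ge> 1 - real (num_vars P) powr (- c')"
proof -
  define D where "D = nat \<lceil>c'\<rceil>"
  define a where "a = 2 * (12 + D) + 8"
  define kf where "kf = (\<lambda>(\<epsilon>::real) N. a * log_bound N)"
  define tf where "tf = (\<lambda>\<epsilon> N. levels (kf \<epsilon> N) \<epsilon> N)"
  define gf where "gf = (\<lambda>\<epsilon> N. gap (kf \<epsilon> N) \<epsilon> N)"
  \<comment> \<open>\<open>N\<close> stands in for the number of variables, which no vertex knows,
    so that \<open>k * n \<le> m\<close>.\<close>
  define mf where "mf = (\<lambda>\<epsilon> N. kf \<epsilon> N * N)"
  define Alg where "Alg = carving_algorithm kf block_length tf gf mf"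
  define A where "A = c * (ln (real K + 1) + real k + 1)"
  have a1: "1 \<le> a" by (simp add: a_def)
  have A1: "1 \<le> A"
  proof -
    have "1 * 1 \<le> c * (ln (real K + 1) + real k + 1)" using assms by (intro mult_mono) auto
    then show ?thesis by (simp add: A_def)
  qed
  obtain C where C: "\<And>n N \<epsilon>. 3 \<le> n \<Longrightarrow> 1 \<le> N \<Longrightarrow> ln (real N) \<le> A * ln (real n) \<Longrightarrow> 0 < \<epsilon> \<Longrightarrow> \<epsilon> < 1 \<Longrightarrow>
    3600 * real (levels (a * log_bound N) \<epsilon> N) ^ 2 * real (a * log_bound N) / \<epsilon>
      \<le> C * ((ln (ln (real n)) + ln (1 / \<epsilon>)) ^ 3 * ln (real n) / \<epsilon>)"
    using round_complexity[OF a1 A1] by blast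
  show ?thesis
  proof (rule exI[of _ Alg], rule exI[of _ C], intro allI impI)
    fix P :: covering_problem and \<epsilon> :: real and N :: nat and nb :: "nat \<Rightarrow> nat list"
    let ?n = "num_vars P"
    assume valid: "valid_problem P" and feasible: "\<exists>x. feasible P x"
      and weights: "(\<Sum>i<?n. weight P i) \<le> K * ?n ^ k" and \<epsilon>: "0 < \<epsilon>" "\<epsilon> < 1"
      and N: "max ?n (opt P) \<le> N" "real N \<le> real (max ?n (opt P)) powr c" and ports: "port_numbering P nb"
    have n: "1 \<le> ?n" using valid by (simp add: valid_problem_def)
    have N1: "1 \<le> N" using n N by simp
    have k1: "1 \<le> kf \<epsilon> N" using a1 log_bound_bounds(2)[OF N1] by (simp add: kf_def)
    interpret instance_with_parameters P \<epsilon> N nb "kf \<epsilon> N" "block_length \<epsilon> N" "tf \<epsilon> N" "gf \<epsilon> N" "mf \<epsilon> N" "slack \<epsilon> N"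
    proof
      show "0 < kf \<epsilon> N" using k1 by simp
      show "4 \<le> block_length \<epsilon> N" by (rule block_length_bounds(3)[OF \<epsilon> N1 k1])
      show "0 < gf \<epsilon> N" unfolding gf_def by (rule gap_bounds(2)[OF \<epsilon> N1 k1])
      show "0 < tf \<epsilon> N" unfolding tf_def by (rule levels_bounds(2)[OF \<epsilon> N1 k1])
      show "0 < mf \<epsilon> N" "kf \<epsilon> N * ?n \<le> mf \<epsilon> N" using k1 N1 N by (auto simp: mf_def)
      show "4 * (1 - (1 - 1 / 2 ^ block_length \<epsilon> N) ^ 3) + 3 * real (kf \<epsilon> N) ^ 2 / 2 ^ tf \<epsilon> N
          + 27 * real (tf \<epsilon> N) * real (kf \<epsilon> N) / real (gf \<epsilon> N) \<le> slack \<epsilon> N"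
        unfolding tf_def gf_def by (rule total_error[OF \<epsilon> N1 k1])
    qed (fact valid feasible ports)+
    have optN: "opt P \<le> N" "0 < N" using N N1 by auto
    note sp = success_probability[of kf block_length tf gf mf, OF refl refl refl refl refl slack_def optN \<epsilon>(1), folded Alg_def]
    have rounds: "real (rounds Alg \<epsilon> N)
        \<le> C * ((ln (ln (real ?n)) + ln (1 / \<epsilon>)) ^ 3 * ln (real ?n) / \<epsilon>)" if n3: "3 \<le> ?n"
    proof -
      obtain x where "feasible P x" using feasible by auto
      then have "opt P \<le> K * ?n ^ k" using opt_le_sum_weight weights by (meson le_trans)
      then have lnN: "ln (real N) \<le> A * ln (real ?n)"
        unfolding A_def using ln_bound_le[OF n3 _ N(2) N1 assms(1)] by blast
      have "real (rounds Alg \<epsilon> N) \<le> 3600 * real (levels (kf \<epsilon> N) \<epsilon> N) ^ 2 * real (kf \<epsilon> N) / \<epsilon>"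
        using rounds_le[OF \<epsilon> N1 k1] by (simp add: Alg_def carving_algorithm_def tf_def gf_def)
      also have "\<dots> \<le> C * ((ln (ln (real ?n)) + ln (1 / \<epsilon>)) ^ 3 * ln (real ?n) / \<epsilon>)"
        using C[OF n3 N1 lnN \<epsilon>] by (simp add: kf_def)
      finally show ?thesis .
    qed
    have fail: "real (?n ^ 2 + ?n * (mf \<epsilon> N + tf \<epsilon> N) + ?n + 2 + tf \<epsilon> N * ?n + tf \<epsilon> N) * (1 / 2) ^ kf \<epsilon> N
      \<le> real ?n powr (- c')"
      unfolding kf_def a_def
    proof (rule failure_le)
      show "1 \<le> ?n" "?n \<le> N" using n N by auto
      show "mf \<epsilon> N = (2 * (12 + D) + 8) * log_bound N * N" by (simp add: mf_def kf_def a_def)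
      show "real (tf \<epsilon> N) \<le> 48 * real ((2 * (12 + D) + 8) * log_bound N) ^ 2 * real N + 1"
        using levels_le[OF \<epsilon> N1 k1] by (simp only: tf_def kf_def a_def)
      show "c' \<le> real D" by (simp add: D_def real_nat_ceiling_ge)
    qed
    show "(3 \<le> ?n \<longrightarrow> real (rounds Alg \<epsilon> N)
            \<le> C * ((ln (ln (real ?n)) + ln (1 / \<epsilon>)) ^ 3 * ln (real ?n) / \<epsilon>)) \<and>
        success_event Alg P \<epsilon> N nb \<in> sets (random_bits P) \<and>
        1 - real ?n powr (- c') \<le> measure (random_bits P) (success_event Alg P \<epsilon> N nb)"
      using rounds sp(1) order_trans[OF diff_left_mono[OF fail] sp(2)] by blast
  qed
qed

end
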